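(* Let $G$ be a (finite, loopless) multigraph of order $n \geq 3$ with at least one edge. Then $$\chi'(G) \leq \phi(G) + \log_{3/2}\bigl(\min\{n/3,\ \phi(G)\}\bigr) \quad \text{if } n \text{ is even},$$ and $$\chi'(G) \leq \phi(G) + \log_{3/2}\bigl(\min\{(n+1)/3,\ \phi(G)\}\bigr) \quad \text{if } n \text{ is odd}.$$
   Context: Multigraphs are finite and loopless, multiple edges allowed. $\chi'(G)$ is the chromatic index (minimum number of matchings covering $E(G)$) and $\Delta(G)$ the maximum degree. For a multigraph $H$ of odd order $n(H) \ge 3$ with $e(H)$ edges, let $t(H) = 2e(H)/(n(H)-1)$. For $S \subseteq V(G)$, $\langle S\rangle$ denotes the induced subgraph. Let $\Gamma(G) = \max\{ t(\langle S\rangle) : S \subseteq V(G),\ |S| \text{ odd},\ |S|\ge 3\}$. The fractional chromatic index is $\chi_f(G) = \max\{\Delta(G), \Gamma(G)\}$ (and $\chi_f(G)=\Delta(G)$ if $G$ has fewer than 3 vertices), and $\phi(G) = \lceil \chi_f(G) \rceil$. *)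

theory Defs
  imports "HOL-Analysis.Analysis"
begin

text \<open>A finite loopless multigraph is given by a finite vertex set V, a finite set E of
edge identifiers and an endpoint map ends; each edge has exactly two distinct endpoints
in V. Parallel edges are distinct elements of E with the same endpoints.\<close>

definition multigraph :: "'a set \<Rightarrow> 'e set \<Rightarrow> ('e \<Rightarrow> 'a set) \<Rightarrow> bool" where
  "multigraph V E ends \<longleftrightarrow> finite V \<and> finite E \<and>
     (\<forall>e\<in>E. ends e \<subseteq> V \<and> card (ends e) = 2)"

definition proper_edge_colouring :: "'e set \<Rightarrow> ('e \<Rightarrow> 'a set) \<Rightarrow> nat \<Rightarrow> ('e \<Rightarrow> nat) \<Rightarrow> bool" where
  "proper_edge_colouring E ends k c \<longleftrightarrow>
     (\<forall>e\<in>E. c e < k) \<and>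
     (\<forall>e\<in>E. \<forall>f\<in>E. e \<noteq> f \<and> ends e \<inter> ends f \<noteq> {} \<longrightarrow> c e \<noteq> c f)"

definition chromatic_index :: "'e set \<Rightarrow> ('e \<Rightarrow> 'a set) \<Rightarrow> nat" where
  "chromatic_index E ends = (LEAST k. \<exists>c. proper_edge_colouring E ends k c)"

definition degree :: "'e set \<Rightarrow> ('e \<Rightarrow> 'a set) \<Rightarrow> 'a \<Rightarrow> nat" where
  "degree E ends v = card {e\<in>E. v \<in> ends e}"

definition max_degree :: "'a set \<Rightarrow> 'e set \<Rightarrow> ('e \<Rightarrow> 'a set) \<Rightarrow> nat" where
  "max_degree V E ends = Max (degree E ends ` V)"

definition induced_edges :: "'e set \<Rightarrow> ('e \<Rightarrow> 'a set) \<Rightarrow> 'a set \<Rightarrow> nat" where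
  "induced_edges E ends S = card {e\<in>E. ends e \<subseteq> S}"

definition Gamma :: "'a set \<Rightarrow> 'e set \<Rightarrow> ('e \<Rightarrow> 'a set) \<Rightarrow> real" where
  "Gamma V E ends = Max ((\<lambda>S. 2 * real (induced_edges E ends S) / (real (card S) - 1)) `
       {S. S \<subseteq> V \<and> odd (card S) \<and> card S \<ge> 3})"

definition frac_chromatic_index :: "'a set \<Rightarrow> 'e set \<Rightarrow> ('e \<Rightarrow> 'a set) \<Rightarrow> real" where
  "frac_chromatic_index V E ends =
     (if card V < 3 then real (max_degree V E ends)
      else max (real (max_degree V E ends)) (Gamma V E ends))"

definition phi :: "'a set \<Rightarrow> 'e set \<Rightarrow> ('e \<Rightarrow> 'a set) \<Rightarrow> int" where
  "phi V E ends = \<lceil>frac_chromatic_index V E ends\<rceil>"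

end

theory Submission
  imports Defs
begin

text \<open>Write \<open>gap r X = r |X| - 2 e(X)\<close>, which is the total deficiency of \<open>X\<close> with respect to degree \<open>r\<close>
plus the size of its edge cut; \<open>\<chi>\<^sub>f \<le> r\<close> means that all degrees are at most \<open>r\<close> and \<open>gap r X \<ge> r\<close> for all odd \<open>X\<close>.
Allow one colour more than \<open>r\<close>, so that every vertex has deficiency at least one, and remove perfect
matchings one after the other. When a removal would destroy \<open>\<chi>\<^sub>f \<le> r\<close>, an odd set with a small gap is to blame;
contracting such a set, or its complement, keeps \<open>\<chi>\<^sub>f \<le> r\<close> if the gap is minimal, and colourings of the two
contracted graphs can be glued along the cut. This can only get stuck when a vertex of large deficiency
dominates, and then the order has dropped by a factor \<open>2/3\<close>, or when such a vertex has become isolated, and then \<open>r\<close>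
is at most about a third of the order. In the latter case a second additional colour makes all deficiencies
at least two, and then \<open>r\<close> can be decreased by a factor \<open>2/3\<close> at the cost of matchings that miss two vertices each.\<close>

section \<open>Tutte's theorem\<close>

text \<open>An odd set that blocks a matching has a small gap, but contracting needs minimal gaps on
  both sides, and the trivial odd sets can spoil this: a single vertex has gap \<open>r\<close>, and
  \<open>V - {y}\<close> has gap \<open>r\<close> plus the total deficiency minus twice the
  deficiency of \<open>y\<close>. Single vertices are kept out by positive deficiencies; the sets
  \<open>V - {y}\<close> are the real obstacle and bring in the dominating vertex. The factor 2/3
  comes from counting: the total deficiency starts at most at the order n and never grows, so with
  all deficiencies at least 1 no vertex can dominate while the order exceeds roughly 2 n / 3. An
  isolated \<open>y\<close> has deficiency \<open>r\<close>, so then \<open>r\<close> is at most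
  roughly n / 3. With k additional colours the recursions reach orders up to 5 (3/2)^k + 2 and, if
  all deficiencies are at least 2, values of \<open>r\<close> up to 15/4 (3/2)^k + 2. The first
  bound for k uses itself at k - 1 and the second at k - 2, which forces 15/4 = 5 (3/2)^2 - 5 (3/2).
  The logarithm in the theorem asks for less: 9/2 and 27/8 in place of 5 and 15/4.\<close>

definition pmatch :: "('a \<Rightarrow> 'a \<Rightarrow> bool) \<Rightarrow> 'a set \<Rightarrow> bool" where
  "pmatch R V \<longleftrightarrow> (\<exists>f. \<forall>v\<in>V. f v \<in> V \<and> f (f v) = v \<and> R v (f v))"

lemma pmatch_Union:
  assumes "disjoint P" "\<And>B. B \<in> P \<Longrightarrow> pmatch R B"
  shows "pmatch R (\<Union>P)"
proof -
  from assms(2) obtain F where F: "\<And>B v. B \<in> P \<Longrightarrow> v \<in> B \<Longrightarrow> F B v \<in> B \<and> F B (F B v) = v \<and> R v (F B v)"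
    unfolding pmatch_def by metis
  define b where "b v = (THE B. B \<in> P \<and> v \<in> B)" for v
  have b: "b v = B" if "B \<in> P" "v \<in> B" for v B
    unfolding b_def using that assms(1) by (intro the_equality) (auto simp: disjoint_def)
  have "\<forall>v\<in>\<Union>P. F (b v) v \<in> \<Union>P \<and> F (b (F (b v) v)) (F (b v) v) = v \<and> R v (F (b v) v)"
  proof
    fix v assume "v \<in> \<Union>P"
    then obtain B where B: "B \<in> P" "v \<in> B" by blast
    have "b (F B v) = B" using F[OF B] b[OF B(1)] by blast
    then show "F (b v) v \<in> \<Union>P \<and> F (b (F (b v) v)) (F (b v) v) = v \<and> R v (F (b v) v)"
      using F[OF B] b[OF B] B by auto
  qed
  then show ?thesis unfolding pmatch_def by (intro exI[of _ "\<lambda>v. F (b v) v"]) simp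
qed

lemma pmatch_clique:
  assumes "finite B" "even (card B)" "symp R" "\<And>u v. u \<in> B \<Longrightarrow> v \<in> B \<Longrightarrow> u \<noteq> v \<Longrightarrow> R u v"
  shows "pmatch R B"
  using assms
proof (induction "card B" arbitrary: B rule: less_induct)
  case less
  show ?case
  proof (cases "B = {}")
    case True then show ?thesis by (simp add: pmatch_def)
  next
    case False
    then obtain x where x: "x \<in> B" by blast
    have "B \<noteq> {x}" using less.prems(2) by auto
    then obtain y where y: "y \<in> B" "y \<noteq> x" using x by blast
    let ?C = "B - {x,y}"
    have c: "card ?C + 2 = card B"
      using x y less.prems(1) card_Diff_subset[of "{x,y}" B] card_mono[of B "{x,y}"] by auto
    then have ev: "even (card ?C)" using less.prems(2) by presburger
    have "pmatch R ?C"
      by (rule less.hyps) (use c ev less.prems in auto)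
    moreover have "pmatch R {x,y}"
      unfolding pmatch_def
      by (rule exI[of _ "\<lambda>v. if v = x then y else x"]) (use x y less.prems(4) in auto)
    moreover have "disjoint {?C, {x,y}}" by (auto simp: disjoint_def)
    ultimately have "pmatch R (\<Union>{?C, {x,y}})" by (intro pmatch_Union) auto
    moreover have "\<Union>{?C, {x,y}} = B" using x y by auto
    ultimately show ?thesis by simp
  qed
qed

text \<open>The union of two perfect matchings \<open>f\<close> and \<open>g\<close> is bipartite: \<open>(g \<circ> f)\<^sup>i y\<close> and \<open>f ((g \<circ> f)\<^sup>j y)\<close> lie on different sides.\<close>

lemma alternating_walk_bipartite:
  assumes f: "\<forall>v\<in>V. f v \<in> V \<and> f (f v) = v \<and> f v \<noteq> v"
    and g: "\<forall>v\<in>V. g v \<in> V \<and> g (g v) = v \<and> g v \<noteq> v"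
    and y: "y \<in> V"
  shows "((g \<circ> f) ^^ i) y \<noteq> f (((g \<circ> f) ^^ j) y)"
proof -
  let ?h = "\<lambda>i. ((g \<circ> f) ^^ i) y"
  have V: "?h i \<in> V" for i by (induction i) (use y f g in auto)
  \<comment> \<open>Cancelling \<open>f\<close> and \<open>g\<close> moves the two indices one step
    towards each other; the descent ends at a fixed point of \<open>f\<close> or of
    \<open>g\<close>.\<close>
  have red: "?h i \<noteq> f (?h j)" if "j \<le> i" for i j
    using that
  proof (induction "i - j" arbitrary: i j rule: less_induct)
    case less
    consider "i = j" | "i = Suc j" | "j + 2 \<le> i" using less.prems by linarith
    then show ?case
    proof cases
      case 1 then show ?thesis using f V by metis
    next
      case 2 then show ?thesis using f g V[of j] by (metis comp_apply funpow.simps(2))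
    next
      case 3
      then obtain i' where i': "i = Suc i'" "Suc j \<le> i'" by (cases i) auto
      have ih: "?h i' \<noteq> f (?h (Suc j))" using less.hyps[of i' "Suc j"] i' by auto
      show ?thesis
      proof
        assume "?h i = f (?h j)"
        then have "g (f (?h i')) = f (?h j)" using i' by simp
        then have "f (?h i') = g (f (?h j))" using f g V by metis
        then have "f (?h i') = ?h (Suc j)" by simp
        then show False using ih f V by metis
      qed
    qed
  qed
  show ?thesis
  proof (cases "j \<le> i")
    case True then show ?thesis by (rule red)
  next
    case False
    then have "?h j \<noteq> f (?h i)" by (intro red) auto
    then show ?thesis using f V by metis
  qed
qed

text \<open>Lovasz's exchange step. \<open>f\<close> and \<open>g\<close> are perfect matchings up
  to one foreign pair each, \<open>{x,z}\<close> and \<open>{y,w}\<close>, and \<open>y\<close> is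
  adjacent to \<open>x\<close> and \<open>z\<close>. Follow the cycle through \<open>y\<close> in
  the union of both. If it misses \<open>x\<close> and \<open>z\<close>, take \<open>f\<close> on it
  and \<open>g\<close> elsewhere; otherwise stop at the first of \<open>x\<close>, \<open>z\<close>
  and close up with an edge at \<open>y\<close>.\<close>

lemma pmatch_exchange:
  assumes fin: "finite V" and sym: "symp R" and irr: "irreflp R"
    and f: "\<forall>v\<in>V. f v \<in> V \<and> f (f v) = v \<and> (R v (f v) \<or> {v, f v} = {x,z})"
    and g: "\<forall>v\<in>V. g v \<in> V \<and> g (g v) = v \<and> (R v (g v) \<or> {v, g v} = {y,w})"
    and xyz: "x \<in> V" "y \<in> V" "z \<in> V" "w \<in> V" "R x y" "R y z" "x \<noteq> z" "y \<noteq> w"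
    and fxz: "f x = z" and gyw: "g y = w"
  shows "pmatch R V"
proof -
  have fV: "f v \<in> V" "f (f v) = v" "g v \<in> V" "g (g v) = v" if "v \<in> V" for v using f g that by auto
  have nR: "\<not> R v v" for v using irr by (simp add: irreflpD)
  have f': "\<forall>v\<in>V. f v \<in> V \<and> f (f v) = v \<and> f v \<noteq> v"
    using f xyz nR by (metis doubleton_eq_iff)
  have g': "\<forall>v\<in>V. g v \<in> V \<and> g (g v) = v \<and> g v \<noteq> v"
    using g xyz nR by (metis doubleton_eq_iff)
  have fR: "R v (f v)" if "v \<in> V" "v \<noteq> x" "v \<noteq> z" for v using f that by (metis insert_iff doubleton_eq_iff)
  have gR: "R v (g v)" if "v \<in> V" "v \<noteq> y" "v \<noteq> w" for v using g that by (metis insert_iff doubleton_eq_iff)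
  have fz: "f z = x" using fxz xyz f by metis
  have gw: "g w = y" using gyw xyz g by metis
  have yxz: "y \<noteq> x" "y \<noteq> z" using xyz nR by auto
  define h where "h i = ((g \<circ> f) ^^ i) y" for i
  have h0: "h 0 = y" and hS: "h (Suc i) = g (f (h i))" for i by (auto simp: h_def)
  have hV: "h i \<in> V" for i by (induction i) (use xyz f g in \<open>auto simp: h0 hS\<close>)
  have hf: "h i \<noteq> f (h j)" for i j
    unfolding h_def by (rule alternating_walk_bipartite[OF f' g' xyz(2)])
  have shift: "h i = h j" if "h (i + k) = h (j + k)" for i j k
    using that
  proof (induction k)
    case (Suc k)
    have "g (f (h (i + k))) = g (f (h (j + k)))" using Suc.prems by (simp add: hS)
    then have "h (i + k) = h (j + k)" using fV hV by metis
    then show ?case using Suc by blast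
  qed auto
  have ret: "\<exists>p>0. h p = y"
  proof -
    have "finite (range h)" using hV fin by (meson finite_subset image_subsetI)
    then have "\<not> inj h" using finite_imageD infinite_UNIV_nat by blast
    then obtain i j where ij: "h i = h j" "i < j" by (metis injI linorder_neqE_nat)
    have "h (0 + i) = h ((j - i) + i)" using ij by auto
    then have "h 0 = h (j - i)" by (rule shift)
    then show ?thesis using ij h0 by (intro exI[of _ "j - i"]) auto
  qed
  show ?thesis
  proof (cases "\<exists>m. h m \<in> {x,z}")
    case False
    define Orb where "Orb = range h \<union> f ` range h"
    have bk: "\<exists>j. h i = g (f (h j))" for i
    proof (cases i)
      case 0
      obtain p where "p > 0" "h p = y" using ret by blast
      then show ?thesis using 0 h0 hS by (metis gr0_implies_Suc)
    next
      case (Suc j) then show ?thesis using hS by blast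
    qed
    have gO: "g v \<in> Orb" if "v \<in> Orb" for v
    proof -
      from that consider i where "v = h i" | i where "v = f (h i)" unfolding Orb_def by blast
      then show ?thesis
      proof cases
        case 1
        obtain j where "h i = g (f (h j))" using bk by blast
        then have "g v = f (h j)" using 1 fV hV by metis
        then show ?thesis unfolding Orb_def by blast
      next
        case 2
        then have "g v = h (Suc i)" by (simp add: hS)
        then show ?thesis unfolding Orb_def by blast
      qed
    qed
    have fO: "f v \<in> Orb" if "v \<in> Orb" for v using that fV hV unfolding Orb_def by auto
    have xO: "x \<notin> Orb" "z \<notin> Orb"
    proof -
      have "h i \<noteq> x" "h i \<noteq> z" for i using False by auto
      moreover have "f (h i) \<noteq> x" "f (h i) \<noteq> z" for i
        using calculation fxz fz fV(2)[OF hV[of i]] by metis+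
      ultimately show "x \<notin> Orb" "z \<notin> Orb" unfolding Orb_def by blast+
    qed
    have yO: "y \<in> Orb" using h0 unfolding Orb_def by (metis UnI1 rangeI)
    have wO: "w \<in> Orb" using gO[OF yO] gyw by simp
    show ?thesis unfolding pmatch_def
    proof (intro exI[of _ "\<lambda>v. if v \<in> Orb then f v else g v"] ballI)
      fix v assume v: "v \<in> V"
      show "(if v \<in> Orb then f v else g v) \<in> V \<and>
        (if (if v \<in> Orb then f v else g v) \<in> Orb then f (if v \<in> Orb then f v else g v) else g (if v \<in> Orb then f v else g v)) = v \<and>
        R v (if v \<in> Orb then f v else g v)"
      proof (cases "v \<in> Orb")
        case True
        then show ?thesis using fO[OF True] fR[OF v] xO fV[OF v] by auto
      next
        case False
        have "g v \<notin> Orb" using gO[of "g v"] fV[OF v] False by auto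
        moreover have "R v (g v)" using gR[OF v] yO wO False by metis
        ultimately show ?thesis using False fV[OF v] by simp
      qed
    qed
  next
    case True
    define m where "m = (LEAST m. h m \<in> {x,z})"
    have hm: "h m \<in> {x,z}" unfolding m_def using True by (rule LeastI_ex)
    have lm: "h i \<notin> {x,z}" if "i < m" for i using that not_less_Least unfolding m_def by blast
    have m0: "m > 0" using hm yxz h0 by (cases m) auto
    \<comment> \<open>The walk from \<open>y\<close> reaches the pair \<open>{x,z}\<close> in
      \<open>x'\<close> and continues to \<open>z'\<close>. The vertices strictly between
      \<open>y\<close> and \<open>z'\<close> are paired off by \<open>g\<close>, so \<open>y\<close>
      can be matched with \<open>z'\<close>, with \<open>g\<close> in between and \<open>f\<close>
      on everything else; neither foreign pair is used.\<close>
    define x' where "x' = h m"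
    define z' where "z' = f x'"
    have z': "z' \<in> {x,z}" "z' \<noteq> x'" "{x',z'} = {x,z}" using hm fxz fz xyz by (auto simp: x'_def z'_def)
    have Ryz: "R y z'" using z'(1) xyz sym by (auto dest: sympD)
    have hy: "h i \<noteq> y" if "0 < i" "i \<le> m" for i
    proof
      assume "h i = y"
      then have "h (0 + (m - i)) = h m" using h0 that
      proof -
        have "h (k + i) = h k" for k using \<open>h i = y\<close> by (induction k) (auto simp: h0 hS)
        from this[of "m - i"] that show ?thesis by simp
      qed
      then show False using lm[of "m - i"] that hm by auto
    qed
    let ?A = "h ` {1..m}" and ?B = "(\<lambda>i. f (h i)) ` {..<m}"
    have gA: "g v \<in> ?B" if "v \<in> ?A" for v
    proof -
      obtain i where i: "i \<in> {1..m}" "v = h i" using \<open>v \<in> ?A\<close> by blast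
      then obtain j where j: "i = Suc j" by (cases i) auto
      have "g v = f (h j)" using i j hS fV hV by metis
      then show ?thesis using i j by auto
    qed
    have gB: "g v \<in> ?A" if "v \<in> ?B" for v
    proof -
      obtain i where i: "i < m" "v = f (h i)" using \<open>v \<in> ?B\<close> by blast
      then have "g v = h (Suc i)" by (simp add: hS)
      then show ?thesis using i by auto
    qed
    let ?S = "?A \<union> ?B"
    have gS: "g v \<in> ?S" if "v \<in> ?S" for v using gA gB that by blast
    have SV: "?S \<subseteq> V" using hV fV by auto
    have yS: "y \<notin> ?S"
    proof -
      have "y \<notin> ?A"
      proof
        assume "y \<in> ?A"
        then obtain i where "1 \<le> i" "i \<le> m" "y = h i" by auto
        then show False using hy[of i] by simp
      qed
      moreover have "y \<notin> ?B"
      proof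
        assume "y \<in> ?B"
        then obtain i where "y = f (h i)" by auto
        then show False using hf[of 0 i] h0 by simp
      qed
      ultimately show ?thesis by blast
    qed
    have zS: "z' \<notin> ?S"
    proof -
      have "z' \<noteq> h i" for i using hf[of i m] by (simp add: z'_def x'_def)
      moreover have "z' \<noteq> f (h i)" if "i < m" for i
      proof
        assume "z' = f (h i)"
        then have "h i = x'" using fV hV unfolding z'_def x'_def by metis
        then show False using lm[OF \<open>i < m\<close>] hm by (simp add: x'_def)
      qed
      ultimately show ?thesis by blast
    qed
    have yz': "y \<noteq> z'" using z'(1) yxz by auto
    let ?S' = "insert y (insert z' ?S)"
    have fS': "f v \<in> ?S'" if "v \<in> ?S'" for v
    proof -
      have A: "f (h i) \<in> ?S'" if "i \<le> m" for i
      proof (cases "i = m")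
        case True then show ?thesis by (simp add: z'_def x'_def)
      next
        case False then show ?thesis using that by auto
      qed
      have B: "h i \<in> ?S'" if "i \<le> m" for i
        using that h0 by (cases i) auto
      have "\<exists>i\<le>m. v = h i \<or> v = f (h i)"
      proof -
        from that consider "v = y" | "v = z'" | "v \<in> ?A" | "v \<in> ?B" by blast
        then show ?thesis
        proof cases
          case 1 then show ?thesis using h0 by (intro exI[of _ 0]) simp
        next
          case 2 then show ?thesis by (intro exI[of _ m]) (simp add: z'_def x'_def)
        next
          case 3
          then obtain i where "i \<le> m" "v = h i" by auto
          then show ?thesis by blast
        next
          case 4
          then obtain i where "i < m" "v = f (h i)" by auto
          then show ?thesis by (intro exI[of _ i]) simp
        qed
      qed
      then show ?thesis using A B fV hV by metis
    qed
    have S'V: "?S' \<subseteq> V" using SV xyz z' by auto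
    define k where "k v = (if v = y then z' else if v = z' then y else if v \<in> ?S then g v else f v)" for v
    show ?thesis unfolding pmatch_def
    proof (intro exI[of _ k] ballI)
      fix v assume v: "v \<in> V"
      consider "v = y" | "v = z'" | "v \<in> ?S" | "v \<notin> ?S'" by blast
      then show "k v \<in> V \<and> k (k v) = v \<and> R v (k v)"
      proof cases
        case 1
        then show ?thesis using Ryz S'V yz' by (auto simp: k_def)
      next
        case 2
        then show ?thesis using Ryz S'V yz' sym by (auto simp: k_def dest: sympD)
      next
        case 3
        then have "v \<noteq> y" "v \<noteq> z'" using yS zS by blast+
        then have kv: "k v = g v" using 3 by (simp add: k_def)
        have gv: "g v \<in> ?S" using gS 3 by blast
        then have "g v \<noteq> y" "g v \<noteq> z'" using yS zS by metis+
        then have "k (g v) = v" using gv fV[OF v] by (simp add: k_def)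
        moreover have "v \<noteq> w" using gw gv yS by metis
        then have "R v (g v)" using gR[OF v] \<open>v \<noteq> y\<close> by blast
        ultimately show ?thesis using kv fV[OF v] by simp
      next
        case 4
        then have kv: "k v = f v" by (auto simp: k_def)
        have fv: "f v \<notin> ?S'" using fS'[of "f v"] fV[OF v] 4 by auto
        then have "k (f v) = v" using fV[OF v] by (auto simp: k_def)
        moreover have "x' \<in> ?S'" using m0 by (auto simp: x'_def)
        then have "v \<noteq> x" "v \<noteq> z" using 4 z'(3) by (metis insert_iff doubleton_eq_iff)+
        then have "R v (f v)" using fR[OF v] by blast
        ultimately show ?thesis using kv fV[OF v] by simp
      qed
    qed
  qed
qed

lemma even_sum_iff_card_odd:
  fixes f :: "'a \<Rightarrow> nat"
  assumes "finite A"
  shows "even (sum f A) \<longleftrightarrow> even (card {a\<in>A. odd (f a)})"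
  using assms
proof (induction A)
  case (insert x F)
  have "{a \<in> insert x F. odd (f a)} = (if odd (f x) then insert x {a\<in>F. odd (f a)} else {a\<in>F. odd (f a)})"
    by auto
  then show ?case using insert by auto
qed auto

lemma even_card_disjoint_Union:
  assumes "finite (\<Union>P)" "disjoint P" "\<And>B. B \<in> P \<Longrightarrow> even (card B)"
  shows "even (card (\<Union>P))"
proof -
  have "card (\<Union>P) = sum card P"
    by (rule card_Union_disjoint)
      (use assms in \<open>auto simp: disjoint_def pairwise_def disjnt_def intro: finite_subset[OF Union_upper]\<close>)
  then show ?thesis using assms(3) by (simp add: dvd_sum)
qed

text \<open>In an edge-maximal graph without perfect matching, adjacency is transitive outside the
  set of vertices adjacent to all others, so the rest splits into cliques. \<open>P\<close> may
  consist of unions of components; hence an obstruction for a supergraph is literally one for the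
  graph itself.\<close>

theorem tutte_obstruction:
  assumes "finite V" "symp R" "irreflp R" "\<not> pmatch R V"
  shows "\<exists>T P. T \<subseteq> V \<and> \<Union>P = V - T \<and> disjoint P \<and>
    (\<forall>C\<in>P. \<forall>D\<in>P. \<forall>u\<in>C. \<forall>v\<in>D. R u v \<longrightarrow> C = D) \<and> card T < card {C\<in>P. odd (card C)}"
  using assms(2-)
proof (induction "card {p\<in>V\<times>V. fst p \<noteq> snd p \<and> \<not> R (fst p) (snd p)}" arbitrary: R rule: less_induct)
  case less
  note sym = less.prems(1) and irr = less.prems(2) and npm = less.prems(3)
  show ?case
  proof (cases "odd (card V)")
    case True
    then have "{C \<in> {V}. odd (card C)} = {V}" by auto
    then show ?thesis by (intro exI[of _ "{}"] exI[of _ "{V}"]) auto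
  next
    case False
    show ?thesis
    proof (cases "\<exists>u\<in>V. \<exists>v\<in>V. u \<noteq> v \<and> \<not> R u v \<and> \<not> pmatch (\<lambda>a b. R a b \<or> {a,b} = {u,v}) V")
      case True
      then obtain u v where uv: "u \<in> V" "v \<in> V" "u \<noteq> v" "\<not> R u v"
        "\<not> pmatch (\<lambda>a b. R a b \<or> {a,b} = {u,v}) V" by blast
      let ?R = "\<lambda>a b. R a b \<or> {a,b} = {u,v}"
      have "card {p\<in>V\<times>V. fst p \<noteq> snd p \<and> \<not> ?R (fst p) (snd p)} < card {p\<in>V\<times>V. fst p \<noteq> snd p \<and> \<not> R (fst p) (snd p)}"
      proof (rule psubset_card_mono)
        show "finite {p\<in>V\<times>V. fst p \<noteq> snd p \<and> \<not> R (fst p) (snd p)}"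
          using assms(1) by simp
        show "{p\<in>V\<times>V. fst p \<noteq> snd p \<and> \<not> ?R (fst p) (snd p)} \<subset> {p\<in>V\<times>V. fst p \<noteq> snd p \<and> \<not> R (fst p) (snd p)}"
        proof
          show "{p\<in>V\<times>V. fst p \<noteq> snd p \<and> \<not> ?R (fst p) (snd p)} \<subseteq> {p\<in>V\<times>V. fst p \<noteq> snd p \<and> \<not> R (fst p) (snd p)}"
            by blast
          have "(u,v) \<in> {p\<in>V\<times>V. fst p \<noteq> snd p \<and> \<not> R (fst p) (snd p)}" using uv by simp
          moreover have "(u,v) \<notin> {p\<in>V\<times>V. fst p \<noteq> snd p \<and> \<not> ?R (fst p) (snd p)}" by simp
          ultimately show "{p\<in>V\<times>V. fst p \<noteq> snd p \<and> \<not> ?R (fst p) (snd p)} \<noteq> {p\<in>V\<times>V. fst p \<noteq> snd p \<and> \<not> R (fst p) (snd p)}"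
            by metis
        qed
      qed
      moreover have "symp ?R" using sym by (auto simp: symp_def insert_commute)
      moreover have "irreflp ?R" using irr uv(3) by (auto simp: irreflp_def doubleton_eq_iff)
      ultimately have "\<exists>T P. T \<subseteq> V \<and> \<Union>P = V - T \<and> disjoint P \<and>
        (\<forall>C\<in>P. \<forall>D\<in>P. \<forall>u\<in>C. \<forall>v\<in>D. ?R u v \<longrightarrow> C = D) \<and> card T < card {C\<in>P. odd (card C)}"
        by (intro less.hyps[of ?R]) (use uv(5) in simp_all)
      then show ?thesis by (elim ex_forward) simp
    next
      case max: False
      have mx: "pmatch (\<lambda>a b. R a b \<or> {a,b} = {u,v}) V" if "u \<in> V" "v \<in> V" "u \<noteq> v" "\<not> R u v" for u v
        using max that by blast
      define T where "T = {v\<in>V. \<forall>u\<in>V. u \<noteq> v \<longrightarrow> R v u}"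
      define W where "W = V - T"
      define r where "r = {(u,v). u \<in> W \<and> v \<in> W \<and> (u = v \<or> R u v)}"
      have TV: "T \<subseteq> V" by (auto simp: T_def)
      have finW: "finite W" using assms(1) by (simp add: W_def)
      \<comment> \<open>If the pair \<open>x\<close>, \<open>z\<close> were missing, maximality
        would give a perfect matching after adding it, and another after adding \<open>y\<close>,
        \<open>w\<close> for some non-neighbour \<open>w\<close> of \<open>y\<close>; the exchange
        lemma combines the two.\<close>
      have tr: "R x z" if xyz: "x \<in> W" "y \<in> W" "z \<in> W" "R x y" "R y z" "x \<noteq> z" for x y z
      proof (rule ccontr)
        assume n: "\<not> R x z"
        have V: "x \<in> V" "y \<in> V" "z \<in> V" using xyz by (auto simp: W_def)
        have "y \<notin> T" using xyz by (auto simp: W_def)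
        then obtain w where w: "w \<in> V" "w \<noteq> y" "\<not> R y w" using V by (auto simp: T_def)
        obtain f where f: "\<forall>v\<in>V. f v \<in> V \<and> f (f v) = v \<and> (R v (f v) \<or> {v, f v} = {x,z})"
          using mx[OF V(1,3) xyz(6) n] unfolding pmatch_def by blast
        obtain g where g: "\<forall>v\<in>V. g v \<in> V \<and> g (g v) = v \<and> (R v (g v) \<or> {v, g v} = {y,w})"
          using mx[OF V(2) w(1) w(2)[symmetric] w(3)] unfolding pmatch_def by blast
        have fxz: "f x = z"
        proof (rule ccontr)
          assume "f x \<noteq> z"
          have "\<forall>v\<in>V. f v \<in> V \<and> f (f v) = v \<and> R v (f v)"
          proof
            fix v assume v: "v \<in> V"
            have "{v, f v} \<noteq> {x,z}"
            proof
              assume a: "{v, f v} = {x,z}"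
              then consider "v = x" "f v = z" | "v = z" "f v = x" by (auto simp: doubleton_eq_iff)
              then show False using \<open>f x \<noteq> z\<close> f v by cases metis+
            qed
            then show "f v \<in> V \<and> f (f v) = v \<and> R v (f v)" using f v by blast
          qed
          then show False using npm unfolding pmatch_def by blast
        qed
        have gyw: "g y = w"
        proof (rule ccontr)
          assume "g y \<noteq> w"
          have "\<forall>v\<in>V. g v \<in> V \<and> g (g v) = v \<and> R v (g v)"
          proof
            fix v assume v: "v \<in> V"
            have "{v, g v} \<noteq> {y,w}"
            proof
              assume a: "{v, g v} = {y,w}"
              then consider "v = y" "g v = w" | "v = w" "g v = y" by (auto simp: doubleton_eq_iff)
              then show False using \<open>g y \<noteq> w\<close> g v by cases metis+
            qed
            then show "g v \<in> V \<and> g (g v) = v \<and> R v (g v)" using g v by blast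
          qed
          then show False using npm unfolding pmatch_def by blast
        qed
        have "pmatch R V"
          by (rule pmatch_exchange[OF assms(1) sym irr f g]) (use V w xyz fxz gyw in auto)
        then show False using npm by blast
      qed
      have eq: "equiv W r"
      proof (rule equivI)
        show "r \<subseteq> W \<times> W" by (auto simp: r_def)
        show "refl_on W r" by (auto simp: refl_on_def r_def)
        show "sym r" using sym by (auto simp: sym_def r_def dest: sympD)
        show "trans r" unfolding trans_def r_def using tr by blast
      qed
      define P where "P = W // r"
      have UP: "\<Union>P = W" unfolding P_def by (rule Union_quotient[OF eq])
      have dP: "disjoint P" unfolding P_def using quotient_disj[OF eq] by (auto simp: disjoint_def)
      have cl: "(u,v) \<in> r" if "C \<in> P" "u \<in> C" "v \<in> C" for C u v
        using that quotient_eq_iff[OF eq, of C C u v] by (simp add: P_def)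
      have clR: "R u v" if "C \<in> P" "u \<in> C" "v \<in> C" "u \<noteq> v" for C u v
        using cl[OF that(1-3)] that(4) by (auto simp: r_def)
      have sep: "C = D" if "C \<in> P" "D \<in> P" "u \<in> C" "v \<in> D" "R u v" for C D u v
      proof -
        have "u \<in> W" "v \<in> W" using that UP by auto
        then have "(u,v) \<in> r" using that(5) by (auto simp: r_def)
        then show ?thesis using quotient_eq_iff[OF eq, of C D u v] that by (simp add: P_def)
      qed
      have finP: "finite P" using UP finW by (intro finite_UnionD) simp
      define Od where "Od = {C\<in>P. odd (card C)}"
      have "card T < card Od"
      proof (rule ccontr)
        assume "\<not> card T < card Od"
        moreover have "finite Od" "finite T"
          using finP finite_subset[OF TV assms(1)] by (auto simp: Od_def)
        ultimately obtain t where t: "t ` Od \<subseteq> T" "inj_on t Od"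
          using card_le_inj[of Od T] by auto
        define blk where "blk C = (if C \<in> Od then insert (t C) C else C)" for C
        define Q where "Q = blk ` P"
        define Rest where "Rest = T - t ` Od"
        have CW: "C \<subseteq> W" if "C \<in> P" for C using that UP by blast
        have TW: "T \<inter> W = {}" by (auto simp: W_def)
        have tT: "t C \<in> T" "t C \<notin> W" if "C \<in> Od" for C using that t(1) TW by auto
        have OdP: "C \<in> P" if "C \<in> Od" for C using that by (simp add: Od_def)
        have disjb: "blk C \<inter> blk D = {}" if "C \<in> P" "D \<in> P" "C \<noteq> D" for C D
        proof -
          have "C \<inter> D = {}" using dP that by (auto simp: disjoint_def)
          moreover have "t C \<noteq> t D" if "C \<in> Od" "D \<in> Od"
            using t(2) that \<open>C \<noteq> D\<close> by (meson inj_onD)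
          ultimately show ?thesis
            using CW[OF that(1)] CW[OF that(2)] tT[of C] tT[of D] by (auto simp: blk_def)
        qed
        have dQ: "disjoint Q"
          unfolding Q_def disjoint_def
        proof (intro ballI impI)
          fix A B assume "A \<in> blk ` P" "B \<in> blk ` P" "A \<noteq> B"
          then show "A \<inter> B = {}" using disjb by blast
        qed
        have blkR: "blk C \<inter> Rest = {}" if "C \<in> P" for C
          using CW[OF that] TW by (auto simp: blk_def Rest_def)
        have UQ: "\<Union>Q = W \<union> t ` Od"
          unfolding Q_def using UP OdP by (auto simp: blk_def split: if_splits)
        have UV: "\<Union>Q \<union> Rest = V" unfolding UQ Rest_def W_def using t(1) TV by auto
        have evb: "even (card (blk C))" if "C \<in> P" for C
        proof (cases "C \<in> Od")
          case True
          have "t C \<notin> C" using tT[OF True] CW[OF that] by auto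
          moreover have "finite C" using CW[OF that] finW finite_subset by auto
          ultimately show ?thesis using True by (simp add: blk_def Od_def)
        next
          case False then show ?thesis using that by (simp add: blk_def Od_def)
        qed
        have finQ: "finite (\<Union>Q)" using UV assms(1) by (metis finite_Un)
        have evQ: "even (card (\<Union>Q))"
          by (rule even_card_disjoint_Union[OF finQ dQ]) (auto simp: Q_def evb)
        have QR: "\<Union>Q \<inter> Rest = {}" using blkR by (auto simp: Q_def)
        have "card V = card (\<Union>Q) + card Rest"
          unfolding UV[symmetric] using card_Un_disjoint[OF finQ _ QR] UV assms(1) by (metis finite_Un)
        then have evR: "even (card Rest)" using False evQ by simp
        have univ: "R a b" if "a \<in> T" "b \<in> V" "a \<noteq> b" for a b using that by (auto simp: T_def)
        have "pmatch R B" if BQ: "B \<in> insert Rest Q" for B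
        proof (rule pmatch_clique[OF _ _ sym])
          show "finite B" using BQ UV assms(1) finQ by (metis Sup_upper finite_Un finite_subset insertE)
          show "even (card B)" using BQ evR evb by (auto simp: Q_def)
          fix u v assume uv: "u \<in> B" "v \<in> B" "u \<noteq> v"
          have V: "u \<in> V" "v \<in> V" using uv that UV by auto
          show "R u v"
          proof (cases "u \<in> T \<or> v \<in> T")
            case True then show ?thesis using univ[of u v] univ[of v u] V uv sym by (auto dest: sympD)
          next
            case False
            then obtain C where C: "C \<in> P" "B = blk C" using BQ uv by (auto simp: Q_def Rest_def)
            then have "u \<in> C" "v \<in> C" using uv False tT(1)[of C] by (auto simp: blk_def split: if_splits)
            then show ?thesis using clR C uv by blast
          qed
        qed
        moreover have "disjoint (insert Rest Q)"
          using dQ QR by (auto simp: disjoint_def)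
        ultimately have "pmatch R (\<Union>(insert Rest Q))" by (intro pmatch_Union) auto
        moreover have "\<Union>(insert Rest Q) = V" using UV by auto
        ultimately show False using npm by simp
      qed
      then show ?thesis
        using TV UP dP sep unfolding Od_def W_def by (intro exI[of _ T] exI[of _ P]) blast
    qed
  qed
qed

section \<open>Gaps and cuts\<close>

definition cut :: "'e set \<Rightarrow> ('e \<Rightarrow> 'a set) \<Rightarrow> 'a set \<Rightarrow> nat" where
  "cut E ends X = card {e\<in>E. ends e \<inter> X \<noteq> {} \<and> \<not> ends e \<subseteq> X}"

definition gap :: "nat \<Rightarrow> 'e set \<Rightarrow> ('e \<Rightarrow> 'a set) \<Rightarrow> 'a set \<Rightarrow> int" where
  "gap r E ends X = int r * int (card X) - 2 * int (induced_edges E ends X)"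

definition dfc :: "nat \<Rightarrow> 'e set \<Rightarrow> ('e \<Rightarrow> 'a set) \<Rightarrow> 'a \<Rightarrow> int" where
  "dfc r E ends v = int r - int (degree E ends v)"

text \<open>The order is even so that \<open>X\<close> and \<open>V - X\<close> are odd together and
  either side of an odd cut can be contracted.\<close>

definition fits :: "'a set \<Rightarrow> 'e set \<Rightarrow> ('e \<Rightarrow> 'a set) \<Rightarrow> nat \<Rightarrow> bool" where
  "fits V E ends r \<longleftrightarrow> multigraph V E ends \<and> even (card V) \<and> (\<forall>v\<in>V. degree E ends v \<le> r) \<and>
     (\<forall>X\<subseteq>V. odd (card X) \<longrightarrow> int r \<le> gap r E ends X)"

definition colourable :: "'e set \<Rightarrow> ('e \<Rightarrow> 'a set) \<Rightarrow> nat \<Rightarrow> bool" where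
  "colourable E ends k \<longleftrightarrow> (\<exists>c. proper_edge_colouring E ends k c)"

lemma multigraphD:
  assumes "multigraph V E ends"
  shows "finite V" "finite E" "e \<in> E \<Longrightarrow> ends e \<subseteq> V" "e \<in> E \<Longrightarrow> card (ends e) = 2"
  using assms by (auto simp: multigraph_def)

lemma fitsD:
  assumes "fits V E ends r"
  shows "multigraph V E ends" "even (card V)" "finite V" "finite E" "v \<in> V \<Longrightarrow> degree E ends v \<le> r"
    "X \<subseteq> V \<Longrightarrow> odd (card X) \<Longrightarrow> int r \<le> gap r E ends X"
  using assms by (auto simp: fits_def multigraph_def)

lemma card_Collect_sum: "finite A \<Longrightarrow> card {x\<in>A. P x} = (\<Sum>x\<in>A. if P x then 1 else 0)"
  by (simp add: sum.If_cases Int_def)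

lemma degree_sum:
  assumes "finite E" "\<And>e. e \<in> E \<Longrightarrow> card (ends e) = 2" "finite X"
  shows "(\<Sum>v\<in>X. degree E ends v) = 2 * induced_edges E ends X + cut E ends X"
proof -
  have "(\<Sum>v\<in>X. degree E ends v) = (\<Sum>v\<in>X. \<Sum>e\<in>E. if v \<in> ends e then 1 else 0)"
    unfolding degree_def using assms(1) by (simp add: card_Collect_sum)
  also have "\<dots> = (\<Sum>e\<in>E. \<Sum>v\<in>X. if v \<in> ends e then 1 else 0)" by (rule sum.swap)
  also have "\<dots> = (\<Sum>e\<in>E. 2 * (if ends e \<subseteq> X then 1 else 0) + (if ends e \<inter> X \<noteq> {} \<and> \<not> ends e \<subseteq> X then 1 else 0))"
  proof (rule sum.cong[OF refl])
    fix e assume "e \<in> E"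
    then obtain a b where ab: "ends e = {a,b}" "a \<noteq> b" using assms(2) by (meson card_2_iff)
    have "(\<Sum>v\<in>X. if v \<in> ends e then 1 else 0) = card {v\<in>X. v \<in> ends e}"
      using assms(3) by (simp add: card_Collect_sum)
    also have "{v\<in>X. v \<in> ends e} = (if a \<in> X then {a} else {}) \<union> (if b \<in> X then {b} else {})"
      using ab by auto
    also have "card \<dots> = 2 * (if ends e \<subseteq> X then 1 else 0) + (if ends e \<inter> X \<noteq> {} \<and> \<not> ends e \<subseteq> X then 1 else 0)"
      using ab by auto
    finally show "(\<Sum>v\<in>X. if v \<in> ends e then 1 else 0) = 2 * (if ends e \<subseteq> X then 1 else 0) + (if ends e \<inter> X \<noteq> {} \<and> \<not> ends e \<subseteq> X then 1 else 0 :: nat)" .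
  qed
  also have "\<dots> = 2 * induced_edges E ends X + cut E ends X"
    unfolding induced_edges_def cut_def using assms(1)
    by (simp add: sum.distrib card_Collect_sum flip: sum_distrib_left)
  finally show ?thesis .
qed

lemma gap_eq:
  assumes "multigraph V E ends" "X \<subseteq> V"
  shows "gap r E ends X = (\<Sum>v\<in>X. dfc r E ends v) + int (cut E ends X)"
proof -
  have fX: "finite X" using assms multigraphD(1) finite_subset by blast
  have "int (\<Sum>v\<in>X. degree E ends v) = int (2 * induced_edges E ends X + cut E ends X)"
    using degree_sum[OF _ _ fX, of E ends] assms(1) by (simp add: multigraph_def)
  then show ?thesis by (simp add: gap_def dfc_def sum_subtractf)
qed

lemma cut_compl:
  assumes "multigraph V E ends" "X \<subseteq> V"
  shows "cut E ends (V - X) = cut E ends X"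
proof -
  have "(ends e \<inter> (V - X) \<noteq> {} \<and> \<not> ends e \<subseteq> V - X) \<longleftrightarrow> (ends e \<inter> X \<noteq> {} \<and> \<not> ends e \<subseteq> X)" if "e \<in> E" for e
    using multigraphD(3)[OF assms(1) that] assms(2) by blast
  then show ?thesis unfolding cut_def by (metis (no_types, lifting) Collect_cong)
qed

lemma cut_singleton:
  assumes "multigraph V E ends"
  shows "cut E ends {v} = degree E ends v"
proof -
  have "(ends e \<inter> {v} \<noteq> {} \<and> \<not> ends e \<subseteq> {v}) \<longleftrightarrow> v \<in> ends e" if e: "e \<in> E" for e
  proof -
    obtain a b where "ends e = {a,b}" "a \<noteq> b" using multigraphD(4)[OF assms e] by (meson card_2_iff)
    then show ?thesis by auto
  qed
  then show ?thesis unfolding cut_def degree_def by (metis (no_types, lifting) Collect_cong)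
qed

section \<open>Restricting, extending and greedily finding colourings\<close>

lemma colourable_mono:
  assumes "colourable E' ends' k" "E \<subseteq> E'" "\<And>e. e \<in> E \<Longrightarrow> ends e = ends' e" "k \<le> k'"
  shows "colourable E ends k'"
proof -
  obtain c where "proper_edge_colouring E' ends' k c" using assms(1) by (auto simp: colourable_def)
  then have "proper_edge_colouring E ends k' c"
    using assms(2-4) unfolding proper_edge_colouring_def by (simp add: subset_iff) (meson order_less_le_trans)
  then show ?thesis by (auto simp: colourable_def)
qed

lemma colourable_add_matching:
  assumes "colourable (E - M) ends k" "\<And>e f. e \<in> M \<Longrightarrow> f \<in> M \<Longrightarrow> e \<noteq> f \<Longrightarrow> ends e \<inter> ends f = {}"
  shows "colourable E ends (Suc k)"
proof -
  obtain c where c: "proper_edge_colouring (E - M) ends k c" using assms(1) by (auto simp: colourable_def)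
  have "proper_edge_colouring E ends (Suc k) (\<lambda>e. if e \<in> M then k else c e)"
    using c assms(2) unfolding proper_edge_colouring_def
    by (auto simp: less_Suc_eq)
  then show ?thesis by (auto simp: colourable_def)
qed

text \<open>An edge meets at most \<open>2 * d - 2\<close> others, so inserting the edges one by one
  always leaves a free colour.\<close>

lemma colourable_greedy:
  assumes "multigraph V E ends" "\<And>v. v \<in> V \<Longrightarrow> degree E ends v \<le> d" "2 * d \<le> k + 1"
  shows "colourable E ends k"
proof -
  have "finite E" using multigraphD(2)[OF assms(1)] .
  then show ?thesis using assms(1,2)
  proof (induction E)
    case empty then show ?case by (auto simp: colourable_def proper_edge_colouring_def)
  next
    case (insert e F)
    have mgF: "multigraph V F ends" using insert.prems(1) insert.hyps by (auto simp: multigraph_def)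
    have dF: "degree F ends v \<le> d" if "v \<in> V" for v
    proof -
      have "degree F ends v \<le> degree (insert e F) ends v"
        unfolding degree_def using insert.hyps by (intro card_mono) auto
      then show ?thesis using insert.prems(2)[OF that] by simp
    qed
    obtain c where c: "proper_edge_colouring F ends k c"
      using insert.IH[OF mgF dF] by (auto simp: colourable_def)
    obtain a b where ab: "ends e = {a,b}" "a \<noteq> b"
      using multigraphD(4)[OF insert.prems(1), of e] by (meson card_2_iff insertI1)
    have abV: "a \<in> V" "b \<in> V" using multigraphD(3)[OF insert.prems(1), of e] ab by auto
    have deg: "card {f\<in>F. v \<in> ends f} + 1 \<le> d" if "v \<in> ends e" for v
    proof -
      have "{f \<in> insert e F. v \<in> ends f} = insert e {f\<in>F. v \<in> ends f}" using that by auto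
      then have "degree (insert e F) ends v = card {f\<in>F. v \<in> ends f} + 1"
        using insert.hyps by (simp add: degree_def)
      then show ?thesis using insert.prems(2)[of v] that ab abV by auto
    qed
    let ?N = "{f\<in>F. ends f \<inter> ends e \<noteq> {}}"
    have "card ?N \<le> card ({f\<in>F. a \<in> ends f} \<union> {f\<in>F. b \<in> ends f})"
      using insert.hyps ab by (intro card_mono) auto
    also have "\<dots> \<le> card {f\<in>F. a \<in> ends f} + card {f\<in>F. b \<in> ends f}" by (rule card_Un_le)
    finally have "card ?N < k" using deg[of a] deg[of b] ab assms(3) by auto
    then have "card (c ` ?N) < card {..<k}" using card_image_le[of ?N c] insert.hyps by auto
    moreover have "finite (c ` ?N)" using insert.hyps by simp
    ultimately have "\<not> {..<k} \<subseteq> c ` ?N" using card_mono[of "c ` ?N" "{..<k}"] by linarith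
    then obtain x where x: "x < k" "x \<notin> c ` ?N" by auto
    have "proper_edge_colouring (insert e F) ends k (c(e := x))"
      unfolding proper_edge_colouring_def
    proof (intro conjI ballI impI)
      fix f assume "f \<in> insert e F"
      then show "(c(e := x)) f < k" using c x by (auto simp: proper_edge_colouring_def)
    next
      fix f g assume fg: "f \<in> insert e F" "g \<in> insert e F" "f \<noteq> g \<and> ends f \<inter> ends g \<noteq> {}"
      consider "f = e" "g \<in> F" "g \<noteq> e" | "g = e" "f \<in> F" "f \<noteq> e" | "f \<in> F" "g \<in> F" "f \<noteq> e" "g \<noteq> e"
        using fg by auto
      then show "(c(e := x)) f \<noteq> (c(e := x)) g"
      proof cases
        case 1 then show ?thesis using x fg by (auto simp: Int_commute)
      next
        case 2 then show ?thesis using x fg by auto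
      next
        case 3 then show ?thesis using c fg by (auto simp: proper_edge_colouring_def)
      qed
    qed
    then show ?case by (auto simp: colourable_def)
  qed
qed

section \<open>Contraction\<close>

definition contract_edges :: "'a set \<Rightarrow> ('e \<Rightarrow> 'a set) \<Rightarrow> 'e set \<Rightarrow> 'e set" where
  "contract_edges X ends E = {e\<in>E. \<not> ends e \<subseteq> X}"

text \<open>Edges keep their identifiers, so colourings of the two contracted graphs can be compared
  on the cut. The new vertex is a member \<open>x\<close> of \<open>X\<close>, so the vertex set
  stays inside \<open>V\<close>.\<close>

definition contract_ends :: "'a set \<Rightarrow> 'a \<Rightarrow> ('e \<Rightarrow> 'a set) \<Rightarrow> 'e \<Rightarrow> 'a set" where
  "contract_ends X x ends e = (if ends e \<inter> X = {} then ends e else insert x (ends e - X))"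

lemma multigraph_contract:
  assumes "multigraph V E ends" "X \<subseteq> V" "x \<in> X"
  shows "multigraph (insert x (V - X)) (contract_edges X ends E) (contract_ends X x ends)"
  unfolding multigraph_def
proof (intro conjI ballI)
  show "finite (insert x (V - X))" "finite (contract_edges X ends E)"
    using assms(1) by (auto simp: multigraph_def contract_edges_def)
  fix e assume "e \<in> contract_edges X ends E"
  then have e: "e \<in> E" "\<not> ends e \<subseteq> X" by (auto simp: contract_edges_def)
  obtain a b where ab: "ends e = {a,b}" "a \<noteq> b" using multigraphD(4)[OF assms(1) e(1)] by (meson card_2_iff)
  show "contract_ends X x ends e \<subseteq> insert x (V - X)"
    using multigraphD(3)[OF assms(1) e(1)] by (auto simp: contract_ends_def)
  consider "a \<in> X" "b \<notin> X" | "a \<notin> X" "b \<in> X" | "a \<notin> X" "b \<notin> X" using ab e(2) by auto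
  then show "card (contract_ends X x ends e) = 2"
  proof cases
    case 1
    then have "contract_ends X x ends e = {x,b}" using ab by (auto simp: contract_ends_def)
    moreover have "x \<noteq> b" using 1 assms(3) by metis
    ultimately show ?thesis by simp
  next
    case 2
    then have "contract_ends X x ends e = {x,a}" using ab by (auto simp: contract_ends_def)
    moreover have "x \<noteq> a" using 2 assms(3) by metis
    ultimately show ?thesis by simp
  next
    case 3
    then have "contract_ends X x ends e = {a,b}" using ab by (auto simp: contract_ends_def)
    then show ?thesis using ab by auto
  qed
qed

lemma degree_contract:
  assumes "x \<in> X" "v \<notin> X"
  shows "degree (contract_edges X ends E) (contract_ends X x ends) v = degree E ends v"
proof -
  have "{e \<in> contract_edges X ends E. v \<in> contract_ends X x ends e} = {e\<in>E. v \<in> ends e}"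
    using assms by (auto simp: contract_edges_def contract_ends_def split: if_splits)
  then show ?thesis by (simp add: degree_def)
qed

lemma degree_contract_vertex:
  assumes "x \<in> X"
  shows "degree (contract_edges X ends E) (contract_ends X x ends) x = cut E ends X"
proof -
  have "{e \<in> contract_edges X ends E. x \<in> contract_ends X x ends e} = {e\<in>E. ends e \<inter> X \<noteq> {} \<and> \<not> ends e \<subseteq> X}"
    using assms by (auto simp: contract_edges_def contract_ends_def split: if_splits)
  then show ?thesis by (simp add: degree_def cut_def)
qed

lemma induced_contract:
  assumes "multigraph V E ends" "x \<in> X" "Y \<inter> X = {}"
  shows "induced_edges (contract_edges X ends E) (contract_ends X x ends) Y = induced_edges E ends Y"
proof -
  have ne: "ends e \<noteq> {}" if "e \<in> E" for e using multigraphD(4)[OF assms(1) that] by auto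
  have "{e \<in> contract_edges X ends E. contract_ends X x ends e \<subseteq> Y} = {e\<in>E. ends e \<subseteq> Y}"
    using assms(2,3) ne by (auto simp: contract_edges_def contract_ends_def split: if_splits) blast
  then show ?thesis by (simp add: induced_edges_def)
qed

lemma induced_contract_vertex:
  assumes "multigraph V E ends" "x \<in> X" "Y \<inter> X = {}"
  shows "induced_edges (contract_edges X ends E) (contract_ends X x ends) (insert x Y) + induced_edges E ends X
    = induced_edges E ends (X \<union> Y)"
proof -
  let ?A = "{e \<in> contract_edges X ends E. contract_ends X x ends e \<subseteq> insert x Y}" and ?B = "{e\<in>E. ends e \<subseteq> X}"
  have "finite E" using multigraphD(2)[OF assms(1)] .
  then have "card (?A \<union> ?B) = card ?A + card ?B"
    by (intro card_Un_disjoint) (auto simp: contract_edges_def)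
  moreover have "?A \<union> ?B = {e\<in>E. ends e \<subseteq> X \<union> Y}"
    using assms(2,3) by (auto simp: contract_edges_def contract_ends_def split: if_splits)
  ultimately show ?thesis by (simp add: induced_edges_def)
qed

lemma card_contract:
  assumes "finite V" "X \<subseteq> V" "x \<in> X"
  shows "card (insert x (V - X)) + card X = card V + 1"
proof -
  have "card (insert x (V - X)) = card (V - X) + 1" using assms by simp
  moreover have "card (V - X) + card X = card V"
    using assms by (metis card_Diff_subset card_mono finite_subset le_add_diff_inverse2)
  ultimately show ?thesis by simp
qed

text \<open>For \<open>Y = insert x R\<close> the gap in the contracted graph is
  \<open>r + gap r E ends (X \<union> R) - gap r E ends X\<close>, so minimality of \<open>X\<close>
  among its odd supersets is exactly the condition for odd sets through \<open>x\<close>. The bound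
  on the cut is the degree condition at \<open>x\<close>.\<close>

lemma fits_contract:
  assumes fit: "fits V E ends r" and X: "X \<subseteq> V" "odd (card X)" "x \<in> X" and cut: "cut E ends X \<le> r"
    and min: "\<And>Z. X \<subseteq> Z \<Longrightarrow> Z \<subseteq> V \<Longrightarrow> odd (card Z) \<Longrightarrow> gap r E ends X \<le> gap r E ends Z"
  shows "fits (insert x (V - X)) (contract_edges X ends E) (contract_ends X x ends) r"
  unfolding fits_def
proof (intro conjI ballI allI impI)
  note mg = fitsD(1)[OF fit]
  show "multigraph (insert x (V - X)) (contract_edges X ends E) (contract_ends X x ends)"
    by (rule multigraph_contract[OF mg X(1,3)])
  show "even (card (insert x (V - X)))"
    using card_contract[OF fitsD(3)[OF fit] X(1,3)] fitsD(2)[OF fit] X(2) by presburger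
next
  fix v assume "v \<in> insert x (V - X)"
  then show "degree (contract_edges X ends E) (contract_ends X x ends) v \<le> r"
    using degree_contract[OF X(3), of v ends E] degree_contract_vertex[OF X(3), of ends E] fitsD(5)[OF fit] cut by auto
next
  fix Y assume Y: "Y \<subseteq> insert x (V - X)" "odd (card Y)"
  show "int r \<le> gap r (contract_edges X ends E) (contract_ends X x ends) Y"
  proof (cases "x \<in> Y")
    case False
    then have "Y \<inter> X = {}" "Y \<subseteq> V" using Y by auto
    then show ?thesis
      using fitsD(6)[OF fit, of Y] Y(2) induced_contract[OF fitsD(1)[OF fit] X(3), of Y] by (simp add: gap_def)
  next
    case True
    define R where "R = Y - {x}"
    have R: "Y = insert x R" "x \<notin> R" "R \<inter> X = {}" "R \<subseteq> V" using True Y X(3) by (auto simp: R_def)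
    have fin: "finite R" "finite X" using R(4) X(1) fitsD(3)[OF fit] by (simp_all add: finite_subset)
    have cR: "card Y = card R + 1" using R fin by simp
    have cZ: "card (X \<union> R) = card X + card R" using card_Un_disjoint[of X R] fin R by auto
    have "odd (card (X \<union> R))" using cR cZ Y(2) X(2) by auto
    then have g: "gap r E ends X \<le> gap r E ends (X \<union> R)" using X R by (intro min) auto
    have i: "int (induced_edges (contract_edges X ends E) (contract_ends X x ends) Y) + int (induced_edges E ends X) = int (induced_edges E ends (X \<union> R))"
      using induced_contract_vertex[OF fitsD(1)[OF fit] X(3) R(3)] R(1) by (metis of_nat_add)
    have "2 * int (induced_edges (contract_edges X ends E) (contract_ends X x ends) Y) \<le> int r * int (card R)"
      using g i unfolding gap_def cZ by (simp add: algebra_simps)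
    then show ?thesis unfolding gap_def cR by (simp add: algebra_simps)
  qed
qed

text \<open>Serves to extend the correspondence between the colours of the cut edges to a
  permutation of all colours.\<close>

lemma bij_betw_extend:
  assumes "finite A" "B \<subseteq> A" "inj_on f B" "f ` B \<subseteq> A"
  shows "\<exists>p. bij_betw p A A \<and> (\<forall>b\<in>B. p b = f b)"
proof -
  have "card (A - B) = card (A - f ` B)"
    using assms by (metis card_Diff_subset card_image finite_subset)
  then obtain g where g: "bij_betw g (A - B) (A - f ` B)"
    using assms(1) finite_same_card_bij[of "A - B" "A - f ` B"] by auto
  have "bij_betw (\<lambda>a. if a \<in> B then f a else g a) (B \<union> (A - B)) (f ` B \<union> (A - f ` B))"
    by (rule bij_betw_disjoint_Un) (use g assms(3) in \<open>auto simp: bij_betw_def\<close>)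
  moreover have "B \<union> (A - B) = A" "f ` B \<union> (A - f ` B) = A" using assms by auto
  ultimately show ?thesis by (intro exI[of _ "\<lambda>a. if a \<in> B then f a else g a"]) auto
qed

text \<open>The edges of the cut receive distinct colours in both contracted graphs, so the two
colourings agree after a permutation of the colours.\<close>

lemma colourable_glue:
  assumes mg: "multigraph V E ends" and X: "X \<subseteq> V" "x \<in> X" "y \<in> V - X"
    and c1: "colourable (contract_edges X ends E) (contract_ends X x ends) k"
    and c2: "colourable (contract_edges (V - X) ends E) (contract_ends (V - X) y ends) k"
  shows "colourable E ends k"
proof -
  obtain c where c: "proper_edge_colouring (contract_edges X ends E) (contract_ends X x ends) k c"
    using c1 by (auto simp: colourable_def)
  obtain d where d: "proper_edge_colouring (contract_edges (V - X) ends E) (contract_ends (V - X) y ends) k d"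
    using c2 by (auto simp: colourable_def)
  define Q where "Q = {e\<in>E. ends e \<inter> X \<noteq> {} \<and> \<not> ends e \<subseteq> X}"
  have eV: "ends e \<subseteq> V" if "e \<in> E" for e using multigraphD(3)[OF mg that] .
  have Q1: "e \<in> contract_edges X ends E \<and> x \<in> contract_ends X x ends e" if "e \<in> Q" for e
    using that by (auto simp: Q_def contract_edges_def contract_ends_def)
  have Q2: "e \<in> contract_edges (V - X) ends E \<and> y \<in> contract_ends (V - X) y ends e" if "e \<in> Q" for e
    using that eV[of e] by (auto simp: Q_def contract_edges_def contract_ends_def)
  have ci: "inj_on c Q"
  proof (rule inj_onI, rule ccontr)
    fix e f assume "e \<in> Q" "f \<in> Q" "c e = c f" "e \<noteq> f"
    then show False using Q1 c unfolding proper_edge_colouring_def by (metis IntI empty_iff)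
  qed
  have di: "inj_on d Q"
  proof (rule inj_onI, rule ccontr)
    fix e f assume "e \<in> Q" "f \<in> Q" "d e = d f" "e \<noteq> f"
    then show False using Q2 d unfolding proper_edge_colouring_def by (metis IntI empty_iff)
  qed
  have "\<exists>p. bij_betw p {..<k} {..<k} \<and> (\<forall>b\<in>d ` Q. p b = (c \<circ> inv_into Q d) b)"
  proof (rule bij_betw_extend)
    show "d ` Q \<subseteq> {..<k}" using Q2 d by (auto simp: proper_edge_colouring_def)
    show "inj_on (c \<circ> inv_into Q d) (d ` Q)"
      using ci di by (auto intro!: comp_inj_on inj_on_inv_into simp: inj_on_subset inv_into_into)
    show "(c \<circ> inv_into Q d) ` d ` Q \<subseteq> {..<k}"
      using Q1 c di by (auto simp: proper_edge_colouring_def)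
  qed auto
  then obtain p where p: "bij_betw p {..<k} {..<k}" "\<And>e. e \<in> Q \<Longrightarrow> p (d e) = c e"
    using di by auto
  \<comment> \<open>Cut edges satisfy \<open>p (d e) = c e\<close>, so two adjacent edges can be
    compared in whichever contracted graph keeps their common end.\<close>
  define h where "h e = (if ends e \<subseteq> X then p (d e) else c e)" for e
  have hc: "h e = c e \<and> e \<in> contract_edges X ends E" if "e \<in> E" "\<not> ends e \<subseteq> X" for e
    using that by (auto simp: h_def contract_edges_def)
  have hd: "h e = p (d e) \<and> e \<in> contract_edges (V - X) ends E" if "e \<in> E" "ends e \<inter> X \<noteq> {}" for e
    using that p(2)[of e] by (auto simp: h_def contract_edges_def Q_def)
  have "proper_edge_colouring E ends k h"
    unfolding proper_edge_colouring_def
  proof (intro conjI ballI impI)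
    fix e assume e: "e \<in> E"
    show "h e < k"
    proof (cases "ends e \<subseteq> X")
      case True
      then have "ends e \<inter> X \<noteq> {}" using multigraphD(4)[OF mg e] by (auto simp: Int_absorb2)
      then have "h e = p (d e)" "d e < k" using hd[OF e] d by (auto simp: proper_edge_colouring_def)
      then show ?thesis using p(1) by (auto simp: bij_betw_def)
    next
      case False
      then show ?thesis using hc[OF e] c by (auto simp: proper_edge_colouring_def)
    qed
  next
    fix e f assume ef: "e \<in> E" "f \<in> E" "e \<noteq> f \<and> ends e \<inter> ends f \<noteq> {}"
    then obtain v where v: "v \<in> ends e" "v \<in> ends f" by blast
    show "h e \<noteq> h f"
    proof (cases "v \<in> X")
      case True
      then have "ends e \<inter> X \<noteq> {}" "ends f \<inter> X \<noteq> {}" using v by auto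
      note he = hd[OF ef(1) this(1)] and hf = hd[OF ef(2) this(2)]
      have "v \<in> contract_ends (V - X) y ends e" "v \<in> contract_ends (V - X) y ends f"
        using v True by (auto simp: contract_ends_def)
      then have "d e \<noteq> d f" "d e < k" "d f < k"
        using d he hf ef(3) unfolding proper_edge_colouring_def by (metis IntI empty_iff)+
      then show ?thesis using he hf p(1) by (auto simp: bij_betw_def inj_on_def)
    next
      case False
      then have "\<not> ends e \<subseteq> X" "\<not> ends f \<subseteq> X" using v by auto
      note he = hc[OF ef(1) this(1)] and hf = hc[OF ef(2) this(2)]
      have "v \<in> contract_ends X x ends e" "v \<in> contract_ends X x ends f"
        using v False by (auto simp: contract_ends_def)
      then show ?thesis using c he hf ef(3) unfolding proper_edge_colouring_def by (metis IntI empty_iff)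
    qed
  qed
  then show ?thesis by (auto simp: colourable_def)
qed

section \<open>Splitting at odd sets and filling up with edges\<close>

text \<open>\<open>X\<close> and \<open>V - X\<close> have the same cut, so their gaps differ only
  in the deficiencies.\<close>

lemma gap_compl:
  assumes "multigraph V E ends" "X \<subseteq> V"
  shows "gap r E ends (V - X) = gap r E ends X + (\<Sum>v\<in>V. dfc r E ends v) - 2 * (\<Sum>v\<in>X. dfc r E ends v)"
proof -
  have "(\<Sum>v\<in>V - X. dfc r E ends v) = (\<Sum>v\<in>V. dfc r E ends v) - (\<Sum>v\<in>X. dfc r E ends v)"
    using assms multigraphD(1) by (intro sum_diff) auto
  then show ?thesis using gap_eq[OF assms(1), of X r] gap_eq[OF assms(1), of "V - X" r] cut_compl[OF assms] assms(2) by auto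
qed

lemma gap_singleton:
  assumes "multigraph V E ends"
  shows "gap r E ends {v} = int r"
proof -
  have "\<not> ends e \<subseteq> {v}" if "e \<in> E" for e
    using multigraphD(4)[OF assms that] card_mono[of "{v}" "ends e"] by auto
  then have "{e\<in>E. ends e \<subseteq> {v}} = {}" by auto
  then have "induced_edges E ends {v} = 0" unfolding induced_edges_def by (simp only: card.empty)
  then show ?thesis by (simp add: gap_def)
qed

text \<open>Splitting along this set would leave one side unchanged, so it must be avoided; its gap
  becomes small when \<open>v\<close> carries almost half of the total deficiency.\<close>

lemma gap_minus_vertex:
  assumes "multigraph V E ends" "v \<in> V"
  shows "gap r E ends (V - {v}) = int r + (\<Sum>u\<in>V. dfc r E ends u) - 2 * dfc r E ends v"
  using gap_compl[OF assms(1), of "{v}" r] gap_singleton[OF assms(1)] assms(2) by simp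

text \<open>Under \<open>fits\<close>, a gap different from \<open>r\<close> is therefore at least
  \<open>r + 2\<close>, which is room for one more edge inside \<open>X\<close>.\<close>

lemma gap_parity: "odd (card X) \<Longrightarrow> even (gap r E ends X - int r)"
  by (simp add: gap_def)

text \<open>The degree of a contracted vertex is the cut, so \<open>m\<close> is a lower bound for
  the deficiency it receives: 0 while filling up, 1 and 2 in the two main inductions. The size
  limits make both contracted graphs smaller, and minimality on both sides makes both satisfy
  \<open>fits\<close>.\<close>

definition splittable :: "'a set \<Rightarrow> 'e set \<Rightarrow> ('e \<Rightarrow> 'a set) \<Rightarrow> nat \<Rightarrow> int \<Rightarrow> bool" where
  "splittable V E ends r m \<longleftrightarrow> (\<exists>X\<subseteq>V. odd (card X) \<and> 3 \<le> card X \<and> card X + 3 \<le> card V \<and>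
     int (cut E ends X) \<le> int r - m \<and>
     (\<forall>Y\<in>{X, V - X}. \<forall>Z\<subseteq>V. Y \<subseteq> Z \<longrightarrow> odd (card Z) \<longrightarrow> gap r E ends Y \<le> gap r E ends Z))"

lemma card_Diff_add:
  assumes "finite V" "X \<subseteq> V"
  shows "card (V - X) + card X = card V"
  using assms by (metis card_Diff_subset card_mono finite_subset le_add_diff_inverse2)

lemma splittable_colourable:
  assumes fit: "fits V E ends r" and m: "0 \<le> m" and sp: "splittable V E ends r m"
    and pieces: "\<And>Y w. Y \<subseteq> V \<Longrightarrow> w \<in> Y \<Longrightarrow> odd (card Y) \<Longrightarrow> int (cut E ends Y) \<le> int r - m \<Longrightarrow>
      card (insert w (V - Y)) < card V \<Longrightarrow>
      fits (insert w (V - Y)) (contract_edges Y ends E) (contract_ends Y w ends) r \<Longrightarrow>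
      colourable (contract_edges Y ends E) (contract_ends Y w ends) k"
  shows "colourable E ends k"
proof -
  obtain X where X: "X \<subseteq> V" "odd (card X)" "3 \<le> card X" "card X + 3 \<le> card V" "int (cut E ends X) \<le> int r - m"
    and min': "\<forall>Y\<in>{X, V - X}. \<forall>Z\<subseteq>V. Y \<subseteq> Z \<longrightarrow> odd (card Z) \<longrightarrow> gap r E ends Y \<le> gap r E ends Z"
    using sp unfolding splittable_def by (elim exE conjE) (rule that; assumption)
  have min: "gap r E ends Y \<le> gap r E ends Z" if "Y = X \<or> Y = V - X" "Z \<subseteq> V" "Y \<subseteq> Z" "odd (card Z)" for Y Z
    by (rule min'[rule_format]) (use that in auto)
  note mg = fitsD(1)[OF fit] and finV = fitsD(3)[OF fit]
  have col: "colourable (contract_edges Y ends E) (contract_ends Y w ends) k"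
    if Y: "Y = X \<or> Y = V - X" and w: "w \<in> Y" for Y w
  proof (rule pieces[OF _ w])
    show YV: "Y \<subseteq> V" using Y X by auto
    have cc: "card (V - X) + card X = card V" by (rule card_Diff_add[OF finV X(1)])
    show odd: "odd (card Y)" using Y X(2) cc fitsD(2)[OF fit] by presburger
    show cut: "int (cut E ends Y) \<le> int r - m" using Y X(5) cut_compl[OF mg X(1)] by auto
    have "3 \<le> card Y" using Y X(3,4) cc by auto
    then show "card (insert w (V - Y)) < card V" using card_contract[OF finV YV w] by linarith
    show "fits (insert w (V - Y)) (contract_edges Y ends E) (contract_ends Y w ends) r"
      by (rule fits_contract[OF fit YV odd w]) (use cut m min[OF Y] in auto)
  qed
  obtain x where x: "x \<in> X" using X(3) by fastforce
  have "card (V - X) \<noteq> 0" using card_Diff_add[OF finV X(1)] X(4) by linarith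
  then have "V - X \<noteq> {}" by (metis card.empty)
  then obtain y where y: "y \<in> V - X" by blast
  show ?thesis by (rule colourable_glue[OF mg X(1) x y]) (use col x y in blast)+
qed

lemma dfc_contract:
  assumes "w \<in> Y"
  shows "v \<notin> Y \<Longrightarrow> dfc r (contract_edges Y ends E) (contract_ends Y w ends) v = dfc r E ends v"
    and "dfc r (contract_edges Y ends E) (contract_ends Y w ends) w = int r - int (cut E ends Y)"
  using degree_contract[OF assms] degree_contract_vertex[OF assms] by (auto simp: dfc_def)

text \<open>The gap of \<open>Y\<close> is at least \<open>r\<close>, so the deficiency of the new
  vertex, \<open>r\<close> minus the cut, is at most the sum of the deficiencies that it
  replaces.\<close>

lemma sum_dfc_contract:
  assumes "fits V E ends r" "Y \<subseteq> V" "w \<in> Y" "odd (card Y)"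
  shows "(\<Sum>v\<in>insert w (V - Y). dfc r (contract_edges Y ends E) (contract_ends Y w ends) v) \<le> (\<Sum>v\<in>V. dfc r E ends v)"
proof -
  have fin: "finite V" using fitsD(3)[OF assms(1)] .
  let ?d = "dfc r (contract_edges Y ends E) (contract_ends Y w ends)"
  have "(\<Sum>v\<in>insert w (V - Y). ?d v) = ?d w + (\<Sum>v\<in>V - Y. ?d v)" using fin assms(3) by simp
  also have "(\<Sum>v\<in>V - Y. ?d v) = (\<Sum>v\<in>V - Y. dfc r E ends v)"
    using dfc_contract(1)[OF assms(3)] by (intro sum.cong) auto
  also have "\<dots> = (\<Sum>v\<in>V. dfc r E ends v) - (\<Sum>v\<in>Y. dfc r E ends v)"
    using fin assms(2) by (rule sum_diff)
  finally show ?thesis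
    using dfc_contract(2)[OF assms(3), of r ends E] fitsD(6)[OF assms(1,2,4)] gap_eq[OF fitsD(1)[OF assms(1)] assms(2), of r]
    by linarith
qed

text \<open>An odd set whose gap is smallest among the admissible ones can be contracted on either side:
a better superset of it, or of its complement, would again be admissible.\<close>

lemma splittableI:
  assumes fit: "fits V E ends r" and pos: "\<And>v. v \<in> V \<Longrightarrow> 1 \<le> dfc r E ends v"
    and H: "\<And>y. y \<in> V \<Longrightarrow> s \<le> (\<Sum>v\<in>V. dfc r E ends v) - 2 * dfc r E ends y"
    and X0: "X0 \<subseteq> V" "odd (card X0)" "3 \<le> card X0" "card X0 + 3 \<le> card V" "int (cut E ends X0) \<le> int r - m"
      "gap r E ends X0 - int r \<le> 2 * int (card X0) - 2" "gap r E ends X0 - int r \<le> s"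
  shows "splittable V E ends r m"
proof -
  note mg = fitsD(1)[OF fit] and finV = fitsD(3)[OF fit]
  let ?g = "gap r E ends" and ?c = "\<lambda>X. int (cut E ends X)" and ?D = "\<lambda>X. \<Sum>v\<in>X. dfc r E ends v"
  \<comment> \<open>The two bounds on the gap keep trivial odd sets from undercutting the minimum:
    the one by \<open>s\<close> deals with complements of single vertices, through \<open>H\<close>,
    and the one by \<open>2 * card X - 2\<close> with single vertices.\<close>
  define S where "S = {X. X \<subseteq> V \<and> odd (card X) \<and> 3 \<le> card X \<and> card X + 3 \<le> card V \<and> ?c X \<le> int r - m \<and>
    ?g X - int r \<le> 2 * int (card X) - 2 \<and> ?g X - int r \<le> s}"
  have "finite S" by (rule finite_subset[of _ "Pow V"]) (use finV in \<open>auto simp: S_def\<close>)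
  moreover have "X0 \<in> S" using X0 unfolding S_def by blast
  then have "S \<noteq> {}" by blast
  ultimately obtain X where XS: "X \<in> S" and least: "\<And>Y. Y \<in> S \<Longrightarrow> ?g X \<le> ?g Y"
    using arg_min_if_finite[of S ?g] by (meson not_less)
  have X: "X \<subseteq> V" "odd (card X)" "3 \<le> card X" "card X + 3 \<le> card V" "?c X \<le> int r - m"
    "?g X - int r \<le> 2 * int (card X) - 2" "?g X - int r \<le> s"
    using XS by (auto simp: S_def)
  have finX: "finite X" using X(1) finV finite_subset by auto
  have ge: "?g Y = ?D Y + ?c Y" if "Y \<subseteq> V" for Y by (rule gap_eq[OF mg that])
  have Dmono: "?D A + int (card (B - A)) \<le> ?D B" if "A \<subseteq> B" "B \<subseteq> V" for A B
  proof -
    have finB: "finite B" using that finV finite_subset by auto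
    have "?D (B - A) = ?D B - ?D A" using finB that(1) by (rule sum_diff)
    moreover have "(\<Sum>v\<in>B - A. 1) \<le> ?D (B - A)" by (rule sum_mono) (use pos that in auto)
    ultimately show ?thesis by simp
  qed
  have super: "?g X \<le> ?g Z" if Z: "Z \<subseteq> V" "X \<subseteq> Z" "odd (card Z)" for Z
  proof (rule ccontr)
    assume less: "\<not> ?g X \<le> ?g Z"
    have finZ: "finite Z" using Z finV finite_subset by auto
    have cXZ: "card X \<le> card Z" using Z finZ by (intro card_mono)
    \<comment> \<open>A superset has no smaller deficiency sum, so a smaller gap means a smaller
      cut. Thus \<open>Z\<close> can fail to be admissible only by its size.\<close>
    have "?c Z < ?c X" using less ge[OF X(1)] ge[OF Z(1)] Dmono[OF Z(2,1)] by linarith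
    then have "card V < card Z + 3"
      using less least[of Z] X Z cXZ by (force simp: S_def)
    moreover have "card Z \<le> card V" using Z finV by (intro card_mono)
    ultimately have "card (V - Z) = 1"
      using card_Diff_add[OF finV Z(1)] Z(3) fitsD(2)[OF fit] by presburger
    then obtain y where y: "V - Z = {y}" by (auto simp: card_1_singleton_iff)
    then have "Z = V - {y}" "y \<in> V" using Z(1) by auto
    then show False using gap_minus_vertex[OF mg, of y r] H[of y] X(7) less by auto
  qed
  have sub: "?g (V - X) \<le> ?g Z" if Z: "Z \<subseteq> V" "V - X \<subseteq> Z" "odd (card Z)" for Z
  proof (rule ccontr)
    assume less: "\<not> ?g (V - X) \<le> ?g Z"
    define U where "U = V - Z"
    have U: "U \<subseteq> X" "U \<subseteq> V" "Z = V - U" using Z by (auto simp: U_def)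
    have cU: "card U + card Z = card V" unfolding U_def by (rule card_Diff_add[OF finV Z(1)])
    then have oddU: "odd (card U)" using Z(3) fitsD(2)[OF fit] by presburger
    have "?g Z = ?g U + ?D V - 2 * ?D U" unfolding U(3) by (rule gap_compl[OF mg U(2)])
    moreover have "?g (V - X) = ?g X + ?D V - 2 * ?D X" by (rule gap_compl[OF mg X(1)])
    ultimately have *: "?g U - 2 * ?D U < ?g X - 2 * ?D X" using less by linarith
    have D: "?D U + int (card (X - U)) \<le> ?D X" by (rule Dmono[OF U(1) X(1)])
    have cXU: "card (X - U) + card U = card X" by (rule card_Diff_add[OF finX U(1)])
    show False
    proof (cases "card U = 1")
      case True
      then obtain y where y: "U = {y}" by (auto simp: card_1_singleton_iff)
      then have "?g U = int r" using gap_singleton[OF mg] by simp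
      then show False using * D X(6) cXU True by linarith
    next
      case False
      then have "3 \<le> card U" using oddU by presburger
      moreover have "?c U < ?c X" using * ge[OF U(2)] ge[OF X(1)] D by linarith
      \<comment> \<open>Shrinking \<open>X\<close> to \<open>U\<close> lowers the gap by more than
        twice the number of lost vertices, so the bound that depends on the size is
        inherited.\<close>
      moreover have gU: "?g U < ?g X - 2 * int (card (X - U))" using * D by linarith
      moreover have "?g U - int r \<le> 2 * int (card U) - 2" using gU X(6) cXU by linarith
      ultimately have "U \<in> S" using U oddU X cXU by (auto simp: S_def)
      then show False using least[of U] gU by linarith
    qed
  qed
  show ?thesis unfolding splittable_def
    by (rule exI[of _ X]) (use X super sub in auto)
qed

text \<open>A gap of \<open>r\<close> is the least possible, so \<open>X\<close> is minimal
  outright. For the complement, a subset \<open>U\<close> of \<open>X\<close> has gap at least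
  \<open>r\<close> and no larger deficiency sum; hence nonnegative deficiencies suffice.\<close>

lemma splittable_tight:
  assumes fit: "fits V E ends r" and X: "X \<subseteq> V" "odd (card X)" "3 \<le> card X" "card X + 3 \<le> card V" "gap r E ends X = int r"
  shows "splittable V E ends r 0"
proof -
  note mg = fitsD(1)[OF fit] and finV = fitsD(3)[OF fit]
  have nn: "0 \<le> dfc r E ends v" if "v \<in> V" for v using fitsD(5)[OF fit that] by (simp add: dfc_def)
  have "0 \<le> (\<Sum>v\<in>X. dfc r E ends v)" by (rule sum_nonneg) (use nn X in auto)
  then have cut: "int (cut E ends X) \<le> int r - 0" using gap_eq[OF mg X(1), of r] X(5) by simp
  have sub: "gap r E ends (V - X) \<le> gap r E ends Z" if Z: "Z \<subseteq> V" "V - X \<subseteq> Z" "odd (card Z)" for Z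
  proof -
    define U where "U = V - Z"
    have U: "U \<subseteq> X" "U \<subseteq> V" "Z = V - U" using Z by (auto simp: U_def)
    have "card U + card Z = card V" unfolding U_def by (rule card_Diff_add[OF finV Z(1)])
    then have "odd (card U)" using Z(3) fitsD(2)[OF fit] by presburger
    then have "int r \<le> gap r E ends U" using fitsD(6)[OF fit U(2)] by simp
    moreover have "(\<Sum>v\<in>U. dfc r E ends v) \<le> (\<Sum>v\<in>X. dfc r E ends v)"
      by (rule sum_mono2) (use U X finite_subset[OF X(1) finV] nn in auto)
    ultimately show ?thesis unfolding U(3) using gap_compl[OF mg U(2), of r] gap_compl[OF mg X(1), of r] X(5) by linarith
  qed
  show ?thesis unfolding splittable_def
    by (rule exI[of _ X]) (use X cut sub fitsD(6)[OF fit] in auto)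
qed

section \<open>Adding edges between deficient vertices\<close>

lemma fits_add_edge:
  assumes fit: "fits V E ends r" and e: "e \<notin> E" and yz: "y \<in> V" "z \<in> V" "y \<noteq> z"
    and dy: "1 \<le> dfc r E ends y" and dz: "1 \<le> dfc r E ends z"
    and free: "\<And>X. X \<subseteq> V \<Longrightarrow> odd (card X) \<Longrightarrow> y \<in> X \<Longrightarrow> z \<in> X \<Longrightarrow> int r + 2 \<le> gap r E ends X"
  shows "fits V (insert e E) (ends(e := {y,z})) r"
    and "\<And>v. dfc r (insert e E) (ends(e := {y,z})) v = dfc r E ends v - (if v = y \<or> v = z then 1 else 0)"
proof -
  note mg = fitsD(1)[OF fit] and finE = fitsD(4)[OF fit]
  have deg: "degree (insert e E) (ends(e := {y,z})) v = degree E ends v + (if v = y \<or> v = z then 1 else 0)" for v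
  proof -
    have "{f \<in> insert e E. v \<in> (ends(e := {y,z})) f} = (if v = y \<or> v = z then insert e {f\<in>E. v \<in> ends f} else {f\<in>E. v \<in> ends f})"
      using e by auto
    then show ?thesis using finE e by (simp add: degree_def)
  qed
  show dfc: "dfc r (insert e E) (ends(e := {y,z})) v = dfc r E ends v - (if v = y \<or> v = z then 1 else 0)" for v
    by (simp add: dfc_def deg)
  have ind: "induced_edges (insert e E) (ends(e := {y,z})) X = induced_edges E ends X + (if y \<in> X \<and> z \<in> X then 1 else 0)" for X
  proof -
    have "{f \<in> insert e E. (ends(e := {y,z})) f \<subseteq> X} = (if y \<in> X \<and> z \<in> X then insert e {f\<in>E. ends f \<subseteq> X} else {f\<in>E. ends f \<subseteq> X})"
      using e by auto
    then show ?thesis using finE e by (simp add: induced_edges_def)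
  qed
  show "fits V (insert e E) (ends(e := {y,z})) r"
    unfolding fits_def
  proof (intro conjI ballI allI impI)
    show "multigraph V (insert e E) (ends(e := {y,z}))" using mg yz e by (auto simp: multigraph_def)
    show "even (card V)" using fitsD(2)[OF fit] .
    show "degree (insert e E) (ends(e := {y,z})) v \<le> r" if "v \<in> V" for v
      using deg[of v] fitsD(5)[OF fit that] dy dz by (auto simp: dfc_def split: if_splits)
    show "int r \<le> gap r (insert e E) (ends(e := {y,z})) X" if "X \<subseteq> V" "odd (card X)" for X
      using fitsD(6)[OF fit that] free[OF that] ind[of X] by (auto simp: gap_def split: if_splits)
  qed
qed

text \<open>Lexicographic induction with one hypothesis per move: removing a matching lowers
  \<open>r\<close>, contracting lowers the order, and adding an edge lowers the total
  deficiency.\<close>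

lemma graph_induct [case_names step]:
  fixes P :: "nat \<Rightarrow> 'a set \<Rightarrow> 'e set \<Rightarrow> ('e \<Rightarrow> 'a set) \<Rightarrow> bool"
  assumes "\<And>r V E ends. (\<And>r' V' E' ends'. r' < r \<Longrightarrow> P r' V' E' ends') \<Longrightarrow>
      (\<And>V' E' ends'. card V' < card V \<Longrightarrow> P r V' E' ends') \<Longrightarrow>
      (\<And>E' ends'. nat (\<Sum>v\<in>V. dfc r E' ends' v) < nat (\<Sum>v\<in>V. dfc r E ends v) \<Longrightarrow> P r V E' ends') \<Longrightarrow>
      P r V E ends"
  shows "P r V E ends"
proof (induction r arbitrary: V E ends rule: less_induct)
  case (less r V E ends)
  note outer = less
  show ?case
  proof (induction "card V" arbitrary: V E ends rule: less_induct)
    case (less V E ends)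
    note middle = less
    show ?case
    proof (induction "nat (\<Sum>v\<in>V. dfc r E ends v)" arbitrary: E ends rule: less_induct)
      case inner: (less E ends)
      show ?case
      proof (rule assms)
        show "P r' V' E' ends'" if "r' < r" for r' V' E' ends' using outer[OF that] .
        show "P r V' E' ends'" if "card V' < card V" for V' E' ends' using middle[OF that] .
        show "P r V E' ends'" if "nat (\<Sum>v\<in>V. dfc r E' ends' v) < nat (\<Sum>v\<in>V. dfc r E ends v)" for E' ends'
          using inner[OF that] .
      qed
    qed
  qed
qed

lemma fill_step:
  fixes E :: "nat set"
  assumes fit: "fits V E ends r" and yz: "y \<in> V" "z \<in> V" "y \<noteq> z" "1 \<le> dfc r E ends y" "1 \<le> dfc r E ends z"
    and free: "\<And>X. X \<subseteq> V \<Longrightarrow> odd (card X) \<Longrightarrow> y \<in> X \<Longrightarrow> z \<in> X \<Longrightarrow> gap r E ends X \<noteq> int r"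
    and step: "\<And>(E' :: nat set) ends'. fits V E' ends' r \<Longrightarrow>
      (\<And>v. dfc r E' ends' v = dfc r E ends v - (if v = y \<or> v = z then 1 else 0)) \<Longrightarrow>
      nat (\<Sum>v\<in>V. dfc r E' ends' v) < nat (\<Sum>v\<in>V. dfc r E ends v) \<Longrightarrow> colourable E' ends' k"
  shows "colourable E ends k"
proof -
  obtain e where e: "e \<notin> E" using fitsD(4)[OF fit] ex_new_if_finite infinite_UNIV_nat by metis
  have free': "int r + 2 \<le> gap r E ends X" if "X \<subseteq> V" "odd (card X)" "y \<in> X" "z \<in> X" for X
    using free[OF that] fitsD(6)[OF fit that(1,2)] gap_parity[OF that(2), of r E ends] by presburger
  have add: "fits V (insert e E) (ends(e := {y,z})) r"
    by (rule fits_add_edge(1)[OF fit e yz]) (use free' in blast)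
  have dadd: "dfc r (insert e E) (ends(e := {y,z})) v = dfc r E ends v - (if v = y \<or> v = z then 1 else 0)" for v
    by (rule fits_add_edge(2)[OF fit e yz]) (use free' in blast)
  have nn: "0 \<le> dfc r E ends v" if "v \<in> V" for v using fitsD(5)[OF fit that] by (simp add: dfc_def)
  have "(\<Sum>v\<in>V. dfc r (insert e E) (ends(e := {y,z})) v) < (\<Sum>v\<in>V. dfc r E ends v)"
    by (rule sum_strict_mono_ex1) (use fitsD(3)[OF fit] dadd yz in auto)
  moreover have "0 < (\<Sum>v\<in>V. dfc r E ends v)"
    by (rule sum_pos2[of _ y]) (use fitsD(3)[OF fit] yz nn in auto)
  ultimately have less: "nat (\<Sum>v\<in>V. dfc r (insert e E) (ends(e := {y,z})) v) < nat (\<Sum>v\<in>V. dfc r E ends v)"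
    by linarith
  have "colourable (insert e E) (ends(e := {y,z})) k"
    by (rule step) (use add dadd less in auto)
  then show ?thesis by (rule colourable_mono) (use e in auto)
qed

text \<open>Edges are added at a vertex \<open>y\<close> of largest deficiency. Then a set
  \<open>V - {u}\<close> containing \<open>y\<close> and the other chosen vertex \<open>z\<close> is
  never tight: tightness would give \<open>u\<close> half of the total deficiency, but
  \<open>y\<close> alone has as much as \<open>u\<close>, and \<open>z\<close> has some too.\<close>

lemma fill_regular:
  fixes E :: "nat set"
  assumes "\<And>(V :: 'a set) (E :: nat set) ends. fits V E ends r \<Longrightarrow> card V \<le> n \<Longrightarrow> (\<And>v. v \<in> V \<Longrightarrow> dfc r E ends v = 0) \<Longrightarrow> colourable E ends k"
    and "fits (V :: 'a set) E ends r" "card V \<le> n"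
  shows "colourable E ends k"
  using assms
proof (induction r V E ends rule: graph_induct)
  case (step r V E ends)
  note reg = step.prems(1) and fit = step.prems(2) and cV = step.prems(3)
  note mg = fitsD(1)[OF fit] and finV = fitsD(3)[OF fit]
  let ?d = "dfc r E ends"
  have nn: "0 \<le> ?d v" if "v \<in> V" for v using fitsD(5)[OF fit that] by (simp add: dfc_def)
  show ?case
  proof (cases "splittable V E ends r 0")
    case True
    show ?thesis
    proof (rule splittable_colourable[OF fit order_refl True])
      show "colourable (contract_edges Y ends E) (contract_ends Y w ends) k"
        if "card (insert w (V - Y)) < card V" "fits (insert w (V - Y)) (contract_edges Y ends E) (contract_ends Y w ends) r" for Y w
        by (rule step.IH(2)[OF that(1) _ that(2)]) (use reg that(1) cV in auto)
    qed
  next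
    case nsplit: False
    show ?thesis
    proof (cases "\<forall>v\<in>V. ?d v = 0")
      case True
      then show ?thesis using reg[OF fit cV] by auto
    next
      case False
      then have Vne: "V \<noteq> {}" by auto
      have "Max (?d ` V) \<in> ?d ` V" using finV Vne by (intro Max_in) auto
      then obtain y where "y \<in> V" "?d y = Max (?d ` V)" by auto
      then have y: "y \<in> V" "\<And>u. u \<in> V \<Longrightarrow> ?d u \<le> ?d y" using finV by auto
      obtain v where "v \<in> V" "?d v \<noteq> 0" using False by blast
      then have dy: "1 \<le> ?d y" using y(2)[of v] nn[of v] by linarith
      \<comment> \<open>If \<open>y\<close> carried the whole deficiency, the gap of
        \<open>V - {y}\<close> would be \<open>r\<close> minus that deficiency.\<close>
      have "\<exists>z\<in>V. z \<noteq> y \<and> 1 \<le> ?d z"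
      proof (rule ccontr)
        assume "\<not> (\<exists>z\<in>V. z \<noteq> y \<and> 1 \<le> ?d z)"
        then have "?d z = 0" if "z \<in> V - {y}" for z using nn[of z] that by force
        then have "(\<Sum>v\<in>V. ?d v) = ?d y"
          using sum.remove[OF finV y(1), of ?d] by simp
        then have "gap r E ends (V - {y}) < int r" using gap_minus_vertex[OF mg y(1), of r] dy by simp
        moreover have "odd (card (V - {y}))" using card_Diff_add[OF finV, of "{y}"] y(1) fitsD(2)[OF fit] by auto
        ultimately show False using fitsD(6)[OF fit, of "V - {y}"] by auto
      qed
      then obtain z where z: "z \<in> V" "z \<noteq> y" "1 \<le> ?d z" by blast
      show ?thesis
      proof (rule fill_step[OF fit y(1) z(1) z(2)[symmetric] dy z(3)])
        show "gap r E ends X \<noteq> int r" if X: "X \<subseteq> V" "odd (card X)" "y \<in> X" "z \<in> X" for X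
        proof
          assume tight: "gap r E ends X = int r"
          have finX: "finite X" using X finV finite_subset by auto
          have "card {y,z} \<le> card X" using X finX by (intro card_mono) auto
          then have c3: "3 \<le> card X" using z X(2) by (cases "card X = 2") auto
          have "\<not> card X + 3 \<le> card V" using splittable_tight[OF fit X(1,2) c3] tight nsplit by auto
          moreover have "card X \<le> card V" using X finV by (intro card_mono)
          ultimately have "card (V - X) = 1"
            using card_Diff_add[OF finV X(1)] X(2) fitsD(2)[OF fit] by presburger
          then obtain u where u: "V - X = {u}" by (auto simp: card_1_singleton_iff)
          then have X': "X = V - {u}" "u \<in> V" using X(1) by auto
          then have "(\<Sum>v\<in>V. ?d v) = 2 * ?d u" using gap_minus_vertex[OF mg, of u r] tight by simp
          moreover have "(\<Sum>v\<in>{u,y,z}. ?d v) \<le> (\<Sum>v\<in>V. ?d v)"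
            using finV nn X' y z by (intro sum_mono2) auto
          moreover have "u \<noteq> y" "u \<noteq> z" using X X' by auto
          ultimately show False using z y(2)[OF X'(2)] by simp
        qed
        show "colourable E' ends' k" if "fits V E' ends' r" "nat (\<Sum>v\<in>V. dfc r E' ends' v) < nat (\<Sum>v\<in>V. ?d v)" for E' :: "nat set" and ends'
          by (rule step.IH(3)[OF that(2) _ that(1) cV]) (rule reg)
      qed
    qed
  qed
qed

section \<open>Removing a matching\<close>

lemma matching_of_involution:
  assumes "multigraph V E ends" "C \<subseteq> V"
    and f: "\<And>v. v \<in> C \<Longrightarrow> f v \<in> C \<and> f (f v) = v \<and> (\<exists>e\<in>E. ends e = {v, f v})"
  shows "\<exists>M\<subseteq>E. (\<forall>v\<in>C. degree M ends v = 1) \<and> (\<forall>v. v \<notin> C \<longrightarrow> degree M ends v = 0)"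
proof -
  \<comment> \<open>The choice depends only on the unordered pair, so both ends of a pair select the
    same one of several parallel edges.\<close>
  define g where "g v = (SOME e. e \<in> E \<and> ends e = {v, f v})" for v
  have g: "g v \<in> E \<and> ends (g v) = {v, f v}" if "v \<in> C" for v
    unfolding g_def using f[OF that] by (intro someI_ex[of "\<lambda>e. e \<in> E \<and> ends e = {v, f v}"]) blast
  have gf: "g (f v) = g v" if "v \<in> C" for v
    using f[OF that] unfolding g_def by (simp add: insert_commute)
  have "{e \<in> g ` C. v \<in> ends e} = {g v}" if v: "v \<in> C" for v
  proof
    show "{e \<in> g ` C. v \<in> ends e} \<subseteq> {g v}"
    proof
      fix e assume "e \<in> {e \<in> g ` C. v \<in> ends e}"
      then obtain u where u: "u \<in> C" "e = g u" "v \<in> ends (g u)" by auto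
      then have "v = u \<or> v = f u" using g[of u] by auto
      then show "e \<in> {g v}" using gf[of u] u by auto
    qed
  qed (use g[OF v] v in auto)
  then have 1: "degree (g ` C) ends v = 1" if "v \<in> C" for v using that by (simp add: degree_def)
  have "{e \<in> g ` C. v \<in> ends e} = {}" if "v \<notin> C" for v
    using that g f by auto
  then have 2: "degree (g ` C) ends v = 0" if "v \<notin> C" for v
    using that unfolding degree_def by (metis card.empty)
  have 3: "g ` C \<subseteq> E" using g by auto
  show ?thesis by (rule exI[of _ "g ` C"]) (simp add: 1 2 3)
qed

text \<open>\<open>M\<close> may miss vertices. Passing from \<open>Suc r\<close> to
  \<open>r\<close> and deleting \<open>M\<close> changes the deficiency of \<open>v\<close> by its
  degree in \<open>M\<close> minus 1, and the gap of \<open>X\<close> by twice the number of edges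
  of \<open>M\<close> inside \<open>X\<close> minus \<open>card X\<close>; \<open>deg\<close> and
  \<open>gp\<close> say that both stay within \<open>fits\<close>.\<close>

lemma remove_matching:
  assumes fit: "fits V E ends (Suc r)" and M: "M \<subseteq> E" and M1: "\<forall>v\<in>V. degree M ends v \<le> 1"
    and deg: "\<forall>v\<in>V. 2 \<le> dfc (Suc r) E ends v + int (degree M ends v) + 1"
    and gp: "\<forall>X\<subseteq>V. odd (card X) \<longrightarrow> int r + int (card X) \<le> gap (Suc r) E ends X + 2 * int (induced_edges M ends X)"
  shows "fits V (E - M) ends r"
    and "\<And>v. dfc r (E - M) ends v = dfc (Suc r) E ends v + int (degree M ends v) - 1"
    and "colourable (E - M) ends k \<Longrightarrow> colourable E ends (Suc k)"
proof -
  note mg = fitsD(1)[OF fit] and finE = fitsD(4)[OF fit]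
  have finM: "finite M" using M finE finite_subset by auto
  have split: "card {e\<in>E. Q e} = card {e\<in>E - M. Q e} + card {e\<in>M. Q e}" for Q
  proof -
    have "{e\<in>E. Q e} = {e\<in>E - M. Q e} \<union> {e\<in>M. Q e}" using M by auto
    moreover have "card ({e\<in>E - M. Q e} \<union> {e\<in>M. Q e}) = card {e\<in>E - M. Q e} + card {e\<in>M. Q e}"
      using finE finM by (intro card_Un_disjoint) auto
    ultimately show ?thesis by simp
  qed
  have d: "degree E ends v = degree (E - M) ends v + degree M ends v" for v
    unfolding degree_def by (rule split)
  have i: "induced_edges E ends X = induced_edges (E - M) ends X + induced_edges M ends X" for X
    unfolding induced_edges_def by (rule split)
  show dfc: "dfc r (E - M) ends v = dfc (Suc r) E ends v + int (degree M ends v) - 1" for v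
    by (simp add: dfc_def d)
  show "fits V (E - M) ends r"
    unfolding fits_def
  proof (intro conjI ballI allI impI)
    show "multigraph V (E - M) ends" using mg by (auto simp: multigraph_def)
    show "even (card V)" using fitsD(2)[OF fit] .
    show "degree (E - M) ends v \<le> r" if "v \<in> V" for v
      using bspec[OF deg that] dfc[of v] by (simp add: dfc_def)
    show "int r \<le> gap r (E - M) ends X" if "X \<subseteq> V" "odd (card X)" for X
      using gp[rule_format, OF that] i[of X] by (simp add: gap_def algebra_simps)
  qed
  show "colourable E ends (Suc k)" if "colourable (E - M) ends k"
  proof (rule colourable_add_matching[OF that])
    fix e f assume ef: "e \<in> M" "f \<in> M" "e \<noteq> f"
    show "ends e \<inter> ends f = {}"
    proof (rule ccontr)
      assume "ends e \<inter> ends f \<noteq> {}"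
      then obtain v where v: "v \<in> ends e" "v \<in> ends f" by auto
      then have "v \<in> V" using multigraphD(3)[OF mg, of e] M ef by auto
      have "card {e,f} \<le> card {e\<in>M. v \<in> ends e}" using ef v finM by (intro card_mono) auto
      then show False using bspec[OF M1 \<open>v \<in> V\<close>] ef by (simp add: degree_def)
    qed
  qed
qed

text \<open>No edge joins two pieces, so every edge in one of the cuts has its other end in
  \<open>T\<close> and belongs to a single piece.\<close>

lemma sum_cut_le:
  assumes mg: "multigraph V E ends" and T: "finite T" and P: "finite P" "disjoint P"
    and sep: "\<And>C e. C \<in> P \<Longrightarrow> e \<in> E \<Longrightarrow> ends e \<inter> C \<noteq> {} \<Longrightarrow> ends e \<subseteq> C \<union> T"
    and PT: "\<And>C. C \<in> P \<Longrightarrow> C \<inter> T = {}"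
  shows "(\<Sum>C\<in>P. cut E ends C) \<le> (\<Sum>t\<in>T. degree E ends t)"
proof -
  let ?q = "\<lambda>C. {e\<in>E. ends e \<inter> C \<noteq> {} \<and> \<not> ends e \<subseteq> C}"
  have finE: "finite E" using multigraphD(2)[OF mg] .
  have "(\<Sum>C\<in>P. cut E ends C) = card (\<Union>C\<in>P. ?q C)"
    unfolding cut_def
  proof (rule card_UN_disjoint[symmetric])
    show "\<forall>C\<in>P. \<forall>D\<in>P. C \<noteq> D \<longrightarrow> ?q C \<inter> ?q D = {}"
    proof (intro ballI impI)
      fix C D assume CD: "C \<in> P" "D \<in> P" "C \<noteq> D"
      then have "C \<inter> D = {}" using P(2) by (auto simp: disjoint_def)
      then show "?q C \<inter> ?q D = {}" using sep[OF CD(1)] PT[OF CD(2)] by blast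
    qed
  qed (use P finE in auto)
  also have "\<dots> \<le> card (\<Union>t\<in>T. {e\<in>E. t \<in> ends e})"
  proof (rule card_mono)
    show "finite (\<Union>t\<in>T. {e\<in>E. t \<in> ends e})" using finE T by simp
    show "(\<Union>C\<in>P. ?q C) \<subseteq> (\<Union>t\<in>T. {e\<in>E. t \<in> ends e})"
    proof
      fix e assume "e \<in> (\<Union>C\<in>P. ?q C)"
      then obtain C where C: "C \<in> P" "e \<in> E" "ends e \<inter> C \<noteq> {}" "\<not> ends e \<subseteq> C" by blast
      then obtain t where "t \<in> T" "t \<in> ends e" using sep[OF C(1-3)] by blast
      then show "e \<in> (\<Union>t\<in>T. {e\<in>E. t \<in> ends e})" using C(2) by blast
    qed
  qed
  also have "\<dots> \<le> (\<Sum>t\<in>T. degree E ends t)"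
    unfolding degree_def by (rule card_UN_le[OF T])
  finally show ?thesis .
qed

section \<open>Tutte barriers\<close>

lemma odd_subset_cases:
  assumes "finite V" "even (card V)" "X \<subseteq> V" "odd (card X)"
  obtains v where "v \<in> V" "X = {v}" | v where "v \<in> V" "X = V - {v}" | "3 \<le> card X" "card X + 3 \<le> card V"
proof -
  have c: "card (V - X) + card X = card V" using assms by (intro card_Diff_add) auto
  have "card X = 1 \<or> card (V - X) = 1 \<or> 3 \<le> card X \<and> card X + 3 \<le> card V"
    using c assms(2,4) by presburger
  then consider "card X = 1" | "card (V - X) = 1" | "3 \<le> card X" "card X + 3 \<le> card V" by blast
  then show thesis
  proof cases
    case 1
    then obtain v where "X = {v}" by (auto simp: card_1_singleton_iff)
    then show ?thesis using that(1)[of v] assms(3) by auto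
  next
    case 2
    then obtain v where "V - X = {v}" by (auto simp: card_1_singleton_iff)
    then show ?thesis using that(2)[of v] assms(3) by blast
  next
    case 3 then show ?thesis by (rule that(3))
  qed
qed

text \<open>The number of odd blocks has the parity of \<open>card T\<close> when the order is even,
  so an excess of one is an excess of two.\<close>

lemma tutte_even:
  assumes "finite V" "even (card V)" "symp R" "irreflp R" "\<not> pmatch R V"
  shows "\<exists>T P. T \<subseteq> V \<and> \<Union>P = V - T \<and> finite P \<and> disjoint P \<and>
    (\<forall>C\<in>P. \<forall>D\<in>P. \<forall>u\<in>C. \<forall>v\<in>D. R u v \<longrightarrow> C = D) \<and> card T + 2 \<le> card {C\<in>P. odd (card C)}"
proof -
  obtain T P where TP: "T \<subseteq> V" "\<Union>P = V - T" "disjoint P"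
    "\<forall>C\<in>P. \<forall>D\<in>P. \<forall>u\<in>C. \<forall>v\<in>D. R u v \<longrightarrow> C = D" "card T < card {C\<in>P. odd (card C)}"
    using tutte_obstruction[OF assms(1,3-5)] by (elim exE conjE) (rule that; assumption)
  have fP: "finite P" using TP(2) assms(1) by (intro finite_UnionD) simp
  have "card (\<Union>P) = sum card P"
    by (rule card_Union_disjoint)
      (use TP(2,3) assms(1) in \<open>auto simp: disjoint_def pairwise_def disjnt_def intro: finite_subset[OF Union_upper]\<close>)
  then have "card T + sum card P = card V" using card_Diff_add[OF assms(1) TP(1)] TP(2) by simp
  then have "even (card T + sum card P)" using assms(2) by simp
  then have "even (card T) \<longleftrightarrow> even (card {C\<in>P. odd (card C)})"
    using even_sum_iff_card_odd[OF fP, of card] by simp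
  then have "card T + 2 \<le> card {C\<in>P. odd (card C)}" using TP(5) by presburger
  then show ?thesis using TP fP by (intro exI[of _ T] exI[of _ P] conjI)
qed

text \<open>Only odd blocks are recorded, since only they are counted and have a guaranteed
  gap.\<close>

definition barrier :: "'a set \<Rightarrow> 'e set \<Rightarrow> ('e \<Rightarrow> 'a set) \<Rightarrow> 'a set \<Rightarrow> 'a set set \<Rightarrow> bool" where
  "barrier V E ends T P \<longleftrightarrow> T \<subseteq> V \<and> finite P \<and> disjoint P \<and> (\<forall>C\<in>P. C \<subseteq> V - T \<and> odd (card C)) \<and>
     (\<forall>C\<in>P. \<forall>e\<in>E. ends e \<inter> C \<noteq> {} \<longrightarrow> ends e \<subseteq> C \<union> T)"

lemma barrier_sum_cut:
  assumes "multigraph V E ends" "barrier V E ends T P" "Q \<subseteq> P"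
  shows "(\<Sum>C\<in>Q. cut E ends C) \<le> (\<Sum>t\<in>T. degree E ends t)"
proof (rule sum_cut_le[OF assms(1)])
  show "finite T" using assms multigraphD(1)[OF assms(1)] finite_subset by (auto simp: barrier_def)
  show "finite Q" using assms finite_subset by (auto simp: barrier_def)
  show "disjoint Q" using assms(2,3) by (auto simp: barrier_def intro: pairwise_subset)
  show "ends e \<subseteq> C \<union> T" if "C \<in> Q" "e \<in> E" "ends e \<inter> C \<noteq> {}" for C e
    using assms that unfolding barrier_def by blast
  show "C \<inter> T = {}" if "C \<in> Q" for C using assms that unfolding barrier_def by blast
qed

lemma barrierI:
  assumes mg: "multigraph V E ends" and T: "T \<subseteq> V" and P: "finite P" "disjoint P"
    and Q: "Q \<subseteq> P" "\<And>C. C \<in> Q \<Longrightarrow> C \<subseteq> V" "\<And>C. C \<in> Q \<Longrightarrow> odd (card C)"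
    and UP: "V - T \<subseteq> \<Union>P" "\<Union>P \<inter> T = {}"
    and sep: "\<And>C D u v e. C \<in> P \<Longrightarrow> D \<in> P \<Longrightarrow> u \<in> C \<Longrightarrow> v \<in> D \<Longrightarrow> e \<in> E \<Longrightarrow> ends e = {u,v} \<Longrightarrow> C = D"
  shows "barrier V E ends T Q"
  unfolding barrier_def
proof (intro conjI ballI impI)
  show "T \<subseteq> V" "finite Q" using T P Q(1) finite_subset by auto
  show "disjoint Q" using P(2) Q(1) by (rule pairwise_subset)
  show "odd (card C)" if "C \<in> Q" for C using Q that by blast
  show "C \<subseteq> V - T" if "C \<in> Q" for C using Q(2)[OF that] Q(1) UP(2) that by blast
  fix C e assume C: "C \<in> Q" and e: "e \<in> E" and ne: "ends e \<inter> C \<noteq> {}"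
  obtain p q where "ends e = {p,q}" using multigraphD(4)[OF mg e] by (meson card_2_iff)
  then obtain a b where ab: "ends e = {a,b}" "a \<in> C" using ne by (cases "p \<in> C") (use insert_commute in auto)
  show "ends e \<subseteq> C \<union> T"
  proof (cases "b \<in> T")
    case False
    then have "b \<in> V - T" using multigraphD(3)[OF mg e] ab by auto
    then obtain D where "D \<in> P" "b \<in> D" using UP(1) by blast
    then have "C = D" using sep[of C D a b e] C Q(1) ab e by blast
    then show ?thesis using ab \<open>b \<in> D\<close> by auto
  qed (use ab in auto)
qed

section \<open>Barriers against perfect and near-perfect matchings\<close>

lemma perfect_matching_or_barrier:
  assumes mg: "multigraph V E ends" and ev: "even (card V)"
    and none: "\<not> (\<exists>M\<subseteq>E. \<forall>v\<in>V. degree M ends v = 1)"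
  shows "\<exists>T P. barrier V E ends T P \<and> card T + 2 \<le> card P"
proof -
  let ?R = "\<lambda>u v. u \<noteq> v \<and> (\<exists>e\<in>E. ends e = {u,v})"
  have "\<not> pmatch ?R V"
  proof
    assume "pmatch ?R V"
    then obtain f where f: "\<forall>v\<in>V. f v \<in> V \<and> f (f v) = v \<and> ?R v (f v)" by (auto simp: pmatch_def)
    have "\<exists>M\<subseteq>E. (\<forall>v\<in>V. degree M ends v = 1) \<and> (\<forall>v. v \<notin> V \<longrightarrow> degree M ends v = 0)"
      by (rule matching_of_involution[OF mg, of V f]) (use f in auto)
    then show False using none by blast
  qed
  moreover have "symp ?R" by (auto simp: symp_def insert_commute)
  moreover have "irreflp ?R" by (auto simp: irreflp_def)
  ultimately have "\<exists>T P. T \<subseteq> V \<and> \<Union>P = V - T \<and> finite P \<and> disjoint P \<and>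
    (\<forall>C\<in>P. \<forall>D\<in>P. \<forall>u\<in>C. \<forall>v\<in>D. ?R u v \<longrightarrow> C = D) \<and> card T + 2 \<le> card {C\<in>P. odd (card C)}"
    by (intro tutte_even[OF multigraphD(1)[OF mg] ev]) auto
  then obtain T P where TP: "T \<subseteq> V" "\<Union>P = V - T" "finite P" "disjoint P"
    "\<forall>C\<in>P. \<forall>D\<in>P. \<forall>u\<in>C. \<forall>v\<in>D. ?R u v \<longrightarrow> C = D" "card T + 2 \<le> card {C\<in>P. odd (card C)}"
    by (elim exE conjE) (rule that; assumption)
  have "barrier V E ends T {C\<in>P. odd (card C)}"
  proof (rule barrierI[OF mg TP(1,3,4)])
    show "C = D" if "C \<in> P" "D \<in> P" "u \<in> C" "v \<in> D" "e \<in> E" "ends e = {u,v}" for C D u v e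
    proof -
      have "u \<noteq> v" using multigraphD(4)[OF mg that(5)] that(6) by auto
      then show ?thesis using TP(5) that by blast
    qed
  qed (use TP(2) in auto)
  then show ?thesis using TP(6) by blast
qed

text \<open>Tutte's theorem for the graph with two further vertices that are adjacent to each other
and to all of \<open>U\<close>.\<close>

lemma near_perfect_matching_or_barrier:
  fixes V :: "nat set"
  assumes mg: "multigraph V E ends" and ev: "even (card V)" and U: "U \<subseteq> V"
    and none: "\<not> (\<exists>M\<subseteq>E. (\<forall>v\<in>V. degree M ends v \<le> 1) \<and> (\<forall>v\<in>V - U. degree M ends v = 1) \<and>
      card {v\<in>V. degree M ends v = 0} \<le> 2)"
  shows "\<exists>T P. barrier V E ends T P \<and> (card T + 1 \<le> card P \<and> (\<forall>C\<in>P. C \<inter> U = {}) \<or> card T + 4 \<le> card P)"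
proof -
  have finV: "finite V" using multigraphD(1)[OF mg] .
  obtain a where a: "a \<notin> V" using finV ex_new_if_finite infinite_UNIV_nat by metis
  obtain b where b: "b \<notin> insert a V" using finV ex_new_if_finite infinite_UNIV_nat by (metis finite_insert)
  let ?N = "{a,b}"
  let ?W = "insert a (insert b V)"
  define R where "R u v \<longleftrightarrow> u \<noteq> v \<and> ((\<exists>e\<in>E. ends e = {u,v}) \<or> u \<in> ?N \<and> v \<in> ?N \<union> U \<or> v \<in> ?N \<and> u \<in> ?N \<union> U)" for u v
  have ab: "a \<noteq> b" "b \<notin> V" using b by auto
  have cW: "card ?W = card V + 2" using a b finV by simp
  have eV: "ends e \<subseteq> V" if "e \<in> E" for e using multigraphD(3)[OF mg that] .
  have "\<not> pmatch R ?W"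
  proof
    assume "pmatch R ?W"
    then obtain f where f: "\<And>v. v \<in> ?W \<Longrightarrow> f v \<in> ?W \<and> f (f v) = v \<and> R v (f v)" by (auto simp: pmatch_def)
    define C where "C = {v\<in>V. f v \<in> V}"
    have "\<exists>M\<subseteq>E. (\<forall>v\<in>C. degree M ends v = 1) \<and> (\<forall>v. v \<notin> C \<longrightarrow> degree M ends v = 0)"
    proof (rule matching_of_involution[OF mg])
      show "f v \<in> C \<and> f (f v) = v \<and> (\<exists>e\<in>E. ends e = {v, f v})" if "v \<in> C" for v
        using f[of v] that a ab by (auto simp: C_def R_def)
    qed (auto simp: C_def)
    then obtain M where M: "M \<subseteq> E" "\<forall>v\<in>C. degree M ends v = 1" "\<forall>v. v \<notin> C \<longrightarrow> degree M ends v = 0"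
      by blast
    have N: "v \<in> U \<and> v \<in> {f a, f b}" if "v \<in> V" "v \<notin> C" for v
    proof -
      have v: "f v \<in> ?W" "f (f v) = v" "R v (f v)" using f[of v] that by auto
      then have "f v = a \<or> f v = b" using that by (auto simp: C_def)
      moreover have "v \<notin> ?N" using that a ab by auto
      moreover have "\<not> (\<exists>e\<in>E. ends e = {v, f v})" using eV calculation(1) a ab by fastforce
      ultimately show ?thesis using v by (auto simp: R_def)
    qed
    have "{v\<in>V. degree M ends v = 0} \<subseteq> {f a, f b}" using N M by fastforce
    then have "card {v\<in>V. degree M ends v = 0} \<le> card {f a, f b}" by (intro card_mono) auto
    also have "\<dots> \<le> 2" by (simp add: card_insert_if)
    finally have "card {v\<in>V. degree M ends v = 0} \<le> 2" .
    moreover have "\<forall>v\<in>V. degree M ends v \<le> 1" using M by (metis le_numeral_extra(4) zero_le)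
    moreover have "\<forall>v\<in>V - U. degree M ends v = 1" using M(2) N by blast
    ultimately show False using none M(1) by blast
  qed
  moreover have "symp R" unfolding symp_def R_def by (auto simp: insert_commute)
  moreover have "irreflp R" by (auto simp: irreflp_def R_def)
  ultimately have "\<exists>T P. T \<subseteq> ?W \<and> \<Union>P = ?W - T \<and> finite P \<and> disjoint P \<and>
    (\<forall>C\<in>P. \<forall>D\<in>P. \<forall>u\<in>C. \<forall>v\<in>D. R u v \<longrightarrow> C = D) \<and> card T + 2 \<le> card {C\<in>P. odd (card C)}"
    using cW ev finV by (intro tutte_even) auto
  then obtain T P where TP: "T \<subseteq> ?W" "\<Union>P = ?W - T" "finite P" "disjoint P"
    "\<forall>C\<in>P. \<forall>D\<in>P. \<forall>u\<in>C. \<forall>v\<in>D. R u v \<longrightarrow> C = D" "card T + 2 \<le> card {C\<in>P. odd (card C)}"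
    by (elim exE conjE) (rule that; assumption)
  define T0 where "T0 = T \<inter> V"
  define Q where "Q = {C\<in>P. odd (card C)}"
  have finQ: "finite Q" using TP(3) by (simp add: Q_def)
  have bar: "barrier V E ends T0 Q'" if Q': "Q' \<subseteq> Q" "\<And>C. C \<in> Q' \<Longrightarrow> a \<notin> C \<and> b \<notin> C" for Q'
  proof (rule barrierI[OF mg _ TP(3,4)])
    show "T0 \<subseteq> V" "Q' \<subseteq> P" using Q' by (auto simp: T0_def Q_def)
    show "odd (card C)" if "C \<in> Q'" for C using Q' that by (auto simp: Q_def)
    show "C \<subseteq> V" if "C \<in> Q'" for C
    proof -
      have "C \<subseteq> ?W" using Q'(1) that TP(2) by (auto simp: Q_def)
      then show ?thesis using Q'(2)[OF that] by auto
    qed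
    show "V - T0 \<subseteq> \<Union>P" "\<Union>P \<inter> T0 = {}" using TP(2) by (auto simp: T0_def)
    show "C = D" if "C \<in> P" "D \<in> P" "u \<in> C" "v \<in> D" "e \<in> E" "ends e = {u,v}" for C D u v e
    proof -
      have "u \<noteq> v" using multigraphD(4)[OF mg that(5)] that(6) by auto
      then have "R u v" using that by (auto simp: R_def)
      then show ?thesis using TP(5) that by blast
    qed
  qed
  have finT: "finite T" using TP(1) finV finite_subset by auto
  show ?thesis
  \<comment> \<open>If both new vertices lie in \<open>T\<close>, deleting them raises the excess
    from 2 to 4. Otherwise the block of a remaining one absorbs all of \<open>U\<close> outside
    \<open>T\<close>; dropping this block costs one and leaves blocks that avoid
    \<open>U\<close>.\<close>
  proof (cases "a \<in> T \<and> b \<in> T")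
    case True
    have "T = insert a (insert b T0)" using TP(1) True by (auto simp: T0_def)
    then have "card T = card (insert a (insert b T0))" by (rule arg_cong)
    also have "\<dots> = card T0 + 2" using finT a ab by (simp add: T0_def)
    finally have "card T = card T0 + 2" .
    then have "card T0 + 4 \<le> card Q" using TP(6) by (simp add: Q_def)
    moreover have "a \<notin> C \<and> b \<notin> C" if "C \<in> Q" for C using that True TP(2) by (auto simp: Q_def)
    ultimately show ?thesis using bar[of Q] by blast
  next
    case False
    then obtain c where c: "c \<in> ?N" "c \<notin> T" by auto
    then have "c \<in> \<Union>P" using TP(2) by auto
    then obtain A where A: "A \<in> P" "c \<in> A" by blast
    have other: "C \<inter> (?N \<union> U) = {}" if C: "C \<in> P" "C \<noteq> A" for C
    proof (rule ccontr)
      assume "C \<inter> (?N \<union> U) \<noteq> {}"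
      then obtain u where u: "u \<in> C" "u \<in> ?N \<union> U" by blast
      have "u \<noteq> c" using u(1) A C TP(4) by (auto simp: disjoint_def)
      then have "R c u" using c u by (auto simp: R_def)
      then show False using TP(5) A C u by blast
    qed
    have "T0 \<subseteq> T" by (auto simp: T0_def)
    then have "card T0 \<le> card T" using finT by (rule card_mono[rotated])
    moreover have "card Q \<le> card (Q - {A}) + 1" using finQ by (auto simp: card_Diff_singleton_if)
    ultimately have "card T0 + 1 \<le> card (Q - {A})" using TP(6) by (simp add: Q_def)
    moreover have "\<forall>C\<in>Q - {A}. C \<inter> U = {}" using other by (auto simp: Q_def)
    moreover have "barrier V E ends T0 (Q - {A})"
      using other by (intro bar) (auto simp: Q_def)
    ultimately show ?thesis by blast
  qed
qed

lemma cut_eq_gap: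
  assumes "multigraph V E ends" "X \<subseteq> V"
  shows "int (cut E ends X) = gap r E ends X - (\<Sum>v\<in>X. dfc r E ends v)"
  using gap_eq[OF assms, of r] by simp

text \<open>In the applications \<open>y\<close> is the one vertex whose deficiency is not under
  control. Apart from one block through \<open>y\<close> and one with more than half of the
  vertices, every block gives a split if its cut is small.\<close>

lemma card_outside_le:
  assumes "finite Q" "disjoint Q" "\<And>C. C \<in> Q \<Longrightarrow> C \<subseteq> V" "finite V"
  shows "card Q \<le> card {C\<in>Q. y \<notin> C \<and> 2 * card C \<le> card V} + card {C\<in>Q. y \<notin> C \<and> card V < 2 * card C} + 1"
    and "card {C\<in>Q. y \<notin> C \<and> card V < 2 * card C} \<le> 1"
proof -
  let ?A = "{C\<in>Q. y \<notin> C \<and> 2 * card C \<le> card V}" and ?B = "{C\<in>Q. y \<notin> C \<and> card V < 2 * card C}"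
  have one: "card S \<le> 1" if S: "S \<subseteq> Q" and meet: "\<And>C D. C \<in> S \<Longrightarrow> D \<in> S \<Longrightarrow> C \<inter> D \<noteq> {}" for S
  proof -
    have "C = D" if "C \<in> S" "D \<in> S" for C D
    proof (rule ccontr)
      assume "C \<noteq> D"
      then have "C \<inter> D = {}" using assms(2) S that unfolding disjoint_def by blast
      then show False using meet[OF that] by simp
    qed
    moreover have "finite S" using S assms(1) finite_subset by auto
    ultimately show ?thesis by (simp add: card_le_Suc0_iff_eq)
  qed
  show "card ?B \<le> 1"
  proof (rule one)
    fix C D assume CD: "C \<in> ?B" "D \<in> ?B"
    show "C \<inter> D \<noteq> {}"
    proof
      assume "C \<inter> D = {}"
      moreover have "C \<subseteq> V" "D \<subseteq> V" using CD assms(3) by auto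
      then have "finite C" "finite D" using assms(4) by (auto intro: finite_subset)
      ultimately have "card (C \<union> D) = card C + card D" by (simp add: card_Un_disjoint)
      moreover have "card (C \<union> D) \<le> card V" using CD assms(3,4) by (intro card_mono) auto
      ultimately show False using CD by auto
    qed
  qed auto
  have "card {C\<in>Q. y \<in> C} \<le> 1" by (rule one) auto
  moreover have "card Q \<le> card (?A \<union> ?B \<union> {C\<in>Q. y \<in> C})" using assms(1) by (intro card_mono) auto
  moreover have "card (?A \<union> ?B \<union> {C\<in>Q. y \<in> C}) \<le> card ?A + card ?B + card {C\<in>Q. y \<in> C}"
    using card_Un_le[of "?A \<union> ?B" "{C\<in>Q. y \<in> C}"] card_Un_le[of ?A ?B] by linarith
  ultimately show "card Q \<le> card ?A + card ?B + 1" by linarith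
qed

section \<open>The bound in terms of the order\<close>

definition order_bound :: "nat \<Rightarrow> nat \<Rightarrow> bool" where
  "order_bound n k \<longleftrightarrow> (\<forall>(V :: nat set) (E :: nat set) ends r.
     fits V E ends r \<longrightarrow> card V \<le> n \<longrightarrow> colourable E ends (r + k))"

text \<open>Deficiency 2 lets a removed matching miss the vertex once, which leaves deficiency
  1.\<close>

definition slack_bound :: "nat \<Rightarrow> nat \<Rightarrow> bool" where
  "slack_bound b k \<longleftrightarrow> (\<forall>(V :: nat set) (E :: nat set) ends r.
     fits V E ends r \<longrightarrow> (\<forall>v\<in>V. 2 \<le> dfc r E ends v) \<longrightarrow> r \<le> b \<longrightarrow> colourable E ends (r + k))"

lemma sum_remove_ge:
  assumes "finite V" "y \<in> V" "\<And>v. v \<in> V \<Longrightarrow> 1 \<le> (f v :: int)"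
  shows "int (card V) - 1 + f y \<le> (\<Sum>v\<in>V. f v)"
proof -
  have "(\<Sum>v\<in>V - {y}. 1) \<le> (\<Sum>v\<in>V - {y}. f v)" by (rule sum_mono) (use assms in auto)
  moreover have "(\<Sum>v\<in>V - {y}. 1 :: int) = int (card V) - 1"
    using card.remove[OF assms(1,2)] by simp
  ultimately show ?thesis using sum.remove[OF assms(1,2), of f] by linarith
qed

text \<open>Take a barrier. A block avoiding \<open>y\<close> with at most half of the vertices has
  cut at least \<open>r\<close>, since otherwise its gap, order plus cut, permits a split. The cuts
  sum to at most \<open>r * card T\<close>, so a large block avoiding \<open>y\<close> must exist
  and its cut is empty. Its complement contains \<open>y\<close> and permits a split unless it is
  \<open>{y}\<close>.\<close>

lemma perfect_matching_or_isolated: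
  assumes fit: "fits V E ends (Suc r)" and y: "y \<in> V" and c6: "6 \<le> card V"
    and one: "\<And>v. v \<in> V \<Longrightarrow> v \<noteq> y \<Longrightarrow> dfc (Suc r) E ends v = 1" and ypos: "1 \<le> dfc (Suc r) E ends y"
    and H: "\<And>u. u \<in> V \<Longrightarrow> int (card V div 2) - 1 \<le> (\<Sum>v\<in>V. dfc (Suc r) E ends v) - 2 * dfc (Suc r) E ends u"
    and ns: "\<not> splittable V E ends (Suc r) 1" and none: "\<not> (\<exists>M\<subseteq>E. \<forall>v\<in>V. degree M ends v = 1)"
  shows "degree E ends y = 0"
proof (rule ccontr)
  assume y0: "degree E ends y \<noteq> 0"
  note mg = fitsD(1)[OF fit] and ev = fitsD(2)[OF fit] and finV = fitsD(3)[OF fit]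
  let ?d = "dfc (Suc r) E ends"
  have pos: "1 \<le> ?d v" if "v \<in> V" for v using one[OF that] ypos by (cases "v = y") auto
  have split: "splittable V E ends (Suc r) 1"
    if "X \<subseteq> V" "odd (card X)" "3 \<le> card X" "card X + 3 \<le> card V" "int (cut E ends X) \<le> int (Suc r) - 1"
      "gap (Suc r) E ends X - int (Suc r) \<le> 2 * int (card X) - 2" "gap (Suc r) E ends X - int (Suc r) \<le> int (card V div 2) - 1" for X
    by (rule splittableI[OF fit pos H that])
  have degle: "degree E ends v \<le> r" if "v \<in> V" for v using pos[OF that] by (simp add: dfc_def)
  then have r1: "1 \<le> r" using y0 degle[OF y] by linarith
  obtain T P where bar: "barrier V E ends T P" and TP: "card T + 2 \<le> card P"
    using perfect_matching_or_barrier[OF mg ev none] by blast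
  have P: "finite P" "disjoint P" "\<And>C. C \<in> P \<Longrightarrow> C \<subseteq> V" "\<And>C. C \<in> P \<Longrightarrow> odd (card C)" "T \<subseteq> V"
    using bar unfolding barrier_def by blast+
  have Tdeg: "(\<Sum>t\<in>T. degree E ends t) \<le> r * card T"
    using sum_bounded_above[of T "degree E ends" r] degle P(5) by (auto simp: mult.commute)
  define A where "A = {C\<in>P. y \<notin> C \<and> 2 * card C \<le> card V}"
  define B where "B = {C\<in>P. y \<notin> C \<and> card V < 2 * card C}"
  have cAB: "card P \<le> card A + card B + 1" "card B \<le> 1"
    using card_outside_le[OF P(1-3) finV, of y] by (auto simp: A_def B_def)
  have big: "r \<le> cut E ends C" if C: "C \<in> A" for C
  proof (rule ccontr)
    assume small: "\<not> r \<le> cut E ends C"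
    have CV: "C \<subseteq> V" "odd (card C)" "y \<notin> C" "2 * card C \<le> card V" using C P by (auto simp: A_def)
    have "(\<Sum>v\<in>C. ?d v) = (\<Sum>v\<in>C. 1)" by (rule sum.cong) (use one CV in auto)
    then have D: "(\<Sum>v\<in>C. ?d v) = int (card C)" by simp
    have g: "gap (Suc r) E ends C = int (card C) + int (cut E ends C)" using gap_eq[OF mg CV(1), of "Suc r"] D by simp
    have "splittable V E ends (Suc r) 1"
    proof (rule odd_subset_cases[OF finV ev CV(1,2)])
      fix v assume "v \<in> V" "C = {v}"
      then show ?thesis using g gap_singleton[OF mg, of "Suc r" v] small by simp
    next
      fix v assume "v \<in> V" "C = V - {v}"
      then have "card C + 1 = card V" using finV by (metis Suc_eq_plus1 card_Suc_Diff1)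
      then show ?thesis using CV(4) c6 by linarith
    next
      assume "3 \<le> card C" "card C + 3 \<le> card V"
      then show ?thesis
        by (rule split[OF CV(1,2)]) (use small g CV(4) in auto)
    qed
    then show False using ns by simp
  qed
  have sumA: "r * card A \<le> (\<Sum>C\<in>A. cut E ends C)"
    using sum_bounded_below[of A r "cut E ends"] big by (auto simp: mult.commute)
  have finA: "finite A" using P(1) by (simp add: A_def)
  have total: "(\<Sum>C\<in>Q. cut E ends C) \<le> r * card T" if "Q \<subseteq> P" for Q
    using barrier_sum_cut[OF mg bar that] Tdeg by linarith
  show False
  proof (cases "B = {}")
    case True
    then have "card T + 1 \<le> card A" using cAB(1) TP by simp
    then have "r * (card T + 1) \<le> r * card A" by (rule mult_le_mono2)
    also have "\<dots> \<le> r * card T"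
    proof -
      have "A \<subseteq> P" by (auto simp: A_def)
      then show ?thesis using sumA total[of A] by linarith
    qed
    finally show False using r1 by simp
  next
    case False
    then obtain C where C: "C \<in> B" by blast
    have CV: "C \<subseteq> V" "odd (card C)" "y \<notin> C" "card V < 2 * card C" using C P by (auto simp: B_def)
    have "card T \<le> card A" using cAB TP by simp
    then have "r * card T \<le> r * card A" by (rule mult_le_mono2)
    moreover have "C \<notin> A" using CV by (auto simp: A_def)
    then have "(\<Sum>C\<in>insert C A. cut E ends C) = cut E ends C + (\<Sum>C\<in>A. cut E ends C)" using finA by simp
    moreover have "(\<Sum>C\<in>insert C A. cut E ends C) \<le> r * card T" by (rule total) (use C in \<open>auto simp: A_def B_def\<close>)
    ultimately have cut0: "cut E ends C = 0" using sumA by linarith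
    define X where "X = V - C"
    have cX: "card X + card C = card V" unfolding X_def by (rule card_Diff_add[OF finV CV(1)])
    have X: "X \<subseteq> V" "odd (card X)" "y \<in> X" "2 * card X < card V"
      using CV y cX ev by (auto simp: X_def) presburger+
    have cutX: "cut E ends X = 0" unfolding X_def using cut_compl[OF mg CV(1)] cut0 by simp
    have D: "(\<Sum>v\<in>X. ?d v) = int (card X) - 1 + ?d y"
    proof -
      have finX: "finite X" using X(1) finV finite_subset by auto
      have "(\<Sum>v\<in>X - {y}. ?d v) = (\<Sum>v\<in>X - {y}. 1)" by (rule sum.cong) (use one X in auto)
      also have "\<dots> = int (card X) - 1" using card.remove[OF finX X(3)] by simp
      finally show ?thesis using sum.remove[OF finX X(3), of ?d] by simp
    qed
    have g: "gap (Suc r) E ends X = int (card X) - 1 + ?d y" using gap_eq[OF mg X(1), of "Suc r"] D cutX by simp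
    \<comment> \<open>This turns \<open>g\<close> into a gap of at most
      \<open>Suc r + card X - 1\<close> with \<open>2 * card X < card V\<close>, the case that
      determines the threshold \<open>card V div 2 - 1\<close>.\<close>
    have dy: "?d y \<le> int (Suc r)" by (simp add: dfc_def)
    have "splittable V E ends (Suc r) 1"
    proof (rule odd_subset_cases[OF finV ev X(1,2)])
      fix v assume "v \<in> V" "X = {v}"
      then show ?thesis using cutX cut_singleton[OF mg, of v] X(3) y0 by auto
    next
      fix v assume "v \<in> V" "X = V - {v}"
      then have "card X + 1 = card V" using finV by (metis Suc_eq_plus1 card_Suc_Diff1)
      then show ?thesis using X(4) c6 by linarith
    next
      assume c: "3 \<le> card X" "card X + 3 \<le> card V"
      have "card X \<le> card V div 2" "int (Suc r) = int r + 1" using X(4) by simp_all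
      then show ?thesis
        by (intro split[OF X(1,2) c]) (use cutX g dy c r1 in linarith)+
    qed
    then show False using ns by simp
  qed
qed

text \<open>The bound \<open>n\<close> on the total deficiency is inherited by contracted graphs, and a vertex of
deficiency \<open>d\<close> can only occur as long as \<open>card V \<le> n - d + 1\<close>.\<close>

lemma order_step_state:
  fixes V :: "nat set" and E :: "nat set"
  assumes base: "order_bound a k" and a: "even a" "4 \<le> a" and n: "2 * n \<le> 3 * a + 4" "n \<le> a + b"
    and iso: "\<And>(V :: nat set) (E :: nat set) ends r. fits V E ends r \<Longrightarrow> (\<And>v. v \<in> V \<Longrightarrow> 1 \<le> dfc r E ends v) \<Longrightarrow>
      r + 1 \<le> b \<Longrightarrow> colourable E ends (r + k)"
    and fit: "fits V E ends r" and pos: "\<And>v. v \<in> V \<Longrightarrow> 1 \<le> dfc r E ends v"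
    and tot: "(\<Sum>v\<in>V. dfc r E ends v) \<le> int n"
  shows "colourable E ends (r + k)"
  using fit pos tot
proof (induction r V E ends rule: graph_induct)
  case (step r V E ends)
  note fit = step.prems(1) and pos = step.prems(2) and tot = step.prems(3)
  note mg = fitsD(1)[OF fit] and ev = fitsD(2)[OF fit] and finV = fitsD(3)[OF fit]
  let ?d = "dfc r E ends"
  show ?case
  proof (cases "card V \<le> a")
    case True then show ?thesis using base fit unfolding order_bound_def by blast
  next
    case False
    then have cV: "a + 2 \<le> card V" using ev a(1) by presburger
    then have c6: "6 \<le> card V" using a by linarith
    obtain h where h: "card V = 2 * h" using ev by blast
    \<comment> \<open>As \<open>?d u\<close> is at most \<open>n - card V + 1\<close>, the right
      side is at least \<open>2 * card V - 2 - n\<close>. For \<open>card V >= a + 2\<close> the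
      inequality then amounts to \<open>2 * n <= 3 * a + 4\<close>.\<close>
    have H: "int (card V div 2) - 1 \<le> (\<Sum>v\<in>V. ?d v) - 2 * ?d u" if "u \<in> V" for u
    proof -
      have "int (card V) - 1 + ?d u \<le> (\<Sum>v\<in>V. ?d v)" by (rule sum_remove_ge[OF finV that]) (rule pos)
      then show ?thesis using tot cV n(1) h by auto
    qed
    have split: "splittable V E ends r 1"
      if "X \<subseteq> V" "odd (card X)" "3 \<le> card X" "card X + 3 \<le> card V" "int (cut E ends X) \<le> int r - 1"
        "gap r E ends X - int r \<le> 2 * int (card X) - 2" "gap r E ends X - int r \<le> int (card V div 2) - 1" for X
      by (rule splittableI[OF fit pos H that])
    show ?thesis
    proof (cases "splittable V E ends r 1")
      case True
      show ?thesis
      proof (rule splittable_colourable[OF fit _ True])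
        fix Y w assume Y: "Y \<subseteq> V" "w \<in> Y" "odd (card Y)" "int (cut E ends Y) \<le> int r - 1"
          "card (insert w (V - Y)) < card V"
          "fits (insert w (V - Y)) (contract_edges Y ends E) (contract_ends Y w ends) r"
        show "colourable (contract_edges Y ends E) (contract_ends Y w ends) (r + k)"
        proof (rule step.IH(2)[OF Y(5,6)])
          show "1 \<le> dfc r (contract_edges Y ends E) (contract_ends Y w ends) v" if "v \<in> insert w (V - Y)" for v
            using that dfc_contract(1)[OF Y(2), of v r ends E] dfc_contract(2)[OF Y(2), of r ends E] Y(4) pos[of v]
            by (cases "v = w") auto
          show "(\<Sum>v\<in>insert w (V - Y). dfc r (contract_edges Y ends E) (contract_ends Y w ends) v) \<le> int n"
            using sum_dfc_contract[OF fit Y(1,2,3)] tot by linarith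
        qed
      qed simp
    next
      case ns: False
      show ?thesis
      proof (cases "\<exists>y\<in>V. \<exists>z\<in>V. y \<noteq> z \<and> 2 \<le> ?d y \<and> 2 \<le> ?d z")
        case True
        then obtain y z where yz: "y \<in> V" "z \<in> V" "y \<noteq> z" "2 \<le> ?d y" "2 \<le> ?d z" by blast
        show ?thesis
        proof (rule fill_step[OF fit yz(1-3)])
          show "1 \<le> ?d y" "1 \<le> ?d z" using yz by auto
          show "gap r E ends X \<noteq> int r" if X: "X \<subseteq> V" "odd (card X)" "y \<in> X" "z \<in> X" for X
          proof
            assume tight: "gap r E ends X = int r"
            have finX: "finite X" using X(1) finV finite_subset by auto
            have "int (card X) - 1 + ?d y \<le> (\<Sum>v\<in>X. ?d v)"
              by (rule sum_remove_ge[OF finX X(3)]) (use pos X in auto)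
            then have cut: "int (cut E ends X) \<le> int r - 1"
              using cut_eq_gap[OF mg X(1), of r] tight yz by linarith
            have "splittable V E ends r 1"
            proof (rule odd_subset_cases[OF finV ev X(1,2)])
              fix v assume "v \<in> V" "X = {v}"
              then show ?thesis using X yz by auto
            next
              fix v assume v: "v \<in> V" "X = V - {v}"
              then show ?thesis using gap_minus_vertex[OF mg v(1), of r] tight H[OF v(1)] c6 by auto
            next
              assume c: "3 \<le> card X" "card X + 3 \<le> card V"
              then show ?thesis by (rule split[OF X(1,2)]) (use cut tight c6 c in auto)
            qed
            then show False using ns by simp
          qed
          fix E' :: "nat set" and ends'
          assume st: "fits V E' ends' r" "\<And>v. dfc r E' ends' v = ?d v - (if v = y \<or> v = z then 1 else 0)"
            "nat (\<Sum>v\<in>V. dfc r E' ends' v) < nat (\<Sum>v\<in>V. ?d v)"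
          show "colourable E' ends' (r + k)"
          proof (rule step.IH(3)[OF st(3,1)])
            show "1 \<le> dfc r E' ends' v" if "v \<in> V" for v using st(2) pos[OF that] yz by auto
            show "(\<Sum>v\<in>V. dfc r E' ends' v) \<le> int n" using st(3) tot by linarith
          qed
        qed
      next
        case no2: False
        have "\<exists>y\<in>V. \<forall>v\<in>V. v \<noteq> y \<longrightarrow> ?d v = 1"
        proof (cases "\<exists>y\<in>V. 2 \<le> ?d y")
          case True
          then obtain y where "y \<in> V" "2 \<le> ?d y" by blast
          then show ?thesis using no2 pos by (intro bexI[of _ y]) force
        next
          case False
          have "V \<noteq> {}" using c6 by auto
          then obtain y where "y \<in> V" by blast
          then show ?thesis using False pos by (intro bexI[of _ y]) force
        qed
        then obtain y where y: "y \<in> V" "\<And>v. v \<in> V \<Longrightarrow> v \<noteq> y \<Longrightarrow> ?d v = 1" by blast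
        have "r \<noteq> 0" using pos[OF y(1)] by (auto simp: dfc_def)
        then obtain q where q: "r = Suc q" by (cases r) auto
        show ?thesis
        proof (cases "\<exists>M\<subseteq>E. \<forall>v\<in>V. degree M ends v = 1")
          case False
          have "degree E ends y = 0"
            by (rule perfect_matching_or_isolated[OF _ y(1) c6])
              (use fit y pos H ns False q in auto)
          \<comment> \<open>The at least \<open>a + 1\<close> other vertices have deficiency at
            least 1 each, which leaves at most \<open>n - a - 1\<close> for the deficiency
            \<open>r\<close> of \<open>y\<close>; hence the hypothesis
            \<open>n <= a + b\<close>.\<close>
          then have "?d y = int r" by (simp add: dfc_def)
          moreover have "int (card V) - 1 + ?d y \<le> (\<Sum>v\<in>V. ?d v)" by (rule sum_remove_ge[OF finV y(1)]) (rule pos)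
          ultimately have "r + 1 \<le> b" using tot cV n(2) by linarith
          then show ?thesis using iso[OF fit pos] by blast
        next
          case True
          then obtain M where M: "M \<subseteq> E" "\<And>v. v \<in> V \<Longrightarrow> degree M ends v = 1" by blast
          have mgM: "multigraph V M ends" using mg M(1) finite_subset by (auto simp: multigraph_def)
          have gp: "\<forall>X\<subseteq>V. odd (card X) \<longrightarrow> int q + int (card X) \<le> gap (Suc q) E ends X + 2 * int (induced_edges M ends X)"
          proof (intro allI impI, rule ccontr)
            fix X assume X: "X \<subseteq> V" "odd (card X)"
            assume "\<not> int q + int (card X) \<le> gap (Suc q) E ends X + 2 * int (induced_edges M ends X)"
            moreover have M_sum: "card Y = 2 * induced_edges M ends Y + cut M ends Y" if Y: "Y \<subseteq> V" for Y
            proof -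
              have "finite Y" using Y finV finite_subset by auto
              then have "(\<Sum>v\<in>Y. degree M ends v) = 2 * induced_edges M ends Y + cut M ends Y"
                using multigraphD(2,4)[OF mgM] by (intro degree_sum)
              moreover have "(\<Sum>v\<in>Y. degree M ends v) = card Y" using M(2) Y by (simp add: subset_iff)
              ultimately show ?thesis by simp
            qed
            \<comment> \<open>\<open>M\<close> is perfect, so \<open>card X\<close> minus twice its
              edges inside \<open>X\<close> counts its edges leaving \<open>X\<close>, at most half
              the order. Thus a violated condition comes with a gap small enough for a
              split.\<close>
            ultimately have viol: "gap r E ends X + 2 \<le> int r + int (cut M ends X)"
              using M_sum[OF X(1)] q by auto
            have cm: "cut M ends X \<le> card X" using M_sum[OF X(1)] by simp
            have cm': "cut M ends X \<le> card (V - X)" using M_sum[of "V - X"] cut_compl[OF mgM X(1)] by simp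
            have finX: "finite X" using X(1) finV finite_subset by auto
            have "splittable V E ends r 1"
            proof (rule odd_subset_cases[OF finV ev X])
              fix v assume "v \<in> V" "X = {v}"
              then show ?thesis using viol cm gap_singleton[OF mg, of r v] by simp
            next
              fix v assume v: "v \<in> V" "X = V - {v}"
              then have "V - X = {v}" by auto
              then show ?thesis
                using gap_minus_vertex[OF mg v(1), of r] v viol cm' H[OF v(1)] c6 by auto
            next
              assume c: "3 \<le> card X" "card X + 3 \<le> card V"
              have "(\<Sum>v\<in>X. 1) \<le> (\<Sum>v\<in>X. ?d v)" by (rule sum_mono) (use pos X in auto)
              then have cut: "int (cut E ends X) \<le> int r - 1"
                using cut_eq_gap[OF mg X(1), of r] viol cm by simp
              have "card (V - X) + card X = card V" by (rule card_Diff_add[OF finV X(1)])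
              then have "cut M ends X \<le> card V div 2" using cm cm' by linarith
              then show ?thesis
                by (intro split[OF X c cut]) (use viol cm in linarith)+
            qed
            then show False using ns by simp
          qed
          have fitq: "fits V E ends (Suc q)" using fit q by simp
          have "\<forall>v\<in>V. degree M ends v \<le> 1" "\<forall>v\<in>V. 2 \<le> dfc (Suc q) E ends v + int (degree M ends v) + 1"
            using M(2) pos q by fastforce+
          note rm = remove_matching[OF fitq M(1) this gp]
          have dM: "dfc q (E - M) ends v = ?d v" if "v \<in> V" for v using rm(2) M(2)[OF that] q by simp
          have "colourable (E - M) ends (q + k)"
          proof (rule step.IH(1))
            show "q < r" using q by simp
            show "fits V (E - M) ends q" by (rule rm(1))
            show "1 \<le> dfc q (E - M) ends v" if "v \<in> V" for v using dM pos that by simp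
            show "(\<Sum>v\<in>V. dfc q (E - M) ends v) \<le> int n" using tot dM by simp
          qed
          then show ?thesis using rm(3) q by simp
        qed
      qed
    qed
  qed
qed

lemma dfc_Suc: "dfc (Suc r) E ends v = dfc r E ends v + 1"
  by (simp add: dfc_def)

lemma fits_Suc:
  assumes "fits V E ends r"
  shows "fits V E ends (Suc r)"
  unfolding fits_def
proof (intro conjI ballI allI impI)
  show "multigraph V E ends" "even (card V)" using fitsD(1,2)[OF assms] .
  show "degree E ends v \<le> Suc r" if "v \<in> V" for v using fitsD(5)[OF assms that] by simp
  fix X assume X: "X \<subseteq> V" "odd (card X)"
  have "1 \<le> card X" using X(2) by (cases "card X") auto
  moreover have "gap (Suc r) E ends X = gap r E ends X + int (card X)" by (simp add: gap_def algebra_simps)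
  ultimately show "int (Suc r) \<le> gap (Suc r) E ends X" using fitsD(6)[OF assms X] by simp
qed

text \<open>In a graph filled up to be regular for \<open>r\<close>, all deficiencies for
  \<open>Suc r\<close> are 1, so the total deficiency is the order.\<close>

lemma order_step:
  assumes base: "order_bound a k" and a: "even a" "4 \<le> a" and n: "2 * n \<le> 3 * a + 4" "n \<le> a + b"
    and iso: "\<And>(V :: nat set) (E :: nat set) ends r. fits V E ends r \<Longrightarrow> (\<And>v. v \<in> V \<Longrightarrow> 1 \<le> dfc r E ends v) \<Longrightarrow>
      r + 1 \<le> b \<Longrightarrow> colourable E ends (r + k)"
  shows "order_bound n (Suc k)"
  unfolding order_bound_def
proof (intro allI impI)
  fix V E :: "nat set" and ends r
  assume fit: "fits V E ends r" and cV: "card V \<le> n"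
  show "colourable E ends (r + Suc k)"
  proof (rule fill_regular[OF _ fit cV])
    fix V E :: "nat set" and ends
    assume fit: "fits V E ends r" and cV: "card V \<le> n" and reg: "\<And>v. v \<in> V \<Longrightarrow> dfc r E ends v = 0"
    have d: "dfc (Suc r) E ends v = dfc r E ends v + 1" for v by (rule dfc_Suc)
    have "colourable E ends (Suc r + k)"
      by (rule order_step_state[OF base a n iso fits_Suc[OF fit]]) (use cV reg d in auto)
    then show "colourable E ends (r + Suc k)" by simp
  qed
qed

section \<open>The bound in terms of the number of colours\<close>

text \<open>Every removed matching covers all vertices of deficiency one and misses at most two others,
hence the bound on the number of vertices of deficiency one.\<close>

lemma slack_step_state:
  fixes V :: "nat set" and E :: "nat set"
  assumes base: "order_bound a (Suc k)" and rec: "slack_bound b' k" and a: "even a" "4 \<le> a"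
    and b: "b + 3 \<le> 2 * b'" "2 * b \<le> a + 2 + b'" "3 \<le> b'"
    and fit: "fits V E ends r" and pos: "\<And>v. v \<in> V \<Longrightarrow> 1 \<le> dfc r E ends v" and rb: "r \<le> b"
    and ones: "card {v\<in>V. dfc r E ends v = 1} \<le> 2 * (b - r)"
  shows "colourable E ends (r + Suc k)"
  using fit pos rb ones
proof (induction r V E ends rule: graph_induct)
  case (step r V E ends)
  note fit = step.prems(1) and pos = step.prems(2) and rb = step.prems(3) and ones = step.prems(4)
  note mg = fitsD(1)[OF fit] and ev = fitsD(2)[OF fit] and finV = fitsD(3)[OF fit]
  let ?d = "dfc r E ends"
  consider "r < b'" | "card V \<le> a" | "b' \<le> r" "a < card V" by linarith
  then show ?case
  proof cases
    case 1
    \<comment> \<open>Spending the additional colour on \<open>r\<close> brings all deficiencies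
      back to at least 2.\<close>
    have "colourable E ends (Suc r + k)"
      using rec fits_Suc[OF fit] 1 pos unfolding slack_bound_def by (force simp: dfc_Suc)
    then show ?thesis by simp
  next
    case 2 then show ?thesis using base fit unfolding order_bound_def by blast
  next
    case 3
    then have cV: "a + 2 \<le> card V" using ev a(1) by presburger
    have br: "2 * b \<le> card V + r" using cV b(2) 3(1) by linarith
    define N where "N = {v\<in>V. ?d v = 1}"
    have finN: "finite N" using finV by (simp add: N_def)
    have two: "(if v \<in> N then 1 else 2) \<le> ?d v" if "v \<in> V" for v using pos[OF that] that by (auto simp: N_def)
    \<comment> \<open>At most \<open>2 * (b - r)\<close> vertices have deficiency 1 and
      \<open>?d u\<close> is at most \<open>r\<close>, so the right side is at least
      \<open>2 * card V - 2 - 2 * b + r\<close>; \<open>br\<close> compares this with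
      \<open>card V - 2\<close>.\<close>
    have H: "int (card V) - 2 \<le> (\<Sum>v\<in>V. ?d v) - 2 * ?d u" if u: "u \<in> V" for u
    proof -
      have "2 * (int (card V) - 1) - int (card ((V - {u}) \<inter> N)) = (\<Sum>v\<in>V - {u}. 2 - (if v \<in> N then 1 else 0))"
        using card.remove[OF finV u] finV by (simp add: sum_subtractf sum.If_cases Int_def)
      also have "\<dots> \<le> (\<Sum>v\<in>V - {u}. ?d v)"
      proof (rule sum_mono)
        fix v assume "v \<in> V - {u}"
        then show "2 - (if v \<in> N then 1 else 0) \<le> ?d v" using two[of v] by (auto split: if_splits)
      qed
      finally have "2 * (int (card V) - 1) - int (card ((V - {u}) \<inter> N)) \<le> (\<Sum>v\<in>V - {u}. ?d v)" .
      moreover have "card ((V - {u}) \<inter> N) \<le> card N" using finN by (intro card_mono) auto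
      then have "int (card ((V - {u}) \<inter> N)) \<le> int (card N)" by simp
      moreover have "int (card N) \<le> 2 * (int b - int r)" using ones rb by (simp add: N_def of_nat_diff)
      moreover have "?d u \<le> int r" by (simp add: dfc_def)
      moreover have "2 * int b \<le> int (card V) + int r" using br by simp
      moreover have "(\<Sum>v\<in>V. ?d v) = ?d u + (\<Sum>v\<in>V - {u}. ?d v)" by (rule sum.remove[OF finV u])
      ultimately show ?thesis by (smt (verit))
    qed
    have split: "splittable V E ends r 2"
      if "X \<subseteq> V" "odd (card X)" "3 \<le> card X" "card X + 3 \<le> card V" "int (cut E ends X) \<le> int r - 2"
        "gap r E ends X - int r \<le> 2 * int (card X) - 2" "gap r E ends X - int r \<le> int (card V) - 2" for X
      by (rule splittableI[OF fit pos H that])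
    have Dge: "int (card X) \<le> (\<Sum>v\<in>X. ?d v)" if "X \<subseteq> V" for X
    proof -
      have "(\<Sum>v\<in>X. 1) \<le> (\<Sum>v\<in>X. ?d v)" by (rule sum_mono) (use pos that in auto)
      then show ?thesis by simp
    qed
    show ?thesis
    proof (cases "splittable V E ends r 2")
      case True
      show ?thesis
      proof (rule splittable_colourable[OF fit _ True])
        fix Y w assume Y: "Y \<subseteq> V" "w \<in> Y" "odd (card Y)" "int (cut E ends Y) \<le> int r - 2"
          "card (insert w (V - Y)) < card V"
          "fits (insert w (V - Y)) (contract_edges Y ends E) (contract_ends Y w ends) r"
        let ?d' = "dfc r (contract_edges Y ends E) (contract_ends Y w ends)"
        have d': "?d' v = (if v = w then int r - int (cut E ends Y) else ?d v)" if "v \<in> insert w (V - Y)" for v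
          using that dfc_contract(1)[OF Y(2), of v r ends E] dfc_contract(2)[OF Y(2), of r ends E] Y(2) by auto
        show "colourable (contract_edges Y ends E) (contract_ends Y w ends) (r + Suc k)"
        proof (rule step.IH(2)[OF Y(5,6)])
          show "1 \<le> ?d' v" if "v \<in> insert w (V - Y)" for v
            using that d'[OF that] Y(4) pos[of v] by (cases "v = w") auto
          \<comment> \<open>The contracted vertex has deficiency at least 2, so no new vertex of
            deficiency 1 arises; this is why splits are taken at level 2.\<close>
          have "{v \<in> insert w (V - Y). ?d' v = 1} \<subseteq> {v\<in>V. ?d v = 1}"
            using d' Y(4) by (auto split: if_splits)
          then have "card {v \<in> insert w (V - Y). ?d' v = 1} \<le> card {v\<in>V. ?d v = 1}"
            using finV by (intro card_mono) auto
          then show "card {v \<in> insert w (V - Y). ?d' v = 1} \<le> 2 * (b - r)" using ones by linarith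
        qed (rule rb)
      qed simp
    next
      case ns: False
      show ?thesis
      \<comment> \<open>The threshold 3 guarantees that the new edge produces no vertex of
        deficiency 1.\<close>
      proof (cases "\<exists>y\<in>V. \<exists>z\<in>V. y \<noteq> z \<and> 3 \<le> ?d y \<and> 3 \<le> ?d z")
        case True
        then obtain y z where yz: "y \<in> V" "z \<in> V" "y \<noteq> z" "3 \<le> ?d y" "3 \<le> ?d z" by blast
        show ?thesis
        proof (rule fill_step[OF fit yz(1-3)])
          show "1 \<le> ?d y" "1 \<le> ?d z" using yz by auto
          show "gap r E ends X \<noteq> int r" if X: "X \<subseteq> V" "odd (card X)" "y \<in> X" "z \<in> X" for X
          proof
            assume tight: "gap r E ends X = int r"
            have "splittable V E ends r 2"
            proof (rule odd_subset_cases[OF finV ev X(1,2)])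
              fix v assume "v \<in> V" "X = {v}"
              then show ?thesis using X yz by auto
            next
              fix v assume v: "v \<in> V" "X = V - {v}"
              then show ?thesis using gap_minus_vertex[OF mg v(1), of r] tight H[OF v(1)] cV a by auto
            next
              assume c: "3 \<le> card X" "card X + 3 \<le> card V"
              then show ?thesis
                by (intro split[OF X(1,2)]) (use tight cV a Dge[OF X(1)] cut_eq_gap[OF mg X(1), of r] in auto)
            qed
            then show False using ns by simp
          qed
          fix E' :: "nat set" and ends'
          assume st: "fits V E' ends' r" "\<And>v. dfc r E' ends' v = ?d v - (if v = y \<or> v = z then 1 else 0)"
            "nat (\<Sum>v\<in>V. dfc r E' ends' v) < nat (\<Sum>v\<in>V. ?d v)"
          show "colourable E' ends' (r + Suc k)"
          proof (rule step.IH(3)[OF st(3,1)])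
            show "1 \<le> dfc r E' ends' v" if "v \<in> V" for v using st(2) pos[OF that] yz by auto
            have "{v\<in>V. dfc r E' ends' v = 1} = {v\<in>V. ?d v = 1}" using st(2) yz by auto
            then show "card {v\<in>V. dfc r E' ends' v = 1} \<le> 2 * (b - r)" using ones by simp
          qed (rule rb)
        qed
      next
        case no2: False
        have "\<exists>y\<in>V. \<forall>v\<in>V. v \<noteq> y \<longrightarrow> ?d v \<le> 2"
        proof (cases "\<exists>y\<in>V. 3 \<le> ?d y")
          case True
          then obtain y where "y \<in> V" "3 \<le> ?d y" by blast
          then show ?thesis using no2 by (intro bexI[of _ y]) force
        next
          case False
          have "V \<noteq> {}" using cV by auto
          then obtain y where "y \<in> V" by blast
          then show ?thesis using False by (intro bexI[of _ y]) force
        qed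
        then obtain y where y: "y \<in> V" "\<And>v. v \<in> V \<Longrightarrow> v \<noteq> y \<Longrightarrow> ?d v \<le> 2" by blast
        obtain q where q: "r = Suc q" using 3 b(3) by (cases r) auto
        define U where "U = {v\<in>V. 2 \<le> ?d v}"
        have UN: "V - U = N" using pos by (force simp: U_def N_def)
        have degle: "degree E ends v \<le> q" if "v \<in> V" for v using pos[OF that] q by (simp add: dfc_def)
        show ?thesis
        proof (cases "\<exists>M\<subseteq>E. (\<forall>v\<in>V. degree M ends v \<le> 1) \<and> (\<forall>v\<in>V - U. degree M ends v = 1) \<and>
            card {v\<in>V. degree M ends v = 0} \<le> 2")
          case True
          then obtain M where M: "M \<subseteq> E" "\<forall>v\<in>V. degree M ends v \<le> 1" "\<forall>v\<in>V - U. degree M ends v = 1"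
            "card {v\<in>V. degree M ends v = 0} \<le> 2" by blast
          have gp: "\<forall>X\<subseteq>V. odd (card X) \<longrightarrow> int q + int (card X) \<le> gap (Suc q) E ends X + 2 * int (induced_edges M ends X)"
          proof (intro allI impI, rule ccontr)
            fix X assume X: "X \<subseteq> V" "odd (card X)"
            assume "\<not> int q + int (card X) \<le> gap (Suc q) E ends X + 2 * int (induced_edges M ends X)"
            \<comment> \<open>Even after discarding the edges of \<open>M\<close> inside
              \<open>X\<close>, a violating set would give a split, so any matching passes the gap
              condition here.\<close>
            then have viol: "gap r E ends X + 2 \<le> int r + int (card X)" using q by simp
            have "splittable V E ends r 2"
            proof (rule odd_subset_cases[OF finV ev X])
              fix v assume "v \<in> V" "X = {v}"
              then show ?thesis using viol gap_singleton[OF mg, of r v] by simp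
            next
              fix v assume v: "v \<in> V" "X = V - {v}"
              then have "card X + 1 = card V" using finV by (metis Suc_eq_plus1 card_Suc_Diff1)
              then show ?thesis using gap_minus_vertex[OF mg v(1), of r] v viol H[OF v(1)] by auto
            next
              assume c: "3 \<le> card X" "card X + 3 \<le> card V"
              then show ?thesis
                by (intro split[OF X]) (use viol Dge[OF X(1)] cut_eq_gap[OF mg X(1), of r] in linarith)+
            qed
            then show False using ns by simp
          qed
          have fitq: "fits V E ends (Suc q)" using fit q by simp
          have dpos: "2 \<le> dfc (Suc q) E ends v + int (degree M ends v)" if "v \<in> V" for v
            using M(3) pos[OF that] that q by (cases "v \<in> U") (auto simp: U_def)
          then have "\<forall>v\<in>V. 2 \<le> dfc (Suc q) E ends v + int (degree M ends v) + 1" by fastforce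
          note rm = remove_matching[OF fitq M(1,2) this gp]
          have "colourable (E - M) ends (q + Suc k)"
          proof (rule step.IH(1))
            show "q < r" using q by simp
            show "fits V (E - M) ends q" by (rule rm(1))
            show "1 \<le> dfc q (E - M) ends v" if "v \<in> V" for v using rm(2)[of v] dpos[OF that] by simp
            show "q \<le> b" using rb q by simp
            \<comment> \<open>A new vertex of deficiency 1 is one missed by \<open>M\<close>. There
              are at most two, just what \<open>2 * (b - r)\<close> gains when \<open>r\<close>
              drops by one.\<close>
            have "{v\<in>V. dfc q (E - M) ends v = 1} \<subseteq> {v\<in>V. ?d v = 1} \<union> {v\<in>V. degree M ends v = 0}"
            proof
              fix v assume "v \<in> {v\<in>V. dfc q (E - M) ends v = 1}"
              then have v: "v \<in> V" "?d v + int (degree M ends v) = 2" using rm(2)[of v] q by auto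
              have "degree M ends v \<le> 1" using M(2) v(1) by blast
              then have "degree M ends v = 0 \<or> degree M ends v = 1" by linarith
              then show "v \<in> {v\<in>V. ?d v = 1} \<union> {v\<in>V. degree M ends v = 0}" using v by auto
            qed
            then have "card {v\<in>V. dfc q (E - M) ends v = 1} \<le> card ({v\<in>V. ?d v = 1} \<union> {v\<in>V. degree M ends v = 0})"
              using finV by (intro card_mono) auto
            also have "\<dots> \<le> card {v\<in>V. ?d v = 1} + card {v\<in>V. degree M ends v = 0}" by (rule card_Un_le)
            finally show "card {v\<in>V. dfc q (E - M) ends v = 1} \<le> 2 * (b - q)" using ones M(4) rb q by linarith
          qed
          then show ?thesis using rm(3)[of "q + Suc k"] q by simp
        next
          case False
          obtain T P where bar: "barrier V E ends T P"
            and TP: "card T + 1 \<le> card P \<and> (\<forall>C\<in>P. C \<inter> U = {}) \<or> card T + 4 \<le> card P"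
            using near_perfect_matching_or_barrier[OF mg ev _ False] by (auto simp: U_def)
          have P: "finite P" "disjoint P" "\<And>C. C \<in> P \<Longrightarrow> C \<subseteq> V" "\<And>C. C \<in> P \<Longrightarrow> odd (card C)" "T \<subseteq> V"
            using bar unfolding barrier_def by blast+
          have finT: "finite T" using P(5) finV finite_subset by auto
          from TP show ?thesis
          proof
            assume TP: "card T + 1 \<le> card P \<and> (\<forall>C\<in>P. C \<inter> U = {})"
            \<comment> \<open>The blocks lie in \<open>N\<close> and outnumber \<open>T\<close>,
              whose vertices have degree at most \<open>q\<close>; so some cut is below
              \<open>q\<close>. With all deficiencies in the block equal to 1, its gap is its order
              plus this cut.\<close>
            have "(\<Sum>C\<in>P. cut E ends C) \<le> (\<Sum>t\<in>T. degree E ends t)" by (rule barrier_sum_cut[OF mg bar order_refl])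
            also have "\<dots> \<le> q * card T" using sum_bounded_above[of T "degree E ends" q] degle P(5) by (auto simp: mult.commute)
            also have "\<dots> < q * card P" using TP 3 q b(3) by simp
            finally have "\<exists>C\<in>P. cut E ends C < q"
              using sum_bounded_below[of P q "cut E ends"] by (force simp: mult.commute)
            then obtain C where C: "C \<in> P" "cut E ends C < q" by blast
            have CV: "C \<subseteq> V" "odd (card C)" "C \<subseteq> N" using P C TP UN by auto
            have "(\<Sum>v\<in>C. ?d v) = (\<Sum>v\<in>C. 1)" by (rule sum.cong) (use CV(3) in \<open>auto simp: N_def\<close>)
            then have g: "gap r E ends C = int (card C) + int (cut E ends C)" using gap_eq[OF mg CV(1), of r] by simp
            have "card C \<le> card N" using finN CV(3) by (rule card_mono)
            then have cN: "card C \<le> 2 * (b - r)" using ones unfolding N_def by linarith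
            have "splittable V E ends r 2"
            proof (rule odd_subset_cases[OF finV ev CV(1,2)])
              fix v assume "v \<in> V" "C = {v}"
              then show ?thesis using g gap_singleton[OF mg, of r v] C(2) q by simp
            next
              fix v assume "v \<in> V" "C = V - {v}"
              then have "card C + 1 = card V" using finV by (metis Suc_eq_plus1 card_Suc_Diff1)
              \<comment> \<open>A subset of \<open>N\<close> is too small to be
                \<open>V - {v}\<close>: that would need \<open>2 * b - r <= 2 * (b - r) + 1\<close>,
                hence \<open>r <= 1\<close>.\<close>
              then show ?thesis using cN br rb 3(1) b(3) by linarith
            next
              assume c: "3 \<le> card C" "card C + 3 \<le> card V"
              then show ?thesis
                by (intro split[OF CV(1,2)]) (use g C(2) q in linarith)+
            qed
            then show ?thesis using ns by simp
          next
            assume TP: "card T + 4 \<le> card P"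
            define A where "A = {C\<in>P. y \<notin> C \<and> 2 * card C \<le> card V}"
            \<comment> \<open>Two blocks are given up, one through \<open>y\<close> and one with
              more than half of the vertices; an excess of 4 leaves 2.\<close>
            have cA: "card T + 2 \<le> card A"
              using card_outside_le[OF P(1-3) finV, of y] TP unfolding A_def by linarith
            have big: "q - 1 \<le> cut E ends C" if C: "C \<in> A" for C
            proof (rule ccontr)
              assume small: "\<not> q - 1 \<le> cut E ends C"
              have CV: "C \<subseteq> V" "odd (card C)" "y \<notin> C" "2 * card C \<le> card V" using C P by (auto simp: A_def)
              have "(\<Sum>v\<in>C. ?d v) \<le> (\<Sum>v\<in>C. 2)" by (rule sum_mono) (use y(2) CV in auto)
              then have g: "gap r E ends C \<le> 2 * int (card C) + int (cut E ends C)" using gap_eq[OF mg CV(1), of r] by simp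
              have "splittable V E ends r 2"
              proof (rule odd_subset_cases[OF finV ev CV(1,2)])
                fix v assume "v \<in> V" "C = {v}"
                then show ?thesis using g gap_singleton[OF mg, of r v] small q by simp
              next
                fix v assume "v \<in> V" "C = V - {v}"
                then have "card C + 1 = card V" using finV by (metis Suc_eq_plus1 card_Suc_Diff1)
                then show ?thesis using CV(4) cV a by linarith
              next
                assume c: "3 \<le> card C" "card C + 3 \<le> card V"
                then show ?thesis
                  by (intro split[OF CV(1,2)]) (use g small CV(4) q in linarith)+
              qed
              then show False using ns by simp
            qed
            \<comment> \<open>Vertices of \<open>T\<close> have degree at most \<open>q - 1\<close>,
              or \<open>q\<close> if they lie in \<open>N\<close>. The two surplus blocks therefore
              require \<open>2 * (q - 1)\<close> vertices in \<open>N\<close>, while there are at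
              most \<open>2 * (b - r)\<close>. This would give \<open>2 * r <= b + 2\<close>,
              against \<open>b + 3 <= 2 * b'\<close> and \<open>b' <= r\<close>.\<close>
            have "(q - 1) * (card T + 2) \<le> (q - 1) * card A" using cA by (rule mult_le_mono2)
            also have "\<dots> \<le> (\<Sum>C\<in>A. cut E ends C)"
              using sum_bounded_below[of A "q - 1" "cut E ends"] big by (auto simp: mult.commute)
            also have "\<dots> \<le> (\<Sum>t\<in>T. degree E ends t)" by (rule barrier_sum_cut[OF mg bar]) (auto simp: A_def)
            also have "\<dots> \<le> (\<Sum>t\<in>T. (q - 1) + (if t \<in> N then 1 else 0))"
            proof (rule sum_mono)
              fix t assume "t \<in> T"
              then have "t \<in> V" using P(5) by auto
              then show "degree E ends t \<le> (q - 1) + (if t \<in> N then 1 else 0)"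
                using two[of t] q by (auto simp: dfc_def split: if_splits)
            qed
            also have "\<dots> = (q - 1) * card T + card (T \<inter> N)"
              using finT by (simp add: sum.distrib sum.If_cases Int_def)
            also have "card (T \<inter> N) \<le> card N" using finN by (intro card_mono) auto
            finally have "(q - 1) * 2 \<le> card N" by (simp add: distrib_left)
            then have "(q - 1) * 2 \<le> 2 * (b - r)" using ones unfolding N_def by linarith
            then have False using q rb b(1) 3(1) by linarith
            then show ?thesis ..
          qed
        qed
      qed
    qed
  qed
qed

lemma slack_step:
  assumes "order_bound a (Suc k)" "slack_bound b' k" "even a" "4 \<le> a"
    and "b + 3 \<le> 2 * b'" "2 * b \<le> a + 2 + b'" "3 \<le> b'"
  shows "slack_bound b (Suc k)"
  unfolding slack_bound_def
proof (intro allI impI)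
  fix V E :: "nat set" and ends r
  assume fit: "fits V E ends r" and d: "\<forall>v\<in>V. 2 \<le> dfc r E ends v" and rb: "r \<le> b"
  have "{v\<in>V. dfc r E ends v = 1} = {}" using d by force
  then have "card {v\<in>V. dfc r E ends v = 1} \<le> 2 * (b - r)" by (metis card.empty zero_le)
  then show "colourable E ends (r + Suc k)"
    by (intro slack_step_state[OF assms fit _ rb]) (use d in force)+
qed

text \<open>Degrees are at most \<open>r - 2\<close>, so \<open>2 * r - 5\<close> colours suffice,
  and this is at most \<open>r + k\<close> for \<open>r <= k + 5\<close>.\<close>

lemma slack_bound_greedy: "b \<le> k + 5 \<Longrightarrow> slack_bound b k"
  unfolding slack_bound_def
proof (intro allI impI)
  fix V E :: "nat set" and ends r
  assume b: "b \<le> k + 5" and fit: "fits V E ends r" and d: "\<forall>v\<in>V. 2 \<le> dfc r E ends v" and rb: "r \<le> b"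
  show "colourable E ends (r + k)"
    by (rule colourable_greedy[OF fitsD(1)[OF fit], of "r - 2"]) (use d rb b in \<open>auto simp: dfc_def\<close>)
qed

section \<open>Geometric growth of the bounds\<close>

lemma order_bound_mono: "order_bound n k \<Longrightarrow> m \<le> n \<Longrightarrow> order_bound m k"
  unfolding order_bound_def by (meson le_trans)

lemma slack_bound_mono: "slack_bound b k \<Longrightarrow> c \<le> b \<Longrightarrow> slack_bound c k"
  unfolding slack_bound_def by (meson le_trans)

text \<open>Without deficiencies the gap is the cut, so every odd block sends at least
  \<open>r\<close> edges to \<open>T\<close>, while each vertex of \<open>T\<close> absorbs at most
  \<open>r\<close>.\<close>

lemma regular_perfect_matching:
  assumes fit: "fits V E ends r" and reg: "\<And>v. v \<in> V \<Longrightarrow> dfc r E ends v = 0" and r: "0 < r"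
  shows "\<exists>M\<subseteq>E. \<forall>v\<in>V. degree M ends v = 1"
proof (rule ccontr)
  assume "\<not> ?thesis"
  then obtain T P where bar: "barrier V E ends T P" and TP: "card T + 2 \<le> card P"
    using perfect_matching_or_barrier[OF fitsD(1,2)[OF fit]] by blast
  have P: "\<And>C. C \<in> P \<Longrightarrow> C \<subseteq> V" "\<And>C. C \<in> P \<Longrightarrow> odd (card C)" "T \<subseteq> V"
    using bar unfolding barrier_def by blast+
  have "r \<le> cut E ends C" if "C \<in> P" for C
  proof -
    have "(\<Sum>v\<in>C. dfc r E ends v) = 0" by (rule sum.neutral) (use reg P(1)[OF that] in auto)
    then show ?thesis using fitsD(6)[OF fit P(1)[OF that] P(2)[OF that]] gap_eq[OF fitsD(1)[OF fit] P(1)[OF that], of r] by simp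
  qed
  then have "r * card P \<le> (\<Sum>C\<in>P. cut E ends C)"
    using sum_bounded_below[of P r "cut E ends"] by (auto simp: mult.commute)
  also have "\<dots> \<le> (\<Sum>t\<in>T. degree E ends t)" by (rule barrier_sum_cut[OF fitsD(1)[OF fit] bar order_refl])
  also have "\<dots> \<le> r * card T"
    using sum_bounded_above[of T "degree E ends" r] fitsD(5)[OF fit] P(3) by (auto simp: mult.commute)
  finally have "card P \<le> card T" using r by simp
  then show False using TP by simp
qed

text \<open>The only odd sets are single vertices and their complements, which a perfect matching
  leaves by exactly one edge. So perfect matchings can be removed until no edge is left.\<close>

lemma regular_colourable_4:
  fixes V :: "'a set" and E :: "'e set"
  assumes "fits V E ends r" "card V \<le> 4" "\<And>v. v \<in> V \<Longrightarrow> dfc r E ends v = 0"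
  shows "colourable E ends r"
  using assms
proof (induction r arbitrary: E)
  case 0
  have "E = {}"
  proof (rule ccontr)
    assume "E \<noteq> {}"
    then obtain e where e: "e \<in> E" by blast
    obtain v where v: "v \<in> ends e" using multigraphD(4)[OF fitsD(1)[OF 0(1)] e] by fastforce
    then have "v \<in> V" using multigraphD(3)[OF fitsD(1)[OF 0(1)] e] by auto
    then have "degree E ends v = 0" using 0(3) by (simp add: dfc_def)
    then show False using e v fitsD(4)[OF 0(1)] by (auto simp: degree_def)
  qed
  then show ?case by (auto simp: colourable_def proper_edge_colouring_def)
next
  case (Suc q)
  note fit = Suc.prems(1) and reg = Suc.prems(3)
  note mg = fitsD(1)[OF fit] and finV = fitsD(3)[OF fit]
  obtain M where M: "M \<subseteq> E" "\<And>v. v \<in> V \<Longrightarrow> degree M ends v = 1"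
    using regular_perfect_matching[OF fit reg] by blast
  have mgM: "multigraph V M ends" using mg M(1) finite_subset by (auto simp: multigraph_def)
  have gp: "\<forall>X\<subseteq>V. odd (card X) \<longrightarrow> int q + int (card X) \<le> gap (Suc q) E ends X + 2 * int (induced_edges M ends X)"
  proof (intro allI impI)
    fix X assume X: "X \<subseteq> V" "odd (card X)"
    have finX: "finite X" using X(1) finV finite_subset by auto
    show "int q + int (card X) \<le> gap (Suc q) E ends X + 2 * int (induced_edges M ends X)"
    proof (rule odd_subset_cases[OF finV fitsD(2)[OF fit] X])
      fix v assume "v \<in> V" "X = {v}"
      then show ?thesis using gap_singleton[OF mg, of "Suc q" v] by simp
    next
      fix v assume v: "v \<in> V" "X = V - {v}"
      have "(\<Sum>u\<in>X. degree M ends u) = 2 * induced_edges M ends X + cut M ends X"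
        using multigraphD(2,4)[OF mgM] finX by (intro degree_sum)
      moreover have "(\<Sum>u\<in>X. degree M ends u) = card X" using M(2) X(1) by (simp add: subset_iff)
      moreover have "cut M ends X = 1"
        using cut_compl[OF mgM, of "{v}"] cut_singleton[OF mgM, of v] v M(2) by simp
      moreover have "gap (Suc q) E ends X = int (Suc q)"
        using gap_minus_vertex[OF mg v(1), of "Suc q"] reg v by simp
      ultimately show ?thesis by linarith
    next
      assume "3 \<le> card X" "card X + 3 \<le> card V"
      then show ?thesis using Suc.prems(2) by simp
    qed
  qed
  have "\<forall>v\<in>V. degree M ends v \<le> 1" "\<forall>v\<in>V. 2 \<le> dfc (Suc q) E ends v + int (degree M ends v) + 1"
    using M(2) reg by simp_all
  note rm = remove_matching[OF fit M(1) this gp]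
  have "colourable (E - M) ends q"
    by (rule Suc.IH[OF rm(1) Suc.prems(2)]) (use rm(2) M(2) reg in simp)
  then show ?case by (rule rm(3))
qed

lemma order_bound_4: "order_bound 4 0"
  unfolding order_bound_def
proof (intro allI impI)
  fix V E :: "nat set" and ends r
  assume fit: "fits V E ends r" and cV: "card V \<le> 4"
  have "colourable E ends r"
    by (rule fill_regular[OF _ fit cV]) (rule regular_colourable_4)
  then show "colourable E ends (r + 0)" by simp
qed

text \<open>Greedy colouring covers \<open>r <= 3\<close> with degrees at most \<open>r - 1\<close>,
  hence \<open>b = 4\<close>; then \<open>2 * n <= 3 * 4 + 4\<close> and \<open>n <= 4 + 4\<close>
  both stop at 8.\<close>

lemma order_bound_8: "order_bound 8 1"
proof -
  have "order_bound 8 (Suc 0)"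
  proof (rule order_step[OF order_bound_4, where b = 4])
    fix V E :: "nat set" and ends r
    assume fit: "fits V E ends r" and pos: "\<And>v. v \<in> V \<Longrightarrow> 1 \<le> dfc r E ends v" and r: "r + 1 \<le> 4"
    show "colourable E ends (r + 0)"
      by (rule colourable_greedy[OF fitsD(1)[OF fit], of "r - 1"]) (use pos r in \<open>force simp: dfc_def\<close>)+
  qed auto
  then show ?thesis by simp
qed

text \<open>The order bound at \<open>k\<close> needs the order bound at \<open>k - 1\<close> and
  the slack bound at \<open>k - 2\<close>; the slack bound at \<open>k\<close> needs the order bound
  at the same \<open>k\<close> and the slack bound at \<open>k - 1\<close>. Hence one joint
  induction, with the order bound proved first. The leading terms fit exactly: 5 (3/2) = 15/2, 45/4
  = 15/2 + 15/4 and 2 * 15/4 = 5 + 5/2.\<close>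

lemma geometric_bounds:
  "(1 \<le> k \<longrightarrow> (\<forall>n. even n \<longrightarrow> real n \<le> 5 * (3/2) ^ k + 2 \<longrightarrow> order_bound n k)) \<and>
   (\<forall>b. real b \<le> 15/4 * (3/2) ^ k + 2 \<longrightarrow> slack_bound b k)"
proof (induction k rule: less_induct)
  case (less k)
  have IHo: "order_bound n j" if "j < k" "1 \<le> j" "even n" "real n \<le> 5 * (3/2) ^ j + 2" for n j
    using less.IH[of j] that by blast
  have IHs: "slack_bound b j" if "j < k" "real b \<le> 15/4 * (3/2) ^ j + 2" for b j
    using less.IH[of j] that by blast
  \<comment> \<open>Orders must be even, and rounding down to an even number loses less than 2; the
    summand 2 in the order bound makes up for it.\<close>
  define ev where "ev x = 2 * nat \<lfloor>x / 2\<rfloor>" for x :: real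
  have ev: "even (ev x)" "real (ev x) \<le> x" "x - 2 < real (ev x)" if "0 \<le> x" for x
  proof -
    have "real (nat \<lfloor>x / 2\<rfloor>) = of_int \<lfloor>x / 2\<rfloor>" using that by simp
    then show "real (ev x) \<le> x" "x - 2 < real (ev x)" unfolding ev_def by (simp_all, linarith+)
  qed (simp add: ev_def)
  have order: "order_bound n k" if k: "1 \<le> k" and n: "even n" "real n \<le> 5 * (3/2) ^ k + 2" for n
  proof (cases "k = 1")
    case True
    have "n < 10" using n True by simp
    then have "n \<le> 8" using n(1) by presburger
    then show ?thesis using order_bound_mono[OF order_bound_8] True by simp
  next
    case False
    then obtain j where j: "k = Suc (Suc j)" using k by (cases k; cases "k - 1") auto
    define p where "p = (3/2 :: real) ^ j"
    have p1: "1 \<le> p" by (simp add: p_def)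
    have nk: "real n \<le> 45/4 * p + 2" using n(2) by (simp add: j p_def)
    define x where "x = 15/2 * p + 2"
    define a where "a = ev x"
    have x0: "0 \<le> x" using p1 by (simp add: x_def)
    have a: "even a" "real a \<le> x" "x - 2 < real a" using ev[OF x0] by (auto simp: a_def)
    define b where "b = nat \<lfloor>15/4 * p + 2\<rfloor>"
    have b: "real b \<le> 15/4 * p + 2" "15/4 * p + 1 < real b" using p1 unfolding b_def by linarith+
    have "order_bound n (Suc (Suc j))"
    proof (rule order_step)
      show "order_bound a (Suc j)" by (rule IHo) (use a j in \<open>auto simp: x_def p_def\<close>)
      show "even a" by (rule a(1))
      have "7 < real a" using a(3) p1 by (simp add: x_def)
      then show "4 \<le> a" by linarith
      have "real (2 * n) < real (3 * a + 4)" using nk a(3) by (simp add: x_def)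
      then show "2 * n \<le> 3 * a + 4" by linarith
      have "real n < real a + (15/4 * p + 2)" using nk a(3) by (simp add: x_def)
      then have "of_int (int n - int a) < 15/4 * p + 2" by simp
      then have "int n - int a \<le> \<lfloor>15/4 * p + 2\<rfloor>" by linarith
      then show "n \<le> a + b" unfolding b_def by linarith
    next
      fix V E :: "nat set" and ends r
      assume fit: "fits V E ends r" and pos: "\<And>v. v \<in> V \<Longrightarrow> 1 \<le> dfc r E ends v" and r: "r + 1 \<le> b"
      \<comment> \<open>One of the \<open>Suc j\<close> colours is added to \<open>r\<close>, which
        turns deficiencies of at least 1 into at least 2.\<close>
      have "slack_bound b j" by (rule IHs) (use b j in \<open>auto simp: p_def\<close>)
      moreover have "\<forall>v\<in>V. 2 \<le> dfc (Suc r) E ends v" using pos by (force simp: dfc_def)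
      moreover have "Suc r \<le> b" using r by simp
      ultimately have "colourable E ends (Suc r + j)"
        using fits_Suc[OF fit] unfolding slack_bound_def by blast
      then show "colourable E ends (r + Suc j)" by simp
    qed
    then show ?thesis by (simp add: j)
  qed
  have slack: "slack_bound b k" if b: "real b \<le> 15/4 * (3/2) ^ k + 2" for b
  proof -
    consider "k = 0" | "k = 1" | "k = 2" | "3 \<le> k" by linarith
    then show ?thesis
    proof cases
      case 1
      then have "b < 6" using b by simp
      then show ?thesis using 1 by (intro slack_bound_greedy) simp
    next
      case 2
      then have "b < 8" using b by simp
      moreover have "slack_bound 7 (Suc 0)"
      proof (rule slack_step)
        show "order_bound 8 (Suc 0)" using order_bound_8 by simp
        show "slack_bound 5 0" by (rule slack_bound_greedy) simp
      qed auto
      ultimately show ?thesis using 2 slack_bound_mono[of 7 1 b] by simp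
    next
      \<comment> \<open>The general estimate for \<open>b + 3 <= 2 * b'\<close> needs
        \<open>y >= 12/5\<close>, and (3/2)^2 is only 9/4; here the integers 10 and 7 just
        work.\<close>
      case 3
      then have "b < 11" using b by (simp add: power2_eq_square)
      moreover have "slack_bound 10 (Suc 1)"
      proof (rule slack_step)
        have "order_bound 12 2" using order[of 12] 3 by (simp add: power2_eq_square)
        then show "order_bound 12 (Suc 1)" by (simp add: numeral_2_eq_2)
        show "slack_bound 7 1" by (rule IHs) (use 3 in auto)
      qed auto
      ultimately show ?thesis using 3 slack_bound_mono[of 10 2 b] by (simp add: numeral_2_eq_2)
    next
      case 4
      then obtain j where j: "k = Suc j" "2 \<le> j" by (cases k) auto
      define y where "y = (3/2 :: real) ^ k"
      have "(3/2 :: real) ^ 3 \<le> y" unfolding y_def using 4 by (intro power_increasing) auto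
      then have y: "27/8 \<le> y" by (simp add: power3_eq_cube)
      define a where "a = ev (5 * y + 2)"
      have a: "even a" "real a \<le> 5 * y + 2" "5 * y < real a" using ev[of "5 * y + 2"] y by (auto simp: a_def)
      define b' where "b' = nat \<lfloor>5/2 * y + 2\<rfloor>"
      have b': "real b' \<le> 5/2 * y + 2" "5/2 * y + 1 < real b'" using y unfolding b'_def by linarith+
      have bb: "real b \<le> 15/4 * y + 2" using b by (simp add: y_def)
      have "slack_bound b (Suc j)"
      proof (rule slack_step)
        show "order_bound a (Suc j)" using order[of a] 4 a j by (simp add: y_def)
        show "slack_bound b' j" by (rule IHs) (use b' j in \<open>auto simp: y_def\<close>)
        show "even a" by (rule a(1))
        show "4 \<le> a" using a(3) y by linarith
        have "real (b + 3) \<le> real (2 * b')" using bb b' y by simp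
        then show "b + 3 \<le> 2 * b'" by linarith
        have "real (2 * b) < real (a + 2 + b' + 1)" using bb a b' by simp
        then show "2 * b \<le> a + 2 + b'" by linarith
        show "3 \<le> b'" using b' y by linarith
      qed
      then show ?thesis using j by simp
    qed
  qed
  show ?case using order slack by blast
qed

section \<open>Passing to the maximum of degree and density\<close>

text \<open>An odd order is made even by an isolated vertex. This adds no constraint on
  \<open>r\<close>: for an odd set through that vertex, the degree bounds on the others already give
  the required gap.\<close>

lemma nat_graph:
  fixes V :: "'a set" and E :: "'e set"
  assumes mg: "multigraph V E ends" and deg: "\<And>v. v \<in> V \<Longrightarrow> degree E ends v \<le> r"
    and odd: "\<And>X. X \<subseteq> V \<Longrightarrow> odd (card X) \<Longrightarrow> 3 \<le> card X \<Longrightarrow> 2 * induced_edges E ends X \<le> r * (card X - 1)"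
  shows "\<exists>(V' :: nat set) (E' :: nat set) ends'. fits V' E' ends' r \<and>
    card V' = (if even (card V) then card V else card V + 1) \<and> (\<forall>k. colourable E' ends' k \<longrightarrow> colourable E ends k)"
proof -
  have fin: "finite V" "finite E" using mg by (auto simp: multigraph_def)
  obtain f :: "'a \<Rightarrow> nat" where f: "inj_on f V" using fin(1) finite_imp_inj_to_nat_seg by metis
  obtain g :: "'e \<Rightarrow> nat" where g: "inj_on g E" using fin(2) finite_imp_inj_to_nat_seg by metis
  obtain u where u: "u \<notin> f ` V" using fin(1) ex_new_if_finite infinite_UNIV_nat by (metis finite_imageI)
  define V' where "V' = (if even (card V) then f ` V else insert u (f ` V))"
  define ends' where "ends' i = f ` ends (inv_into E g i)" for i
  have eg: "ends' (g e) = f ` ends e" if "e \<in> E" for e using that g by (simp add: ends'_def)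
  have eV: "ends e \<subseteq> V" "card (ends e) = 2" if "e \<in> E" for e using multigraphD(3,4)[OF mg that] .
  have cV: "card V' = (if even (card V) then card V else card V + 1)"
    using u fin(1) f by (simp add: V'_def card_image)
  have count: "card {i \<in> g ` E. Q (ends' i)} = card {e\<in>E. Q (f ` ends e)}" for Q
  proof -
    have "{i \<in> g ` E. Q (ends' i)} = g ` {e\<in>E. Q (f ` ends e)}" using eg by auto
    moreover have "inj_on g {e\<in>E. Q (f ` ends e)}" using g by (rule inj_on_subset) auto
    ultimately show ?thesis by (simp add: card_image)
  qed
  have mg': "multigraph V' (g ` E) ends'"
    unfolding multigraph_def
  proof (intro conjI ballI)
    show "finite V'" "finite (g ` E)" using fin by (auto simp: V'_def)
    fix i assume "i \<in> g ` E"
    then obtain e where e: "e \<in> E" "i = g e" by blast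
    have "f ` ends e \<subseteq> f ` V" using eV(1)[OF e(1)] by auto
    then show "ends' i \<subseteq> V'" using eg[OF e(1)] e by (auto simp: V'_def)
    have "inj_on f (ends e)" using f eV(1)[OF e(1)] by (rule inj_on_subset)
    then show "card (ends' i) = 2" using eg[OF e(1)] e eV(2)[OF e(1)] by (simp add: card_image)
  qed
  have deg': "degree (g ` E) ends' v \<le> r" if "v \<in> V'" for v
  proof (cases "v \<in> f ` V")
    case True
    then obtain w where w: "w \<in> V" "v = f w" by blast
    have "{e\<in>E. v \<in> f ` ends e} = {e\<in>E. w \<in> ends e}"
      using w f eV(1) by (auto dest: inj_onD)
    then have "degree (g ` E) ends' v = degree E ends w" unfolding degree_def using count[of "\<lambda>S. v \<in> S"] by simp
    then show ?thesis using deg[OF w(1)] by simp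
  next
    case False
    then have "{e\<in>E. v \<in> f ` ends e} = {}" using eV(1) by auto
    then have "card {e\<in>E. v \<in> f ` ends e} = 0" by (simp only: card.empty)
    then have "degree (g ` E) ends' v = 0" unfolding degree_def using count[of "\<lambda>S. v \<in> S"] by simp
    then show ?thesis by simp
  qed
  have "fits V' (g ` E) ends' r"
    unfolding fits_def
  proof (intro conjI ballI allI impI)
    show "multigraph V' (g ` E) ends'" by (rule mg')
    show "even (card V')" using cV by simp
    show "degree (g ` E) ends' v \<le> r" if "v \<in> V'" for v by (rule deg'[OF that])
    fix X assume X: "X \<subseteq> V'" "odd (card X)"
    have finX: "finite X" using X multigraphD(1)[OF mg'] finite_subset by auto
    show "int r \<le> gap r (g ` E) ends' X"
    proof (cases "X \<subseteq> f ` V")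
      case True
      then obtain Y where Y: "Y \<subseteq> V" "X = f ` Y" by (meson subset_imageE)
      have cY: "card X = card Y" using Y f by (metis card_image inj_on_subset)
      have "f ` ends e \<subseteq> X \<longleftrightarrow> ends e \<subseteq> Y" if "e \<in> E" for e
        unfolding Y(2) using inj_on_image_subset_iff[OF f eV(1)[OF that] Y(1)] by simp
      then have "{e\<in>E. f ` ends e \<subseteq> X} = {e\<in>E. ends e \<subseteq> Y}" by blast
      then have ind: "induced_edges (g ` E) ends' X = induced_edges E ends Y"
        unfolding induced_edges_def using count[of "\<lambda>S. S \<subseteq> X"] by simp
      show ?thesis
      proof (cases "card X = 1")
        case True
        then obtain v where "X = {v}" by (auto simp: card_1_singleton_iff)
        then show ?thesis using gap_singleton[OF mg', of r v] by simp
      next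
        case False
        then have c3: "3 \<le> card Y" "odd (card Y)" using X(2) cY by presburger+
        have "int (2 * induced_edges E ends Y) \<le> int (r * (card Y - 1))"
          using odd[OF Y(1) c3(2,1)] by (simp only: of_nat_le_iff)
        also have "\<dots> = int r * int (card Y) - int r" using c3 by (simp add: of_nat_diff algebra_simps)
        finally show ?thesis by (simp add: gap_def ind cY)
      qed
    next
      case False
      then have u': "u \<in> X" "X - {u} \<subseteq> f ` V" using X(1) by (auto simp: V'_def split: if_splits)
      let ?R = "X - {u}"
      have "(\<Sum>v\<in>?R. degree (g ` E) ends' v) = 2 * induced_edges (g ` E) ends' ?R + cut (g ` E) ends' ?R"
        using multigraphD(2,4)[OF mg'] finX by (intro degree_sum) auto
      moreover have "(\<Sum>v\<in>?R. degree (g ` E) ends' v) \<le> card ?R * r"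
        using sum_bounded_above[of ?R "degree (g ` E) ends'" r] deg' X(1) by auto
      ultimately have "2 * induced_edges (g ` E) ends' ?R \<le> card ?R * r" by linarith
      moreover have "induced_edges (g ` E) ends' X = induced_edges (g ` E) ends' ?R"
      proof -
        have "(f ` ends e \<subseteq> X) = (f ` ends e \<subseteq> ?R)" if "e \<in> E" for e using eV(1)[OF that] u by auto
        then have "{e\<in>E. f ` ends e \<subseteq> X} = {e\<in>E. f ` ends e \<subseteq> ?R}" by blast
        then show ?thesis unfolding induced_edges_def using count[of "\<lambda>S. S \<subseteq> X"] count[of "\<lambda>S. S \<subseteq> ?R"] by simp
      qed
      ultimately have "int (2 * induced_edges (g ` E) ends' X) \<le> int (card ?R * r)" by (simp only: of_nat_le_iff)
      moreover have "card X = card ?R + 1" using card.remove[OF finX u'(1)] by simp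
      ultimately show ?thesis by (simp add: gap_def algebra_simps)
    qed
  qed
  moreover have "colourable E ends k" if "colourable (g ` E) ends' k" for k
  proof -
    obtain c where c: "proper_edge_colouring (g ` E) ends' k c" using \<open>colourable (g ` E) ends' k\<close> by (auto simp: colourable_def)
    have "proper_edge_colouring E ends k (c \<circ> g)"
      unfolding proper_edge_colouring_def
    proof (intro conjI ballI impI)
      show "(c \<circ> g) e < k" if "e \<in> E" for e using c that by (auto simp: proper_edge_colouring_def)
      fix e h assume eh: "e \<in> E" "h \<in> E" "e \<noteq> h \<and> ends e \<inter> ends h \<noteq> {}"
      then have "g e \<noteq> g h" "ends' (g e) \<inter> ends' (g h) \<noteq> {}" using g eg by (auto dest: inj_onD)
      then show "(c \<circ> g) e \<noteq> (c \<circ> g) h" using c eh(1,2) by (auto simp: proper_edge_colouring_def)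
    qed
    then show ?thesis by (auto simp: colourable_def)
  qed
  ultimately show ?thesis using cV by blast
qed

section \<open>From integer bounds to the logarithm\<close>

lemma log_floor:
  assumes "1 \<le> (x :: real)"
  obtains k :: nat where "real k \<le> log (3/2) x" "x < (3/2) ^ Suc k"
proof
  define k where "k = nat \<lfloor>log (3/2) x\<rfloor>"
  have nn: "0 \<le> log (3/2) x" using assms by simp
  show "real k \<le> log (3/2) x" using nn by (simp add: k_def)
  have "log (3/2) x < real (Suc k)" using nn unfolding k_def by linarith
  then have "x < (3/2) powr real (Suc k)" using assms by (subst (asm) log_less_iff) auto
  then show "x < (3/2) ^ Suc k" by (simp add: powr_realpow del: of_nat_Suc)
qed

theorem theorem1:
  fixes V :: "'a set" and E :: "'e set" and ends :: "'e \<Rightarrow> 'a set"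
  assumes "multigraph V E ends"
    and "card V \<ge> 3"
    and "E \<noteq> {}"
  shows "(even (card V) \<longrightarrow>
            real (chromatic_index E ends) \<le> real_of_int (phi V E ends) +
              log (3/2) (min (real (card V) / 3) (real_of_int (phi V E ends))))
       \<and> (odd (card V) \<longrightarrow>
            real (chromatic_index E ends) \<le> real_of_int (phi V E ends) +
              log (3/2) (min ((real (card V) + 1) / 3) (real_of_int (phi V E ends))))"
proof -
  note mg = assms(1)
  have fin: "finite V" "finite E" using mg by (auto simp: multigraph_def)
  have deg_phi: "int (degree E ends v) \<le> phi V E ends" if "v \<in> V" for v
  proof -
    have "degree E ends v \<le> max_degree V E ends" unfolding max_degree_def using fin that by (intro Max_ge) auto
    then have "real (degree E ends v) \<le> frac_chromatic_index V E ends"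
      using assms(2) unfolding frac_chromatic_index_def by (simp add: max.coboundedI1)
    then show ?thesis unfolding phi_def by linarith
  qed
  obtain e where e: "e \<in> E" using assms(3) by blast
  then obtain v where v: "v \<in> ends e" "v \<in> V" using multigraphD(3,4)[OF mg e] by (metis card.empty ex_in_conv subsetD zero_neq_numeral)
  have "degree E ends v \<noteq> 0" using fin(2) e v by (auto simp: degree_def)
  then have phi1: "1 \<le> phi V E ends" using deg_phi[OF v(2)] by linarith
  define r where "r = nat (phi V E ends)"
  have r: "real_of_int (phi V E ends) = real r" "1 \<le> r" using phi1 by (auto simp: r_def)
  have deg: "degree E ends v \<le> r" if "v \<in> V" for v using deg_phi[OF that] by (simp add: r_def)
  have odd: "2 * induced_edges E ends X \<le> r * (card X - 1)" if X: "X \<subseteq> V" "odd (card X)" "3 \<le> card X" for X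
  proof -
    have "2 * real (induced_edges E ends X) / (real (card X) - 1) \<le> Gamma V E ends"
      unfolding Gamma_def using X fin(1) by (intro Max_ge finite_imageI) auto
    also have "\<dots> \<le> frac_chromatic_index V E ends"
      using assms(2) unfolding frac_chromatic_index_def by simp
    also have "\<dots> \<le> real r" unfolding r(1)[symmetric] phi_def by linarith
    finally have "2 * real (induced_edges E ends X) \<le> real r * (real (card X) - 1)"
      using X(3) by (simp add: divide_le_eq)
    also have "\<dots> = real (r * (card X - 1))" using X(3) by (simp add: of_nat_diff)
    finally have "real (2 * induced_edges E ends X) \<le> real (r * (card X - 1))" by simp
    then show ?thesis by (simp only: of_nat_le_iff)
  qed
  define m where "m = (if even (card V) then card V else card V + 1)"
  obtain V' E' :: "nat set" and ends' where fit: "fits V' E' ends' r" and cV': "card V' = m"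
    and transfer: "\<And>k. colourable E' ends' k \<Longrightarrow> colourable E ends k"
    using nat_graph[OF mg deg odd] unfolding m_def by blast
  have m: "even m" "4 \<le> m" using assms(2) by (auto simp: m_def)
  have chi: "chromatic_index E ends \<le> k" if "colourable E' ends' k" for k
    using transfer[OF that] unfolding chromatic_index_def colourable_def by (rule Least_le)
  have by_order: "real (chromatic_index E ends) \<le> real r + log (3/2) (real m / 3)"
  proof -
    obtain k where k: "real k \<le> log (3/2) (real m / 3)" "real m / 3 < (3/2) ^ Suc k"
      using log_floor[of "real m / 3"] m(2) by auto
    have "order_bound m k"
    proof (cases "k = 0")
      case True
      then have "m = 4" using k(2) m by simp
      then show ?thesis using order_bound_4 True by simp
    next
      case False
      \<comment> \<open>Here \<open>m\<close> is below 3 (3/2) (3/2)^k = 9/2 (3/2)^k.\<close>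
      have "real m \<le> 5 * (3/2) ^ k + 2" using k(2) zero_le_power[of "3/2 :: real" k] by simp
      then show ?thesis using geometric_bounds[of k] False m(1) by simp
    qed
    then have "colourable E' ends' (r + k)" using fit cV' unfolding order_bound_def by blast
    then show ?thesis using chi k(1) by fastforce
  qed
  have by_phi: "real (chromatic_index E ends) \<le> real r + log (3/2) (real r)"
  \<comment> \<open>The greedy \<open>2 * r - 1\<close> colours are good enough as long as (3/2)^(r
    - 1) is at most \<open>r\<close>; this holds up to 4 and fails at 5.\<close>
  proof (cases "r \<le> 4")
    case True
    have "colourable E' ends' (r + (r - 1))"
      by (rule colourable_greedy[OF fitsD(1)[OF fit], of r]) (use fitsD(5)[OF fit] r(2) in auto)
    then have "real (chromatic_index E ends) \<le> real r + real (r - 1)" using chi by fastforce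
    moreover have "(3/2 :: real) ^ (r - 1) \<le> real r"
    proof -
      have "r = 1 \<or> r = 2 \<or> r = 3 \<or> r = 4" using True r(2) by linarith
      then show ?thesis by (auto simp: power2_eq_square power3_eq_cube)
    qed
    then have "real (r - 1) \<le> log (3/2) (real r)"
      using r(2) by (subst le_log_iff) (auto simp: powr_realpow simp del: of_nat_diff)
    ultimately show ?thesis by linarith
  next
    case False
    obtain k where k: "real k \<le> log (3/2) (real r)" "real r < (3/2) ^ Suc k"
      using log_floor[of "real r"] r(2) by auto
    have "\<not> k \<le> 2"
    proof
      assume "k \<le> 2"
      then have "(3/2 :: real) ^ Suc k \<le> (3/2) ^ 3" by (intro power_increasing) auto
      then show False using k(2) False by (simp add: power3_eq_cube)
    qed
    \<comment> \<open>Two of the \<open>k\<close> additional colours produce deficiency 2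
      everywhere, and the slack bound takes the other \<open>j\<close>. It applies because (3/2)^3 =
      27/8 is below 15/4.\<close>
    then obtain j where j: "k = Suc (Suc j)" by (cases k; cases "k - 1") auto
    have "real (r + 2) \<le> 15/4 * (3/2) ^ j + 2" using k(2) zero_le_power[of "3/2 :: real" j] by (simp add: j)
    then have "slack_bound (r + 2) j" using geometric_bounds[of j] by blast
    moreover have "fits V' E' ends' (r + 2)" using fits_Suc[OF fits_Suc[OF fit]] by simp
    moreover have "\<forall>v\<in>V'. 2 \<le> dfc (r + 2) E' ends' v" using fitsD(5)[OF fit] by (auto simp: dfc_def)
    ultimately have "colourable E' ends' (r + 2 + j)" unfolding slack_bound_def by blast
    then show ?thesis using chi[of "r + 2 + j"] k(1) j by simp
  qed
  have "real (chromatic_index E ends) \<le> real r + log (3/2) (min (real m / 3) (real r))"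
    using by_order by_phi by (simp add: min_def)
  then show ?thesis unfolding r(1) m_def by (auto simp: add.commute)
qed

end
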